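(* The pro-$p$ completion of $\mathcal{L}_n$ is $\mathbb{F}_p[[\mathbb{Z}_p]]^n\rtimes\mathbb{Z}_p$, where $\mathbb{Z}_p$ is the pro-$p$ completion of $\mathbb{Z}$ and $\mathbb{F}_p[[\mathbb{Z}_p]]$ is the pro-$p$ completion of the ring $R=\mathbb{F}_p[\mathbb{Z}]$, which is also the projective limit $\varprojlim_m\mathbb{F}_p[\mathbb{Z}/p^m\mathbb{Z}]$.
   Context: $p$ is a fixed prime, $\mathbb{F}_p$ is the field with $p$ elements, and $n\ge 1$. $\mathcal{L}_n=(\mathbb{Z}/p\mathbb{Z})^n\wr\mathbb{Z}=\left(\bigoplus_{\mathbb{Z}}(\mathbb{Z}/p\mathbb{Z})^n\right)\rtimes\mathbb{Z}$, where the generator of $\mathbb{Z}$ acts by the shift by one. $R=\mathbb{F}_p[\mathbb{Z}]=\mathbb{F}_p[x,x^{-1}]$ is the group ring of $\mathbb{Z}$ over $\mathbb{F}_p$, that is, the ring of Laurent polynomials; equivalently $\mathcal{L}_n=R^n\rtimes\mathbb{Z}$ with the generator of $\mathbb{Z}$ acting by multiplication by $x$. The pro-$p$ completion of a group $G$ is the inverse limit of the quotients $G/N$ over all normal subgroups $N$ of index a power of $p$, with the projective limit topology. The source uses the phrase "pro-$p$ completion of the ring $R$" without giving a separate definition for rings. In the semidirect product, $\mathbb{Z}_p$ acts on each factor $\mathbb{F}_p[[\mathbb{Z}_p]]$ by multiplication by its elements viewed as group elements of $\mathbb{F}_p[[\mathbb{Z}_p]]$.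
   Formalization: The pro-p completion of the ring R, which the source leaves undefined, is taken over ideals I with R/I of p-power order in which the image of the group Z is a p-group; over all ideals of p-power index the claim would be false (e.g. p=2, I=(x^2+x+1)). *)

theory Defs
  imports
    "HOL-Algebra.Product_Groups"
    "HOL-Algebra.QuotRing"
    "HOL-Number_Theory.Residues"
    "HOL-Analysis.Function_Topology"
    "HOL-Analysis.Product_Topology"
begin

section \<open>Inverse limits of groups and rings\<close>

text \<open>
  An inverse system consists of an index set \<open>I\<close> with a preorder \<open>rel\<close>, objects \<open>A i\<close> and
  transition maps \<open>f j i\<close> from \<open>A j\<close> to \<open>A i\<close> whenever \<open>rel i j\<close>.  All limits below carry the
  projective limit topology of discrete objects.
\<close>

definition inv_lim ::
  "'i set \<Rightarrow> ('i \<Rightarrow> 'i \<Rightarrow> bool) \<Rightarrow> ('i \<Rightarrow> 'i \<Rightarrow> 'a \<Rightarrow> 'a) \<Rightarrow> ('i \<Rightarrow> 'a set) \<Rightarrow> ('i \<Rightarrow> 'a) set" where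
  "inv_lim I rel f A =
     {x \<in> \<Pi>\<^sub>E i\<in>I. A i. \<forall>i\<in>I. \<forall>j\<in>I. rel i j \<longrightarrow> f j i (x j) = x i}"

definition inv_lim_top ::
  "'i set \<Rightarrow> ('i \<Rightarrow> 'i \<Rightarrow> bool) \<Rightarrow> ('i \<Rightarrow> 'i \<Rightarrow> 'a \<Rightarrow> 'a) \<Rightarrow> ('i \<Rightarrow> 'a set) \<Rightarrow> ('i \<Rightarrow> 'a) topology" where
  "inv_lim_top I rel f A =
     subtopology (product_topology (\<lambda>i. discrete_topology (A i)) I) (inv_lim I rel f A)"

definition inv_lim_group ::
  "'i set \<Rightarrow> ('i \<Rightarrow> 'i \<Rightarrow> bool) \<Rightarrow> ('i \<Rightarrow> 'i \<Rightarrow> 'a \<Rightarrow> 'a) \<Rightarrow> ('i \<Rightarrow> 'a monoid) \<Rightarrow> ('i \<Rightarrow> 'a) monoid" where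
  "inv_lim_group I rel f G =
     (product_group I G)\<lparr>carrier := inv_lim I rel f (\<lambda>i. carrier (G i))\<rparr>"

definition inv_lim_ring ::
  "'i set \<Rightarrow> ('i \<Rightarrow> 'i \<Rightarrow> bool) \<Rightarrow> ('i \<Rightarrow> 'i \<Rightarrow> 'a \<Rightarrow> 'a) \<Rightarrow> ('i \<Rightarrow> 'a ring) \<Rightarrow> ('i \<Rightarrow> 'a) ring" where
  "inv_lim_ring I rel f R =
     \<lparr>carrier = inv_lim I rel f (\<lambda>i. carrier (R i)),
      monoid.mult = (\<lambda>x y. \<lambda>i\<in>I. x i \<otimes>\<^bsub>R i\<^esub> y i),
      one = (\<lambda>i\<in>I. \<one>\<^bsub>R i\<^esub>),
      ring.zero = (\<lambda>i\<in>I. \<zero>\<^bsub>R i\<^esub>),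
      ring.add = (\<lambda>x y. \<lambda>i\<in>I. x i \<oplus>\<^bsub>R i\<^esub> y i)\<rparr>"

definition top_group_iso ::
  "('a, 'x) monoid_scheme \<Rightarrow> 'a topology \<Rightarrow> ('b, 'y) monoid_scheme \<Rightarrow> 'b topology \<Rightarrow> ('a \<Rightarrow> 'b) set" where
  "top_group_iso G S H T = {h \<in> iso G H. homeomorphic_map S T h}"

definition top_ring_iso ::
  "('a, 'x) ring_scheme \<Rightarrow> 'a topology \<Rightarrow> ('b, 'y) ring_scheme \<Rightarrow> 'b topology \<Rightarrow> ('a \<Rightarrow> 'b) set" where
  "top_ring_iso R S Q T = {h \<in> ring_iso R Q. homeomorphic_map S T h}"


section \<open>Pro-p completion of a group\<close>

text \<open>Infinite index is excluded for \<open>p > 0\<close>, since an infinite set has \<open>card\<close> zero.\<close>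

definition pro_p_normals :: "nat \<Rightarrow> ('a, 'x) monoid_scheme \<Rightarrow> 'a set set" where
  "pro_p_normals p G = {N. N \<lhd> G \<and> (\<exists>k. card (rcosets\<^bsub>G\<^esub> N) = p ^ k)}"

text \<open>For \<open>M \<subseteq> N\<close> the projection from \<open>G/M\<close> to \<open>G/N\<close> sends a coset \<open>C\<close> to \<open>NC\<close>.\<close>

definition pro_p_completion :: "nat \<Rightarrow> ('a, 'x) monoid_scheme \<Rightarrow> ('a set \<Rightarrow> 'a set) monoid" where
  "pro_p_completion p G =
     inv_lim_group (pro_p_normals p G) (\<lambda>N M. M \<subseteq> N) (\<lambda>M N C. N <#>\<^bsub>G\<^esub> C) (\<lambda>N. G Mod N)"

definition pro_p_completion_top :: "nat \<Rightarrow> ('a, 'x) monoid_scheme \<Rightarrow> ('a set \<Rightarrow> 'a set) topology" where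
  "pro_p_completion_top p G =
     inv_lim_top (pro_p_normals p G) (\<lambda>N M. M \<subseteq> N) (\<lambda>M N C. N <#>\<^bsub>G\<^esub> C) (\<lambda>N. carrier (G Mod N))"

definition pro_p_map :: "nat \<Rightarrow> ('a, 'x) monoid_scheme \<Rightarrow> 'a \<Rightarrow> 'a set \<Rightarrow> 'a set" where
  "pro_p_map p G g = (\<lambda>N\<in>pro_p_normals p G. N #>\<^bsub>G\<^esub> g)"


section \<open>Group rings\<close>

definition group_ring :: "('k, 'y) ring_scheme \<Rightarrow> ('g, 'x) monoid_scheme \<Rightarrow> ('g \<Rightarrow> 'k) ring" where
  "group_ring K G =
     \<lparr>carrier = {f \<in> carrier G \<rightarrow>\<^sub>E carrier K. finite {g \<in> carrier G. f g \<noteq> \<zero>\<^bsub>K\<^esub>}},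
      monoid.mult = (\<lambda>f h. \<lambda>g\<in>carrier G.
        \<Oplus>\<^bsub>K\<^esub>a\<in>{a \<in> carrier G. f a \<noteq> \<zero>\<^bsub>K\<^esub>}. f a \<otimes>\<^bsub>K\<^esub> h (inv\<^bsub>G\<^esub> a \<otimes>\<^bsub>G\<^esub> g)),
      one = (\<lambda>g\<in>carrier G. if g = \<one>\<^bsub>G\<^esub> then \<one>\<^bsub>K\<^esub> else \<zero>\<^bsub>K\<^esub>),
      ring.zero = (\<lambda>g\<in>carrier G. \<zero>\<^bsub>K\<^esub>),
      ring.add = (\<lambda>f h. \<lambda>g\<in>carrier G. f g \<oplus>\<^bsub>K\<^esub> h g)\<rparr>"

definition group_elem :: "('k, 'y) ring_scheme \<Rightarrow> ('g, 'x) monoid_scheme \<Rightarrow> 'g \<Rightarrow> 'g \<Rightarrow> 'k" where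
  "group_elem K G a = (\<lambda>g\<in>carrier G. if g = a then \<one>\<^bsub>K\<^esub> else \<zero>\<^bsub>K\<^esub>)"

text \<open>The \<open>K\<close>-linear map \<open>K[G] \<rightarrow> K[H]\<close> induced by a homomorphism \<open>\<phi>\<close> from \<open>G\<close> to \<open>H\<close>.\<close>

definition group_ring_map ::
  "('k, 'y) ring_scheme \<Rightarrow> ('g, 'x) monoid_scheme \<Rightarrow> ('h, 'z) monoid_scheme \<Rightarrow> ('g \<Rightarrow> 'h) \<Rightarrow>
    ('g \<Rightarrow> 'k) \<Rightarrow> 'h \<Rightarrow> 'k" where
  "group_ring_map K G H \<phi> f =
     (\<lambda>h\<in>carrier H. \<Oplus>\<^bsub>K\<^esub>a\<in>{a \<in> carrier G. \<phi> a = h \<and> f a \<noteq> \<zero>\<^bsub>K\<^esub>}. f a)"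


section \<open>Pro-p completion of a group ring\<close>

text \<open>
  The quotients of \<open>K[G]\<close> that are admitted are the pro-p ones of the ring together with its group
  \<open>G\<close> of monomials: \<open>K[G]/I\<close> has p-power order and the image of \<open>G\<close> in its units is a p-group.
  The second condition cannot be dropped: the limit over all ideals of p-power index of
  \<open>\<FF>\<^sub>p[x, x\<^sup>-\<^sup>1]\<close> is the product of its completions at all maximal ideals, whereas
  \<open>\<FF>\<^sub>p[[\<int>\<^sub>p]]\<close> is the completion at \<open>x - 1\<close> only.
\<close>

definition pro_p_ideals :: "nat \<Rightarrow> ('k, 'y) ring_scheme \<Rightarrow> ('g, 'x) monoid_scheme \<Rightarrow> ('g \<Rightarrow> 'k) set set" where
  "pro_p_ideals p K G =
     {I. ideal I (group_ring K G) \<and>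
         (\<exists>k. card (a_rcosets\<^bsub>group_ring K G\<^esub> I) = p ^ k) \<and>
         (\<exists>k. card ((\<lambda>g. I +>\<^bsub>group_ring K G\<^esub> group_elem K G g) ` carrier G) = p ^ k)}"

definition pro_p_group_ring ::
  "nat \<Rightarrow> ('k, 'y) ring_scheme \<Rightarrow> ('g, 'x) monoid_scheme \<Rightarrow> (('g \<Rightarrow> 'k) set \<Rightarrow> ('g \<Rightarrow> 'k) set) ring" where
  "pro_p_group_ring p K G =
     inv_lim_ring (pro_p_ideals p K G) (\<lambda>I J. J \<subseteq> I)
       (\<lambda>J I C. I <+>\<^bsub>group_ring K G\<^esub> C) (\<lambda>I. group_ring K G Quot I)"

definition pro_p_group_ring_top ::
  "nat \<Rightarrow> ('k, 'y) ring_scheme \<Rightarrow> ('g, 'x) monoid_scheme \<Rightarrow> (('g \<Rightarrow> 'k) set \<Rightarrow> ('g \<Rightarrow> 'k) set) topology" where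
  "pro_p_group_ring_top p K G =
     inv_lim_top (pro_p_ideals p K G) (\<lambda>I J. J \<subseteq> I)
       (\<lambda>J I C. I <+>\<^bsub>group_ring K G\<^esub> C) (\<lambda>I. carrier (group_ring K G Quot I))"

definition pro_p_group_ring_map ::
  "nat \<Rightarrow> ('k, 'y) ring_scheme \<Rightarrow> ('g, 'x) monoid_scheme \<Rightarrow> ('g \<Rightarrow> 'k) \<Rightarrow> ('g \<Rightarrow> 'k) set \<Rightarrow> ('g \<Rightarrow> 'k) set" where
  "pro_p_group_ring_map p K G r = (\<lambda>I\<in>pro_p_ideals p K G. I +>\<^bsub>group_ring K G\<^esub> r)"


section \<open>Completed group algebras\<close>

text \<open>
  For a profinite group \<open>G\<close> with topology \<open>T\<close>, \<open>K[[G]]\<close> is the limit of \<open>K[G/U]\<close> over the open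
  normal subgroups \<open>U\<close>.
\<close>

definition open_normals :: "('g, 'x) monoid_scheme \<Rightarrow> 'g topology \<Rightarrow> 'g set set" where
  "open_normals G T = {U. U \<lhd> G \<and> openin T U}"

definition completed_group_ring ::
  "('k, 'y) ring_scheme \<Rightarrow> ('g, 'x) monoid_scheme \<Rightarrow> 'g topology \<Rightarrow> ('g set \<Rightarrow> 'g set \<Rightarrow> 'k) ring" where
  "completed_group_ring K G T =
     inv_lim_ring (open_normals G T) (\<lambda>U V. V \<subseteq> U)
       (\<lambda>V U. group_ring_map K (G Mod V) (G Mod U) (\<lambda>C. U <#>\<^bsub>G\<^esub> C))
       (\<lambda>U. group_ring K (G Mod U))"

definition completed_group_ring_top ::
  "('k, 'y) ring_scheme \<Rightarrow> ('g, 'x) monoid_scheme \<Rightarrow> 'g topology \<Rightarrow> ('g set \<Rightarrow> 'g set \<Rightarrow> 'k) topology" where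
  "completed_group_ring_top K G T =
     inv_lim_top (open_normals G T) (\<lambda>U V. V \<subseteq> U)
       (\<lambda>V U. group_ring_map K (G Mod V) (G Mod U) (\<lambda>C. U <#>\<^bsub>G\<^esub> C))
       (\<lambda>U. carrier (group_ring K (G Mod U)))"

text \<open>An element of \<open>G\<close> viewed as a group element of \<open>K[[G]]\<close>.\<close>

definition completed_group_elem ::
  "('k, 'y) ring_scheme \<Rightarrow> ('g, 'x) monoid_scheme \<Rightarrow> 'g topology \<Rightarrow> 'g \<Rightarrow> 'g set \<Rightarrow> 'g set \<Rightarrow> 'k" where
  "completed_group_elem K G T z =
     (\<lambda>U\<in>open_normals G T. group_elem K (G Mod U) (U #>\<^bsub>G\<^esub> z))"

text \<open>The map \<open>K[H] \<rightarrow> K[[G]]\<close> induced by a homomorphism \<open>\<phi>\<close> from \<open>H\<close> to \<open>G\<close>.\<close>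

definition completed_group_ring_map ::
  "('k, 'y) ring_scheme \<Rightarrow> ('h, 'z) monoid_scheme \<Rightarrow> ('g, 'x) monoid_scheme \<Rightarrow> 'g topology \<Rightarrow> ('h \<Rightarrow> 'g) \<Rightarrow>
    ('h \<Rightarrow> 'k) \<Rightarrow> 'g set \<Rightarrow> 'g set \<Rightarrow> 'k" where
  "completed_group_ring_map K H G T \<phi> r =
     (\<lambda>U\<in>open_normals G T. group_ring_map K H (G Mod U) (\<lambda>h. U #>\<^bsub>G\<^esub> \<phi> h) r)"


section \<open>The p-adic integers, and group rings over the prime field\<close>

definition Zp :: "nat \<Rightarrow> (nat \<Rightarrow> int) monoid" where
  "Zp p = inv_lim_group UNIV (\<le>) (\<lambda>j i a. a mod int p ^ i) (\<lambda>m. integer_mod_group (p ^ m))"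

definition Zp_top :: "nat \<Rightarrow> (nat \<Rightarrow> int) topology" where
  "Zp_top p = inv_lim_top UNIV (\<le>) (\<lambda>j i a. a mod int p ^ i) (\<lambda>m. carrier (integer_mod_group (p ^ m)))"

definition Zp_map :: "nat \<Rightarrow> int \<Rightarrow> nat \<Rightarrow> int" where
  "Zp_map p k = (\<lambda>m. k mod int p ^ m)"

abbreviation Fp :: "nat \<Rightarrow> int ring" where
  "Fp p \<equiv> residue_ring (int p)"

text \<open>A Laurent polynomial is its coefficient function: \<open>f j\<close> is the coefficient of \<open>x\<^sup>j\<close>.\<close>

abbreviation Laurent :: "nat \<Rightarrow> (int \<Rightarrow> int) ring" where
  "Laurent p \<equiv> group_ring (Fp p) integer_group"

abbreviation Fp_Zp :: "nat \<Rightarrow> ((nat \<Rightarrow> int) set \<Rightarrow> (nat \<Rightarrow> int) set \<Rightarrow> int) ring" where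
  "Fp_Zp p \<equiv> completed_group_ring (Fp p) (Zp p) (Zp_top p)"

abbreviation Fp_Zp_top :: "nat \<Rightarrow> ((nat \<Rightarrow> int) set \<Rightarrow> (nat \<Rightarrow> int) set \<Rightarrow> int) topology" where
  "Fp_Zp_top p \<equiv> completed_group_ring_top (Fp p) (Zp p) (Zp_top p)"

abbreviation Fp_Zp_map :: "nat \<Rightarrow> (int \<Rightarrow> int) \<Rightarrow> (nat \<Rightarrow> int) set \<Rightarrow> (nat \<Rightarrow> int) set \<Rightarrow> int" where
  "Fp_Zp_map p \<equiv> completed_group_ring_map (Fp p) integer_group (Zp p) (Zp_top p) (Zp_map p)"

text \<open>The projective limit of the rings \<open>\<FF>\<^sub>p[\<int>/p\<^sup>m\<int>]\<close> over \<open>m\<close>.\<close>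

definition lim_group_ring :: "nat \<Rightarrow> (nat \<Rightarrow> int \<Rightarrow> int) ring" where
  "lim_group_ring p =
     inv_lim_ring UNIV (\<le>)
       (\<lambda>j i. group_ring_map (Fp p) (integer_mod_group (p ^ j)) (integer_mod_group (p ^ i)) (\<lambda>a. a mod int p ^ i))
       (\<lambda>m. group_ring (Fp p) (integer_mod_group (p ^ m)))"

definition lim_group_ring_top :: "nat \<Rightarrow> (nat \<Rightarrow> int \<Rightarrow> int) topology" where
  "lim_group_ring_top p =
     inv_lim_top UNIV (\<le>)
       (\<lambda>j i. group_ring_map (Fp p) (integer_mod_group (p ^ j)) (integer_mod_group (p ^ i)) (\<lambda>a. a mod int p ^ i))
       (\<lambda>m. carrier (group_ring (Fp p) (integer_mod_group (p ^ m))))"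

definition lim_group_ring_map :: "nat \<Rightarrow> (int \<Rightarrow> int) \<Rightarrow> nat \<Rightarrow> int \<Rightarrow> int" where
  "lim_group_ring_map p r =
     (\<lambda>m. group_ring_map (Fp p) integer_group (integer_mod_group (p ^ m)) (\<lambda>a. a mod int p ^ m) r)"


section \<open>Semidirect products and the wreath product\<close>

definition semidirect ::
  "('a, 'x) monoid_scheme \<Rightarrow> ('b, 'y) monoid_scheme \<Rightarrow> ('b \<Rightarrow> 'a \<Rightarrow> 'a) \<Rightarrow> ('a \<times> 'b) monoid" where
  "semidirect N H act =
     \<lparr>carrier = carrier N \<times> carrier H,
      monoid.mult = (\<lambda>(a, h) (b, k). (a \<otimes>\<^bsub>N\<^esub> act h b, h \<otimes>\<^bsub>H\<^esub> k)),
      one = (\<one>\<^bsub>N\<^esub>, \<one>\<^bsub>H\<^esub>)\<rparr>"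

definition wreath_int :: "('a, 'x) monoid_scheme \<Rightarrow> ((int \<Rightarrow> 'a) \<times> int) monoid" where
  "wreath_int A =
     semidirect (sum_group (UNIV :: int set) (\<lambda>_. A)) integer_group (\<lambda>k f j. f (j - k))"

definition lamplighter :: "nat \<Rightarrow> nat \<Rightarrow> ((int \<Rightarrow> nat \<Rightarrow> int) \<times> int) monoid" where
  "lamplighter p n = wreath_int (product_group {..<n} (\<lambda>_. integer_mod_group p))"

definition Fp_Zp_semidirect ::
  "nat \<Rightarrow> nat \<Rightarrow> ((nat \<Rightarrow> (nat \<Rightarrow> int) set \<Rightarrow> (nat \<Rightarrow> int) set \<Rightarrow> int) \<times> (nat \<Rightarrow> int)) monoid" where
  "Fp_Zp_semidirect p n =
     semidirect (product_group {..<n} (\<lambda>_. add_monoid (Fp_Zp p))) (Zp p)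
       (\<lambda>z v. \<lambda>i\<in>{..<n}. completed_group_elem (Fp p) (Zp p) (Zp_top p) z \<otimes>\<^bsub>Fp_Zp p\<^esub> v i)"

definition Fp_Zp_semidirect_top ::
  "nat \<Rightarrow> nat \<Rightarrow> ((nat \<Rightarrow> (nat \<Rightarrow> int) set \<Rightarrow> (nat \<Rightarrow> int) set \<Rightarrow> int) \<times> (nat \<Rightarrow> int)) topology" where
  "Fp_Zp_semidirect_top p n =
     prod_topology (product_topology (\<lambda>_. Fp_Zp_top p) {..<n}) (Zp_top p)"

text \<open>
  The natural map from the wreath product; the \<open>i\<close>-th coordinates of \<open>f\<close> form the Laurent
  polynomial \<open>\<lambda>j. f j i\<close>, on which the shift by one is multiplication by \<open>x\<close>.
\<close>

definition Fp_Zp_semidirect_map ::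
  "nat \<Rightarrow> nat \<Rightarrow> (int \<Rightarrow> nat \<Rightarrow> int) \<times> int \<Rightarrow> (nat \<Rightarrow> (nat \<Rightarrow> int) set \<Rightarrow> (nat \<Rightarrow> int) set \<Rightarrow> int) \<times> (nat \<Rightarrow> int)" where
  "Fp_Zp_semidirect_map p n =
     (\<lambda>(f, k). (\<lambda>i\<in>{..<n}. Fp_Zp_map p (\<lambda>j. f j i), Zp_map p k))"

end

theory Submission
  imports Defs
begin

text \<open>
  Both sides of each isomorphism are completions of the same discrete object along the same
  sequence of finite levels: \<open>\<int>\<close> modulo \<open>p^m\<close>, the Laurent polynomials modulo \<open>1 - x^(p^m)\<close>, and the
  combination of the two for the lamplighter group.  Such a completion is unique, and the limit over
  a directed family of quotients is one as soon as the levels are cofinal in the family.  For the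
  pro-p families this holds because in a quotient of order \<open>p^m\<close> the shift has order dividing \<open>p^m\<close>,
  so that \<open>x^(p^m)\<close> acts trivially.
\<close>


section \<open>Completions along a sequence of finite levels\<close>

text \<open>A completion is described by a relation \<open>P\<close> and not by maps to quotients,
  because the two sides of an isomorphism are limits over different families: normal subgroups,
  ideals, open subgroups of the p-adic integers, natural numbers. What they share is
  \<open>\<psi>\<close>, a map on the discrete object whose fibres are the classes of each level.
  With the same \<open>\<psi>\<close> on both sides, a point is sent to the point with the same
  approximations, and every operation respected by the levels is preserved. The main obstacle is
  cofinality. That \<open>x^(p^m)\<close> acts trivially on a quotient is not yet enough: whatever
  dies at level \<open>m\<close> must be a multiple of \<open>1 - x^(p^m)\<close> with a Laurent
  polynomial as cofactor. The cofactor of \<open>f\<close> solves \<open>g = f + x^(p^m) g\<close>,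
  and a solution of finite support exists exactly when the coefficients of \<open>f\<close> sum to
  zero modulo \<open>p\<close> along each residue class. In the ring the equation puts
  \<open>f\<close> into an ideal; in the lamplighter group it reads as a commutator
  identity.\<close>

text \<open>
  \<open>P m x g\<close> says that the point \<open>x\<close> of the completion and the element \<open>g\<close> of the dense set agree at
  level \<open>m\<close>, and \<open>\<psi> m g\<close> is the class of \<open>g\<close> at level \<open>m\<close>.
\<close>

locale completion =
  fixes L :: "'l set" and T :: "'l topology" and G :: "'g set"
    and \<psi> :: "nat \<Rightarrow> 'g \<Rightarrow> 'q" and P :: "nat \<Rightarrow> 'l \<Rightarrow> 'g \<Rightarrow> bool"
  assumes topspace_eq: "topspace T = L"
    and ex_approx: "x \<in> L \<Longrightarrow> \<exists>g\<in>G. P m x g"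
    and approx_iff: "x \<in> L \<Longrightarrow> g \<in> G \<Longrightarrow> h \<in> G \<Longrightarrow> P m x g \<Longrightarrow> P m x h \<longleftrightarrow> \<psi> m g = \<psi> m h"
    and approx_Suc: "x \<in> L \<Longrightarrow> g \<in> G \<Longrightarrow> P (Suc m) x g \<Longrightarrow> P m x g"
    and separated: "x \<in> L \<Longrightarrow> y \<in> L \<Longrightarrow> (\<And>m. \<exists>g\<in>G. P m x g \<and> P m y g) \<Longrightarrow> x = y"
    and complete: "(\<And>m. s m \<in> G) \<Longrightarrow> (\<And>m. \<psi> m (s (Suc m)) = \<psi> m (s m)) \<Longrightarrow> \<exists>x\<in>L. \<forall>m. P m x (s m)"
    and openin_iff_cylinder:
      "U \<subseteq> L \<Longrightarrow> openin T U \<longleftrightarrow> (\<forall>x\<in>U. \<exists>m. {y \<in> L. \<exists>g\<in>G. P m x g \<and> P m y g} \<subseteq> U)"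
begin

definition cylinder :: "nat \<Rightarrow> 'l \<Rightarrow> 'l set" where
  "cylinder m x = {y \<in> L. \<exists>g\<in>G. P m x g \<and> P m y g}"

lemma openin_iff: "openin T U \<longleftrightarrow> U \<subseteq> L \<and> (\<forall>x\<in>U. \<exists>m. cylinder m x \<subseteq> U)"
  using openin_iff_cylinder openin_subset[of T U] unfolding topspace_eq cylinder_def by blast

lemma approx_antimono: "m \<le> m' \<Longrightarrow> x \<in> L \<Longrightarrow> g \<in> G \<Longrightarrow> P m' x g \<Longrightarrow> P m x g"
  by (induction m' rule: dec_induct) (auto intro: approx_Suc)

lemma cylinder_antimono: "m \<le> m' \<Longrightarrow> x \<in> L \<Longrightarrow> cylinder m' x \<subseteq> cylinder m x"
  unfolding cylinder_def using approx_antimono by blast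

lemma mem_cylinder_self: "x \<in> L \<Longrightarrow> x \<in> cylinder m x"
  unfolding cylinder_def using ex_approx by blast

text \<open>The level-\<open>m\<close> approximations of a point form exactly one fibre of
  \<open>\<psi> m\<close> in \<open>G\<close>, so sharing one approximation with \<open>x\<close> is
  the same as sharing all of them.\<close>

lemma cylinder_eq: "x \<in> L \<Longrightarrow> g \<in> G \<Longrightarrow> P m x g \<Longrightarrow> cylinder m x = {y \<in> L. P m y g}"
  unfolding cylinder_def using approx_iff by blast

text \<open>Cylinders behave like ultrametric balls: each is the cylinder of any of its
  points.\<close>

lemma openin_cylinder:
  assumes "x \<in> L" shows "openin T (cylinder m x)"
proof -
  obtain g where g: "g \<in> G" "P m x g"
    using ex_approx assms by blast
  show ?thesis
    unfolding openin_iff cylinder_eq[OF assms g] using cylinder_eq[OF _ g(1)] by blast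
qed

end

section \<open>Comparison of two completions with the same levels\<close>

locale completion_pair =
  one: completion L1 T1 G \<psi> P1 + two: completion L2 T2 G \<psi> P2
  for L1 :: "'l set" and T1 and L2 :: "'k set" and T2
    and G :: "'g set" and \<psi> :: "nat \<Rightarrow> 'g \<Rightarrow> 'q" and P1 P2
begin

definition compare :: "'l \<Rightarrow> 'k" where
  "compare x = (THE y. y \<in> L2 \<and> (\<forall>m. \<forall>g\<in>G. P1 m x g \<longrightarrow> P2 m y g))"

text \<open>Approximations of \<open>x\<close> at all levels form a coherent sequence, which
  converges on the second side by completeness; separation there makes the limit unique.\<close>

lemma ex_compare:
  assumes x: "x \<in> L1"
  shows "\<exists>!y. y \<in> L2 \<and> (\<forall>m. \<forall>g\<in>G. P1 m x g \<longrightarrow> P2 m y g)"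
proof (rule ex_ex1I)
  obtain s where s: "\<And>m. s m \<in> G" "\<And>m. P1 m x (s m)"
    using one.ex_approx[OF x] by metis
  have "\<psi> m (s (Suc m)) = \<psi> m (s m)" for m
    using one.approx_iff[OF x] one.approx_Suc[OF x] s by blast
  with two.complete s(1) obtain y where y: "y \<in> L2" "\<And>m. P2 m y (s m)"
    by blast
  \<comment> \<open>So far \<open>y\<close> is approximated by the chosen \<open>s m\<close> only;
    any other approximation of \<open>x\<close> lies in the same class of
    \<open>\<psi> m\<close>.\<close>
  have "P2 m y g" if "g \<in> G" "P1 m x g" for m g
    using one.approx_iff[OF x s(1) that(1) s(2)] two.approx_iff[OF y(1) s(1) that(1) y(2)] that(2)
    by blast
  with y(1) show "\<exists>y. y \<in> L2 \<and> (\<forall>m. \<forall>g\<in>G. P1 m x g \<longrightarrow> P2 m y g)"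
    by blast
next
  fix y z
  assume "y \<in> L2 \<and> (\<forall>m. \<forall>g\<in>G. P1 m x g \<longrightarrow> P2 m y g)" "z \<in> L2 \<and> (\<forall>m. \<forall>g\<in>G. P1 m x g \<longrightarrow> P2 m z g)"
  then show "y = z"
    using two.separated one.ex_approx[OF x] by metis
qed

lemma compare_in: "x \<in> L1 \<Longrightarrow> compare x \<in> L2"
  and compare_approx: "x \<in> L1 \<Longrightarrow> g \<in> G \<Longrightarrow> P1 m x g \<Longrightarrow> P2 m (compare x) g"
  using theI'[OF ex_compare, folded compare_def] by blast+

lemma compare_eqI:
  assumes x: "x \<in> L1" and y: "y \<in> L2" and "\<And>m. \<exists>g\<in>G. P1 m x g \<and> P2 m y g"
  shows "compare x = y"
  using assms compare_approx[OF x] by (intro two.separated compare_in) blast+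

text \<open>At each level both sides are approximated by the same element \<open>opG g h\<close>,
  and separation does the rest. The operation is a parameter so that ring addition and all
  multiplications are instances.\<close>

lemma compare_op:
  assumes op1: "\<And>m g h. g \<in> G \<Longrightarrow> h \<in> G \<Longrightarrow> P1 m x g \<Longrightarrow> P1 m y h \<Longrightarrow> P1 m (op1 x y) (opG g h)"
    and op2: "\<And>m g h. g \<in> G \<Longrightarrow> h \<in> G \<Longrightarrow> P2 m (compare x) g \<Longrightarrow> P2 m (compare y) h \<Longrightarrow>
      P2 m (op2 (compare x) (compare y)) (opG g h)"
    and opG: "\<And>g h. g \<in> G \<Longrightarrow> h \<in> G \<Longrightarrow> opG g h \<in> G"
    and "op1 x y \<in> L1" "op2 (compare x) (compare y) \<in> L2"
    and x: "x \<in> L1" and y: "y \<in> L1"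
  shows "compare (op1 x y) = op2 (compare x) (compare y)"
proof (rule compare_eqI)
  fix m
  obtain g where g: "g \<in> G" "P1 m x g"
    using one.ex_approx[OF x] by blast
  obtain h where h: "h \<in> G" "P1 m y h"
    using one.ex_approx[OF y] by blast
  show "\<exists>g\<in>G. P1 m (op1 x y) g \<and> P2 m (op2 (compare x) (compare y)) g"
    using opG[OF g(1) h(1)] op1[OF g(1) h(1) g(2) h(2)]
      op2[OF g(1) h(1) compare_approx[OF x g] compare_approx[OF y h]] by blast
qed fact+

text \<open>The comparison maps the cylinder of level \<open>m\<close> around \<open>x\<close> into
  the cylinder of the same level around its image.\<close>

lemma continuous_map_compare: "continuous_map T1 T2 compare"
  unfolding continuous_map_def one.topspace_eq two.topspace_eq
proof (intro conjI allI impI)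
  show "compare \<in> L1 \<rightarrow> L2"
    using compare_in by blast
next
  fix U assume U: "openin T2 U"
  show "openin T1 {x \<in> L1. compare x \<in> U}"
    unfolding one.openin_iff
  proof (intro conjI ballI)
    fix x assume "x \<in> {x \<in> L1. compare x \<in> U}"
    then have x: "x \<in> L1" "compare x \<in> U"
      by auto
    then obtain m where m: "two.cylinder m (compare x) \<subseteq> U"
      using U two.openin_iff by blast
    have "one.cylinder m x \<subseteq> {x \<in> L1. compare x \<in> U}"
      using m x compare_approx compare_in unfolding one.cylinder_def two.cylinder_def by blast
    then show "\<exists>m. one.cylinder m x \<subseteq> {x \<in> L1. compare x \<in> U}"
      by blast
  qed auto
qed

end

text \<open>The hypotheses are symmetric in the two sides, so a comparison backwards exists as well;
  the round trip preserves approximations and is therefore the identity.\<close>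

lemma (in completion_pair) homeomorphic_map_compare: "homeomorphic_map T1 T2 compare"
proof -
  interpret swap: completion_pair L2 T2 L1 T1 G \<psi> P2 P1 ..
  have "homeomorphic_maps T1 T2 compare swap.compare"
    unfolding homeomorphic_maps_def one.topspace_eq two.topspace_eq
  proof (intro conjI ballI)
    fix x assume x: "x \<in> L1"
    then show "swap.compare (compare x) = x"
      using one.ex_approx compare_approx by (intro swap.compare_eqI compare_in) blast+
  next
    fix x assume x: "x \<in> L2"
    then show "compare (swap.compare x) = x"
      using two.ex_approx swap.compare_approx by (intro compare_eqI swap.compare_in) blast+
  qed (rule continuous_map_compare swap.continuous_map_compare)+
  then show ?thesis
    using homeomorphic_maps_map by blast
qed

lemma (in completion_pair) bij_betw_compare: "bij_betw compare L1 L2"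
  using homeomorphic_map_compare homeomorphic_eq_everything_map[of T1 T2 compare]
  unfolding bij_betw_def one.topspace_eq two.topspace_eq by blast

section \<open>Products and finite powers of completions\<close>

lemma completion_prod:
  assumes "completion L1 T1 G1 \<psi>1 P1" "completion L2 T2 G2 \<psi>2 P2"
  shows "completion (L1 \<times> L2) (prod_topology T1 T2) (G1 \<times> G2)
    (\<lambda>m g. (\<psi>1 m (fst g), \<psi>2 m (snd g))) (\<lambda>m x g. P1 m (fst x) (fst g) \<and> P2 m (snd x) (snd g))"
proof -
  interpret one: completion L1 T1 G1 \<psi>1 P1 by fact
  interpret two: completion L2 T2 G2 \<psi>2 P2 by fact
  let ?P = "\<lambda>m x g. P1 m (fst x) (fst g) \<and> P2 m (snd x) (snd g)"
  have cyl: "{y \<in> L1 \<times> L2. \<exists>g\<in>G1 \<times> G2. ?P m x g \<and> ?P m y g}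
      = one.cylinder m (fst x) \<times> two.cylinder m (snd x)"
    for m x unfolding one.cylinder_def two.cylinder_def by (auto; blast)
  show ?thesis
  proof
    show "topspace (prod_topology T1 T2) = L1 \<times> L2"
      by (simp add: one.topspace_eq two.topspace_eq)
  next
    fix x m assume "x \<in> L1 \<times> L2"
    then have "\<exists>g\<in>G1. P1 m (fst x) g" "\<exists>h\<in>G2. P2 m (snd x) h"
      using one.ex_approx two.ex_approx by (auto simp: mem_Times_iff)
    then show "\<exists>g\<in>G1 \<times> G2. ?P m x g"
      by auto
  next
    fix x g h m
    assume "x \<in> L1 \<times> L2" "g \<in> G1 \<times> G2" "h \<in> G1 \<times> G2" "?P m x g"
    then show "?P m x h \<longleftrightarrow> (\<psi>1 m (fst g), \<psi>2 m (snd g)) = (\<psi>1 m (fst h), \<psi>2 m (snd h))"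
      using one.approx_iff[of "fst x" "fst g" "fst h" m] two.approx_iff[of "snd x" "snd g" "snd h" m]
      by (auto simp: mem_Times_iff)
  next
    fix x g m
    assume "x \<in> L1 \<times> L2" "g \<in> G1 \<times> G2" "?P (Suc m) x g"
    then show "?P m x g"
      using one.approx_Suc two.approx_Suc by (auto simp: mem_Times_iff)
  next
    fix x y
    assume xy: "x \<in> L1 \<times> L2" "y \<in> L1 \<times> L2" "\<And>m. \<exists>g\<in>G1 \<times> G2. ?P m x g \<and> ?P m y g"
    have "fst x = fst y"
    proof (rule one.separated)
      show "\<exists>g\<in>G1. P1 m (fst x) g \<and> P1 m (fst y) g" for m
        using xy(3)[of m] by auto
    qed (use xy in auto)
    moreover have "snd x = snd y"
    proof (rule two.separated)
      show "\<exists>h\<in>G2. P2 m (snd x) h \<and> P2 m (snd y) h" for m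
        using xy(3)[of m] by auto
    qed (use xy in auto)
    ultimately show "x = y"
      by (rule prod_eqI)
  next
    fix s
    assume s: "\<And>m. s m \<in> G1 \<times> G2"
      "\<And>m. (\<psi>1 m (fst (s (Suc m))), \<psi>2 m (snd (s (Suc m)))) = (\<psi>1 m (fst (s m)), \<psi>2 m (snd (s m)))"
    have "\<exists>x\<in>L1. \<forall>m. P1 m x (fst (s m))"
      using s by (intro one.complete) (auto simp: mem_Times_iff)
    moreover have "\<exists>y\<in>L2. \<forall>m. P2 m y (snd (s m))"
      using s by (intro two.complete) (auto simp: mem_Times_iff)
    ultimately show "\<exists>x\<in>L1 \<times> L2. \<forall>m. ?P m x (s m)"
      by auto
  next
    fix U assume U: "U \<subseteq> L1 \<times> L2"
    show "openin (prod_topology T1 T2) U \<longleftrightarrow>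
      (\<forall>x\<in>U. \<exists>m. {y \<in> L1 \<times> L2. \<exists>g\<in>G1 \<times> G2. ?P m x g \<and> ?P m y g} \<subseteq> U)" (is "?l \<longleftrightarrow> ?r")
    proof
      assume ?l
      show ?r
      proof
        fix x assume "x \<in> U"
        then obtain a b V W where x: "x = (a, b)" "openin T1 V" "openin T2 W" "a \<in> V" "b \<in> W" "V \<times> W \<subseteq> U"
          using \<open>?l\<close> unfolding openin_prod_topology_alt by (metis surj_pair)
        then obtain m m' where m: "one.cylinder m a \<subseteq> V" "two.cylinder m' b \<subseteq> W"
          unfolding one.openin_iff two.openin_iff by blast
        have "a \<in> L1" "b \<in> L2"
          using U \<open>x \<in> U\<close> x by auto
        \<comment> \<open>One level has to serve both factors; cylinders shrink as the level grows,
          so the larger one does.\<close>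
        with m have "one.cylinder (max m m') a \<subseteq> V" "two.cylinder (max m m') b \<subseteq> W"
          using one.cylinder_antimono[of m "max m m'" a] two.cylinder_antimono[of m' "max m m'" b]
            by auto
        then have "one.cylinder (max m m') a \<times> two.cylinder (max m m') b \<subseteq> U"
          using x by blast
        then show "\<exists>m. {y \<in> L1 \<times> L2. \<exists>g\<in>G1 \<times> G2. ?P m x g \<and> ?P m y g} \<subseteq> U"
          unfolding cyl x(1) by auto
      qed
    next
      assume ?r
      show ?l
        unfolding openin_prod_topology_alt
      proof (intro allI impI)
        fix a b assume ab: "(a, b) \<in> U"
        then obtain m where "one.cylinder m a \<times> two.cylinder m b \<subseteq> U"
          using \<open>?r\<close> unfolding cyl by force
        moreover have a: "a \<in> L1" and b: "b \<in> L2"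
          using U ab by auto
        ultimately show "\<exists>V W. openin T1 V \<and> openin T2 W \<and> a \<in> V \<and> b \<in> W \<and> V \<times> W \<subseteq> U"
          using one.openin_cylinder[OF a, of m] two.openin_cylinder[OF b, of m]
            one.mem_cylinder_self[OF a, of m] two.mem_cylinder_self[OF b, of m]
          by (intro exI[of _ "one.cylinder m a"] exI[of _ "two.cylinder m b"]) simp
      qed
    qed
  qed
qed

text \<open>The dense set \<open>H\<close> need not consist of tuples: \<open>pr i\<close> reads off
  a coordinate and \<open>surj\<close> realises prescribed coordinates. This fits lamp
  configurations, which are indexed by position first and by coordinate second.\<close>

lemma completion_power:
  assumes "completion L T G \<psi> P" and I: "finite I"
    and pr: "\<And>i g. i \<in> I \<Longrightarrow> g \<in> H \<Longrightarrow> pr i g \<in> G"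
    and surj: "\<And>s. (\<And>i. i \<in> I \<Longrightarrow> s i \<in> G) \<Longrightarrow> \<exists>g\<in>H. \<forall>i\<in>I. pr i g = s i"
  shows "completion (\<Pi>\<^sub>E i\<in>I. L) (product_topology (\<lambda>_. T) I) H
    (\<lambda>m g. \<lambda>i\<in>I. \<psi> m (pr i g)) (\<lambda>m x g. \<forall>i\<in>I. P m (x i) (pr i g))"
proof -
  interpret completion L T G \<psi> P by fact
  have cyl: "{y \<in> \<Pi>\<^sub>E i\<in>I. L. \<exists>g\<in>H. (\<forall>i\<in>I. P m (x i) (pr i g)) \<and> (\<forall>i\<in>I. P m (y i) (pr i g))}
      = (\<Pi>\<^sub>E i\<in>I. cylinder m (x i))" for m x
  proof (intro equalityI subsetI)
    fix y assume y: "y \<in> (\<Pi>\<^sub>E i\<in>I. cylinder m (x i))"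
    then have "\<exists>g\<in>G. P m (x i) g \<and> P m (y i) g" if "i \<in> I" for i
      using PiE_mem[OF y that] unfolding cylinder_def by blast
    then obtain s where s: "\<And>i. i \<in> I \<Longrightarrow> s i \<in> G \<and> P m (x i) (s i) \<and> P m (y i) (s i)"
      by metis
    then obtain g where "g \<in> H" "\<forall>i\<in>I. pr i g = s i"
      using surj[of s] by blast
    with s y show "y \<in> {y \<in> \<Pi>\<^sub>E i\<in>I. L. \<exists>g\<in>H. (\<forall>i\<in>I. P m (x i) (pr i g)) \<and> (\<forall>i\<in>I. P m (y i) (pr i g))}"
      unfolding cylinder_def by (auto simp: PiE_iff intro!: bexI[of _ g])
  qed (use pr in \<open>auto simp: cylinder_def PiE_iff\<close>)
  show ?thesis
  proof
    show "topspace (product_topology (\<lambda>_. T) I) = (\<Pi>\<^sub>E i\<in>I. L)"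
      by (simp add: topspace_eq)
  next
    fix x m assume x: "x \<in> (\<Pi>\<^sub>E i\<in>I. L)"
    then have "\<exists>g\<in>G. P m (x i) g" if "i \<in> I" for i
      using ex_approx PiE_mem[OF x that] by blast
    then obtain s where s: "\<And>i. i \<in> I \<Longrightarrow> s i \<in> G \<and> P m (x i) (s i)"
      by metis
    then show "\<exists>g\<in>H. \<forall>i\<in>I. P m (x i) (pr i g)"
      using surj[of s] by metis
  next
    fix x g h m
    assume "x \<in> (\<Pi>\<^sub>E i\<in>I. L)" "g \<in> H" "h \<in> H" "\<forall>i\<in>I. P m (x i) (pr i g)"
    then show "(\<forall>i\<in>I. P m (x i) (pr i h)) \<longleftrightarrow> (\<lambda>i\<in>I. \<psi> m (pr i g)) = (\<lambda>i\<in>I. \<psi> m (pr i h))"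
      using approx_iff[of "x i" "pr i g" "pr i h" m for i] pr
      by (auto simp: PiE_iff fun_eq_iff restrict_def)
  next
    fix x g m
    assume "x \<in> (\<Pi>\<^sub>E i\<in>I. L)" "g \<in> H" "\<forall>i\<in>I. P (Suc m) (x i) (pr i g)"
    then show "\<forall>i\<in>I. P m (x i) (pr i g)"
      using approx_Suc pr by (auto simp: PiE_iff)
  next
    fix x y
    assume xy: "x \<in> (\<Pi>\<^sub>E i\<in>I. L)" "y \<in> (\<Pi>\<^sub>E i\<in>I. L)"
      "\<And>m. \<exists>g\<in>H. (\<forall>i\<in>I. P m (x i) (pr i g)) \<and> (\<forall>i\<in>I. P m (y i) (pr i g))"
    show "x = y"
    proof (rule PiE_ext[OF xy(1,2)])
      fix i assume i: "i \<in> I"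
      show "x i = y i"
        using xy(3) pr i by (intro separated PiE_mem[OF xy(1)] PiE_mem[OF xy(2)]) blast+
    qed
  next
    fix s
    assume s: "\<And>m. s m \<in> H" "\<And>m. (\<lambda>i\<in>I. \<psi> m (pr i (s (Suc m)))) = (\<lambda>i\<in>I. \<psi> m (pr i (s m)))"
    have "\<exists>x\<in>L. \<forall>m. P m x (pr i (s m))" if "i \<in> I" for i
    proof (rule complete)
      show "\<psi> m (pr i (s (Suc m))) = \<psi> m (pr i (s m))" for m
        using fun_cong[OF s(2), of m i] that by simp
    qed (use pr s that in auto)
    then obtain x where "\<And>i. i \<in> I \<Longrightarrow> x i \<in> L \<and> (\<forall>m. P m (x i) (pr i (s m)))"
      by metis
    then show "\<exists>x\<in>\<Pi>\<^sub>E i\<in>I. L. \<forall>m. \<forall>i\<in>I. P m (x i) (pr i (s m))"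
      by (intro bexI[of _ "restrict x I"]) auto
  next
    fix U assume U: "U \<subseteq> (\<Pi>\<^sub>E i\<in>I. L)"
    show "openin (product_topology (\<lambda>_. T) I) U \<longleftrightarrow>
      (\<forall>x\<in>U. \<exists>m. {y \<in> \<Pi>\<^sub>E i\<in>I. L. \<exists>g\<in>H. (\<forall>i\<in>I. P m (x i) (pr i g)) \<and> (\<forall>i\<in>I. P m (y i) (pr i g))} \<subseteq> U)"
      (is "?l \<longleftrightarrow> ?r")
      unfolding cyl
    proof
      assume ?l
      show "\<forall>x\<in>U. \<exists>m. (\<Pi>\<^sub>E i\<in>I. cylinder m (x i)) \<subseteq> U"
      proof
        fix x assume x: "x \<in> U"
        obtain V where V: "\<And>i. i \<in> I \<Longrightarrow> openin T (V i)" "x \<in> Pi\<^sub>E I V" "Pi\<^sub>E I V \<subseteq> U"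
          using \<open>?l\<close> x unfolding openin_product_topology_alt by metis
        have "\<exists>m. cylinder m (x i) \<subseteq> V i" if "i \<in> I" for i
          using V(1)[OF that] PiE_mem[OF V(2) that] unfolding openin_iff by blast
        then obtain m where m: "\<And>i. i \<in> I \<Longrightarrow> cylinder (m i) (x i) \<subseteq> V i"
          by metis
        \<comment> \<open>Finiteness of \<open>I\<close> provides a common level. For empty
          \<open>I\<close> the value of \<open>Max\<close> does not matter, as there is no
          coordinate to control.\<close>
        have "cylinder (Max (m ` I)) (x i) \<subseteq> V i" if i: "i \<in> I" for i
        proof -
          have "m i \<le> Max (m ` I)"
            using I i by simp
          moreover have "x i \<in> L"
            using U x i by blast
          ultimately show ?thesis
            using m[OF i] cylinder_antimono by blast
        qed
        then have "(\<Pi>\<^sub>E i\<in>I. cylinder (Max (m ` I)) (x i)) \<subseteq> Pi\<^sub>E I V"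
          by (rule PiE_mono)
        with V(3) show "\<exists>m. (\<Pi>\<^sub>E i\<in>I. cylinder m (x i)) \<subseteq> U"
          by blast
      qed
    next
      assume r: "\<forall>x\<in>U. \<exists>m. (\<Pi>\<^sub>E i\<in>I. cylinder m (x i)) \<subseteq> U"
      show ?l
      proof (subst openin_subopen, intro ballI)
        fix x assume x: "x \<in> U"
        then obtain m where m: "(\<Pi>\<^sub>E i\<in>I. cylinder m (x i)) \<subseteq> U"
          using r by blast
        have "openin (product_topology (\<lambda>_. T) I) (\<Pi>\<^sub>E i\<in>I. cylinder m (x i))"
          using I U x by (auto simp: openin_PiE_gen intro!: openin_cylinder)
        moreover have "x \<in> (\<Pi>\<^sub>E i\<in>I. cylinder m (x i))"
          using U x mem_cylinder_self by (auto simp: PiE_iff)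
        ultimately show "\<exists>W. openin (product_topology (\<lambda>_. T) I) W \<and> x \<in> W \<and> W \<subseteq> U"
          using m by blast
      qed
    qed
  qed
qed

section \<open>Inverse limits of quotients of a fixed object\<close>

locale inverse_system =
  fixes I :: "'i set" and rel :: "'i \<Rightarrow> 'i \<Rightarrow> bool" and f :: "'i \<Rightarrow> 'i \<Rightarrow> 'a \<Rightarrow> 'a" and A :: "'i \<Rightarrow> 'a set"
    and G :: "'g set" and \<psi> :: "nat \<Rightarrow> 'g \<Rightarrow> 'q" and \<iota> :: "'i \<Rightarrow> 'g \<Rightarrow> 'a" and c :: "nat \<Rightarrow> 'i"
  assumes rel_trans: "rel i j \<Longrightarrow> rel j k \<Longrightarrow> rel i k"
    and \<iota>_image: "i \<in> I \<Longrightarrow> \<iota> i ` G = A i"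
    and \<iota>_compat: "i \<in> I \<Longrightarrow> j \<in> I \<Longrightarrow> rel i j \<Longrightarrow> g \<in> G \<Longrightarrow> f j i (\<iota> j g) = \<iota> i g"
    and c_in: "c m \<in> I"
    and c_mono: "m \<le> m' \<Longrightarrow> rel (c m) (c m')"
    and c_cofinal: "i \<in> I \<Longrightarrow> \<exists>m. rel i (c m)"
    and \<iota>_eq_iff: "g \<in> G \<Longrightarrow> h \<in> G \<Longrightarrow> \<iota> (c m) g = \<iota> (c m) h \<longleftrightarrow> \<psi> m g = \<psi> m h"
begin

lemma lim_in: "x \<in> inv_lim I rel f A \<Longrightarrow> i \<in> I \<Longrightarrow> x i \<in> A i"
  and lim_coherent: "x \<in> inv_lim I rel f A \<Longrightarrow> i \<in> I \<Longrightarrow> j \<in> I \<Longrightarrow> rel i j \<Longrightarrow> f j i (x j) = x i"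
  and lim_extensional: "x \<in> inv_lim I rel f A \<Longrightarrow> x \<in> extensional I"
  unfolding inv_lim_def by (auto simp: PiE_def)

lemma limI:
  assumes "x \<in> extensional I" "\<And>i. i \<in> I \<Longrightarrow> x i \<in> A i"
    and "\<And>i j. i \<in> I \<Longrightarrow> j \<in> I \<Longrightarrow> rel i j \<Longrightarrow> f j i (x j) = x i"
  shows "x \<in> inv_lim I rel f A"
  using assms unfolding inv_lim_def by (auto simp: PiE_def)

lemma lim_rep:
  assumes "x \<in> inv_lim I rel f A" "i \<in> I" obtains g where "g \<in> G" "x i = \<iota> i g"
  using lim_in[OF assms] \<iota>_image[OF assms(2)] by auto

lemma lim_rel:
  assumes x: "x \<in> inv_lim I rel f A" and "i \<in> I" "j \<in> I" "rel i j" "g \<in> G" "x j = \<iota> j g"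
  shows "x i = \<iota> i g"
  using assms \<iota>_compat lim_coherent by metis

lemma \<iota>_in_lim: "g \<in> G \<Longrightarrow> (\<lambda>i\<in>I. \<iota> i g) \<in> inv_lim I rel f A"
  by (rule limI) (use \<iota>_image \<iota>_compat in auto)

text \<open>Representatives taken at the larger index \<open>j\<close> also represent the
  coordinates at \<open>i\<close>. Hence it suffices that the operations are compatible with
  \<open>\<iota>\<close>; nothing has to be shown about the transition maps as
  homomorphisms.\<close>

lemma op_in_lim:
  assumes op: "\<And>i g h. i \<in> I \<Longrightarrow> g \<in> G \<Longrightarrow> h \<in> G \<Longrightarrow> op i (\<iota> i g) (\<iota> i h) = \<iota> i (opG g h)"
    and opG: "\<And>g h. g \<in> G \<Longrightarrow> h \<in> G \<Longrightarrow> opG g h \<in> G"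
    and x: "x \<in> inv_lim I rel f A" and y: "y \<in> inv_lim I rel f A"
  shows "(\<lambda>i\<in>I. op i (x i) (y i)) \<in> inv_lim I rel f A"
proof (rule limI)
  fix i assume i: "i \<in> I"
  obtain g h where "g \<in> G" "h \<in> G" "x i = \<iota> i g" "y i = \<iota> i h"
    using lim_rep[OF x i] lim_rep[OF y i] by metis
  then show "(\<lambda>i\<in>I. op i (x i) (y i)) i \<in> A i"
    using op[OF i] opG \<iota>_image[OF i] i by auto
next
  fix i j assume ij: "i \<in> I" "j \<in> I" "rel i j"
  obtain g h where gh: "g \<in> G" "h \<in> G" "x j = \<iota> j g" "y j = \<iota> j h"
    using lim_rep[OF x ij(2)] lim_rep[OF y ij(2)] by metis
  have "x i = \<iota> i g" "y i = \<iota> i h"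
    using lim_rel[OF x ij gh(1,3)] lim_rel[OF y ij gh(2,4)] .
  with gh ij show "f j i ((\<lambda>i\<in>I. op i (x i) (y i)) j) = (\<lambda>i\<in>I. op i (x i) (y i)) i"
    using op opG \<iota>_compat by simp
qed auto

lemma \<psi>_antimono:
  assumes "m \<le> m'" "g \<in> G" "h \<in> G" "\<psi> m' g = \<psi> m' h"
  shows "\<psi> m g = \<psi> m h"
  using assms \<iota>_eq_iff \<iota>_compat[OF c_in c_in c_mono] by metis

lemma \<psi>_coherent:
  assumes s: "\<And>m. s m \<in> G" "\<And>m. \<psi> m (s (Suc m)) = \<psi> m (s m)" and "m \<le> m'"
  shows "\<psi> m (s m') = \<psi> m (s m)"
  using assms(3)
proof (induction m' rule: dec_induct)
  case (step k)
  then show ?case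
    using \<psi>_antimono[OF _ s(1) s(1) s(2)] by metis
qed simp

text \<open>Each index lies below some \<open>c m\<close>, so a point is determined by its
  coordinates along the chain, and these coordinates alone generate the topology.\<close>

lemma completion_inv_lim:
  "completion (inv_lim I rel f A) (inv_lim_top I rel f A) G \<psi> (\<lambda>m x g. x (c m) = \<iota> (c m) g)"
    (is "completion ?L ?T _ _ ?P")
proof
  show topspace: "topspace ?T = ?L"
    unfolding inv_lim_top_def by (auto simp: inv_lim_def)
  show "\<exists>g\<in>G. x (c m) = \<iota> (c m) g" if "x \<in> ?L" for x m
    using lim_rep[OF that c_in] by metis
  show "x (c m) = \<iota> (c m) h \<longleftrightarrow> \<psi> m g = \<psi> m h"
    if "g \<in> G" "h \<in> G" "x (c m) = \<iota> (c m) g" for x g h m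
    using that \<iota>_eq_iff by metis
  show "x (c m) = \<iota> (c m) g" if "x \<in> ?L" "g \<in> G" "x (c (Suc m)) = \<iota> (c (Suc m)) g" for x g m
    using lim_rel[OF that(1) c_in c_in c_mono that(2,3)] by simp
  show "x = y" if x: "x \<in> ?L" and y: "y \<in> ?L"
    and xy: "\<And>m. \<exists>g\<in>G. x (c m) = \<iota> (c m) g \<and> y (c m) = \<iota> (c m) g" for x y
  proof (rule extensionalityI[OF lim_extensional[OF x] lim_extensional[OF y]])
    fix i assume i: "i \<in> I"
    then obtain m g where "rel i (c m)" "g \<in> G" "x (c m) = \<iota> (c m) g" "y (c m) = \<iota> (c m) g"
      using c_cofinal xy by blast
    then show "x i = y i"
      using lim_rel[OF x i c_in] lim_rel[OF y i c_in] by metis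
  qed
  show "\<exists>x\<in>?L. \<forall>m. x (c m) = \<iota> (c m) (s m)"
    if s: "\<And>m. s m \<in> G" "\<And>m. \<psi> m (s (Suc m)) = \<psi> m (s m)" for s
  proof -
    obtain \<mu> where \<mu>: "\<And>i. i \<in> I \<Longrightarrow> rel i (c (\<mu> i))"
      using c_cofinal by metis
    \<comment> \<open>The class of \<open>s m\<close> at \<open>i\<close> is constant once
      \<open>c m\<close> lies above \<open>i\<close>, so the limit point does not depend on the
      choice of \<open>\<mu>\<close>.\<close>
    have s_eq: "\<iota> i (s m) = \<iota> i (s m')" if i: "i \<in> I" "rel i (c m)" "rel i (c m')" for i m m'
    proof -
      have *: "\<iota> i (s m) = \<iota> i (s m')" if "m \<le> m'" "rel i (c m)" for m m'
        using \<psi>_coherent[of s, OF s that(1)] \<iota>_eq_iff[OF s(1) s(1)] \<iota>_compat[OF i(1) c_in that(2) s(1)] by metis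
      show ?thesis
        using *[of m m'] *[of m' m] i by (metis linear)
    qed
    let ?x = "\<lambda>i\<in>I. \<iota> i (s (\<mu> i))"
    have "?x \<in> ?L"
    proof (rule limI)
      fix i j assume ij: "i \<in> I" "j \<in> I" "rel i j"
      have "\<iota> i (s (\<mu> j)) = \<iota> i (s (\<mu> i))"
        using ij \<mu> rel_trans by (intro s_eq) blast+
      then show "f j i (?x j) = ?x i"
        using \<iota>_compat[OF ij s(1)] ij by simp
    qed (use \<iota>_image s in auto)
    moreover have "?x (c m) = \<iota> (c m) (s m)" for m
      using s_eq[OF c_in \<mu>[OF c_in] c_mono] c_in by simp
    ultimately show ?thesis
      by blast
  qed
  fix U assume U: "U \<subseteq> ?L"
  let ?cyl = "\<lambda>m x. {y \<in> ?L. \<exists>g\<in>G. x (c m) = \<iota> (c m) g \<and> y (c m) = \<iota> (c m) g}"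
  let ?X = "product_topology (\<lambda>i. discrete_topology (A i)) I"
  have cyl: "?cyl m x = {y \<in> ?L. y (c m) = x (c m)}" if x: "x \<in> ?L" for m x
  proof -
    obtain g where "g \<in> G" "x (c m) = \<iota> (c m) g"
      using lim_rep[OF x c_in] by blast
    then show ?thesis
      by auto
  qed
  show "openin ?T U \<longleftrightarrow> (\<forall>x\<in>U. \<exists>m. ?cyl m x \<subseteq> U)"
  proof
    assume "openin ?T U"
    then obtain W where W: "openin ?X W" "U = W \<inter> ?L"
      unfolding inv_lim_top_def openin_subtopology by blast
    show "\<forall>x\<in>U. \<exists>m. ?cyl m x \<subseteq> U"
    proof
      fix x assume x: "x \<in> U"
      then obtain V where V: "finite {i \<in> I. V i \<noteq> A i}" "x \<in> Pi\<^sub>E I V" "Pi\<^sub>E I V \<subseteq> W"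
        using W unfolding openin_product_topology_alt by auto
      have xL: "x \<in> ?L"
        using x U by blast
      obtain \<mu> where \<mu>: "\<And>i. i \<in> I \<Longrightarrow> rel i (c (\<mu> i))"
        using c_cofinal by metis
      \<comment> \<open>A basic open set restricts only finitely many coordinates; \<open>m\<close>
        lies beyond the levels chosen for them. If there are none, the value is arbitrary and every
        coordinate falls under the first case below.\<close>
      define m where "m = Max (\<mu> ` {i \<in> I. V i \<noteq> A i})"
      have "y \<in> W" if y: "y \<in> ?L" "y (c m) = x (c m)" for y
      proof -
        have "y i \<in> V i" if i: "i \<in> I" for i
        proof (cases "V i = A i")
          case True
          then show ?thesis
            using lim_in[OF y(1) i] by simp
        next
          case False
          then have "\<mu> i \<le> m"
            unfolding m_def using V(1) i by (intro Max_ge) auto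
          then have "rel i (c m)"
            using \<mu>[OF i] c_mono rel_trans by blast
          then have "y i = x i"
            using lim_coherent[OF y(1) i c_in] lim_coherent[OF xL i c_in] y(2) by metis
          then show ?thesis
            using V(2) i by auto
        qed
        then have "y \<in> Pi\<^sub>E I V"
          using lim_extensional[OF y(1)] by (auto simp: PiE_def)
        with V(3) show ?thesis
          by blast
      qed
      then have "?cyl m x \<subseteq> U"
        unfolding cyl[OF xL] W(2) by blast
      then show "\<exists>m. ?cyl m x \<subseteq> U"
        by blast
    qed
  next
    assume r: "\<forall>x\<in>U. \<exists>m. ?cyl m x \<subseteq> U"
    show "openin ?T U"
    proof (subst openin_subopen, intro ballI)
      fix x assume x: "x \<in> U"
      then obtain m where m: "?cyl m x \<subseteq> U"
        using r by blast
      have xL: "x \<in> ?L"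
        using x U by blast
      \<comment> \<open>A cylinder is the preimage of a point under the projection to one discrete
        coordinate.\<close>
      have "continuous_map ?T (discrete_topology (A (c m))) (\<lambda>y. y (c m))"
        unfolding inv_lim_top_def
        using continuous_map_from_subtopology continuous_map_product_projection[OF c_in] by fastforce
      then have "openin ?T {y \<in> topspace ?T. y (c m) \<in> {x (c m)}}"
        by (rule openin_continuous_map_preimage) (use lim_in[OF xL c_in] in simp)
      moreover have "{y \<in> topspace ?T. y (c m) \<in> {x (c m)}} = ?cyl m x"
        unfolding topspace cyl[OF xL] by auto
      ultimately show "\<exists>W. openin ?T W \<and> x \<in> W \<and> W \<subseteq> U"
        using m xL cyl[OF xL] by (intro exI[of _ "?cyl m x"]) auto
    qed
  qed
qed

end


section \<open>Completions of groups and rings\<close>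

text \<open>The product of \<open>H\<close> is tied to that of \<open>G\<close> only through
  approximations, which by separation determines it. The embedding \<open>\<iota>\<close> is
  recorded so that the comparison can be shown to fix the dense object.\<close>

locale monoid_completion =
  completion "carrier H" T "carrier G" \<psi> P
  for H :: "('l, 'x) monoid_scheme" and T and G :: "('g, 'y) monoid_scheme"
    and \<psi> :: "nat \<Rightarrow> 'g \<Rightarrow> 'q" and P +
  fixes \<iota> :: "'g \<Rightarrow> 'l"
  assumes mult_in: "g \<in> carrier G \<Longrightarrow> h \<in> carrier G \<Longrightarrow> g \<otimes>\<^bsub>G\<^esub> h \<in> carrier G"
    and lim_mult_in: "x \<in> carrier H \<Longrightarrow> y \<in> carrier H \<Longrightarrow> x \<otimes>\<^bsub>H\<^esub> y \<in> carrier H"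
    and approx_mult: "x \<in> carrier H \<Longrightarrow> y \<in> carrier H \<Longrightarrow> g \<in> carrier G \<Longrightarrow> h \<in> carrier G \<Longrightarrow>
      P m x g \<Longrightarrow> P m y h \<Longrightarrow> P m (x \<otimes>\<^bsub>H\<^esub> y) (g \<otimes>\<^bsub>G\<^esub> h)"
    and embed_in: "g \<in> carrier G \<Longrightarrow> \<iota> g \<in> carrier H"
    and approx_embed: "g \<in> carrier G \<Longrightarrow> P m (\<iota> g) g"

text \<open>Ring homomorphisms have to preserve the unit; it is transported as the image of the unit
  of \<open>G\<close> under the embedding.\<close>

locale ring_completion =
  monoid_completion H T G \<psi> P \<iota>
  for H :: "('l, 'x) ring_scheme" and T and G :: "('g, 'y) ring_scheme"
    and \<psi> :: "nat \<Rightarrow> 'g \<Rightarrow> 'q" and P \<iota> +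
  assumes add_in: "g \<in> carrier G \<Longrightarrow> h \<in> carrier G \<Longrightarrow> g \<oplus>\<^bsub>G\<^esub> h \<in> carrier G"
    and lim_add_in: "x \<in> carrier H \<Longrightarrow> y \<in> carrier H \<Longrightarrow> x \<oplus>\<^bsub>H\<^esub> y \<in> carrier H"
    and approx_add: "x \<in> carrier H \<Longrightarrow> y \<in> carrier H \<Longrightarrow> g \<in> carrier G \<Longrightarrow> h \<in> carrier G \<Longrightarrow>
      P m x g \<Longrightarrow> P m y h \<Longrightarrow> P m (x \<oplus>\<^bsub>H\<^esub> y) (g \<oplus>\<^bsub>G\<^esub> h)"
    and one_in: "\<one>\<^bsub>G\<^esub> \<in> carrier G"
    and embed_one: "\<iota> \<one>\<^bsub>G\<^esub> = \<one>\<^bsub>H\<^esub>"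

theorem top_group_iso_completions:
  assumes "monoid_completion H1 T1 G \<psi> P1 \<iota>1" "monoid_completion H2 T2 G \<psi> P2 \<iota>2"
  shows "\<exists>\<phi> \<in> top_group_iso H1 T1 H2 T2. \<forall>g \<in> carrier G. \<phi> (\<iota>1 g) = \<iota>2 g"
proof -
  interpret one: monoid_completion H1 T1 G \<psi> P1 \<iota>1 by fact
  interpret two: monoid_completion H2 T2 G \<psi> P2 \<iota>2 by fact
  interpret completion_pair "carrier H1" T1 "carrier H2" T2 "carrier G" \<psi> P1 P2 ..
  have "compare (x \<otimes>\<^bsub>H1\<^esub> y) = compare x \<otimes>\<^bsub>H2\<^esub> compare y"
    if x: "x \<in> carrier H1" and y: "y \<in> carrier H1" for x y
    by (rule compare_op[where opG = "monoid.mult G"])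
      (use x y one.mult_in one.lim_mult_in two.lim_mult_in one.approx_mult two.approx_mult compare_in in auto)
  then have "compare \<in> iso H1 H2"
    unfolding iso_def hom_def using bij_betw_compare compare_in by auto
  moreover have "compare (\<iota>1 g) = \<iota>2 g" if g: "g \<in> carrier G" for g
    using one.embed_in[OF g] two.embed_in[OF g] one.approx_embed[OF g] two.approx_embed[OF g] g
    by (intro compare_eqI) auto
  ultimately show ?thesis
    unfolding top_group_iso_def using homeomorphic_map_compare by blast
qed

theorem top_ring_iso_completions:
  assumes "ring_completion H1 T1 G \<psi> P1 \<iota>1" "ring_completion H2 T2 G \<psi> P2 \<iota>2"
  shows "\<exists>\<phi> \<in> top_ring_iso H1 T1 H2 T2. \<forall>g \<in> carrier G. \<phi> (\<iota>1 g) = \<iota>2 g"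
proof -
  interpret one: ring_completion H1 T1 G \<psi> P1 \<iota>1 by fact
  interpret two: ring_completion H2 T2 G \<psi> P2 \<iota>2 by fact
  interpret completion_pair "carrier H1" T1 "carrier H2" T2 "carrier G" \<psi> P1 P2 ..
  have "compare (x \<otimes>\<^bsub>H1\<^esub> y) = compare x \<otimes>\<^bsub>H2\<^esub> compare y"
    if x: "x \<in> carrier H1" and y: "y \<in> carrier H1" for x y
    by (rule compare_op[where opG = "monoid.mult G"])
      (use x y one.mult_in one.lim_mult_in two.lim_mult_in one.approx_mult two.approx_mult compare_in in auto)
  moreover have "compare (x \<oplus>\<^bsub>H1\<^esub> y) = compare x \<oplus>\<^bsub>H2\<^esub> compare y"
    if x: "x \<in> carrier H1" and y: "y \<in> carrier H1" for x y
    by (rule compare_op[where opG = "ring.add G"])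
      (use x y one.add_in one.lim_add_in two.lim_add_in one.approx_add two.approx_add compare_in in auto)
  moreover have embed: "compare (\<iota>1 g) = \<iota>2 g" if g: "g \<in> carrier G" for g
    using one.embed_in[OF g] two.embed_in[OF g] one.approx_embed[OF g] two.approx_embed[OF g] g
    by (intro compare_eqI) auto
  moreover have "compare \<one>\<^bsub>H1\<^esub> = \<one>\<^bsub>H2\<^esub>"
    using embed[OF one.one_in] one.embed_one two.embed_one by simp
  ultimately have "compare \<in> ring_iso H1 H2"
    unfolding ring_iso_def ring_hom_def using bij_betw_compare compare_in by auto
  with embed show ?thesis
    unfolding top_ring_iso_def using homeomorphic_map_compare by blast
qed

lemma monoid_completion_inv_lim:
  assumes "inverse_system I rel f (\<lambda>i. carrier (Q i)) (carrier G) \<psi> \<iota> c"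
    and mult: "\<And>i g h. i \<in> I \<Longrightarrow> g \<in> carrier G \<Longrightarrow> h \<in> carrier G \<Longrightarrow> \<iota> i g \<otimes>\<^bsub>Q i\<^esub> \<iota> i h = \<iota> i (g \<otimes>\<^bsub>G\<^esub> h)"
    and mult_in: "\<And>g h. g \<in> carrier G \<Longrightarrow> h \<in> carrier G \<Longrightarrow> g \<otimes>\<^bsub>G\<^esub> h \<in> carrier G"
  shows "monoid_completion (inv_lim_group I rel f Q) (inv_lim_top I rel f (\<lambda>i. carrier (Q i))) G \<psi>
    (\<lambda>m x g. x (c m) = \<iota> (c m) g) (\<lambda>g. \<lambda>i\<in>I. \<iota> i g)"
proof -
  interpret inverse_system I rel f "\<lambda>i. carrier (Q i)" "carrier G" \<psi> \<iota> c by fact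
  have carrier: "carrier (inv_lim_group I rel f Q) = inv_lim I rel f (\<lambda>i. carrier (Q i))"
    and mult_eq: "monoid.mult (inv_lim_group I rel f Q) = (\<lambda>x y. \<lambda>i\<in>I. x i \<otimes>\<^bsub>Q i\<^esub> y i)"
    by (simp_all add: inv_lim_group_def product_group_def)
  show ?thesis
    unfolding monoid_completion_def monoid_completion_axioms_def carrier mult_eq
    using completion_inv_lim op_in_lim[of "\<lambda>i. monoid.mult (Q i)" "monoid.mult G"] mult mult_in \<iota>_in_lim c_in by simp
qed

lemma ring_completion_inv_lim:
  assumes "inverse_system I rel f (\<lambda>i. carrier (Q i)) (carrier G) \<psi> \<iota> c"
    and "ring G"
    and mult: "\<And>i g h. i \<in> I \<Longrightarrow> g \<in> carrier G \<Longrightarrow> h \<in> carrier G \<Longrightarrow> \<iota> i g \<otimes>\<^bsub>Q i\<^esub> \<iota> i h = \<iota> i (g \<otimes>\<^bsub>G\<^esub> h)"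
    and add: "\<And>i g h. i \<in> I \<Longrightarrow> g \<in> carrier G \<Longrightarrow> h \<in> carrier G \<Longrightarrow> \<iota> i g \<oplus>\<^bsub>Q i\<^esub> \<iota> i h = \<iota> i (g \<oplus>\<^bsub>G\<^esub> h)"
    and one: "\<And>i. i \<in> I \<Longrightarrow> \<iota> i \<one>\<^bsub>G\<^esub> = \<one>\<^bsub>Q i\<^esub>"
  shows "ring_completion (inv_lim_ring I rel f Q) (inv_lim_top I rel f (\<lambda>i. carrier (Q i))) G \<psi>
    (\<lambda>m x g. x (c m) = \<iota> (c m) g) (\<lambda>g. \<lambda>i\<in>I. \<iota> i g)"
proof -
  interpret inverse_system I rel f "\<lambda>i. carrier (Q i)" "carrier G" \<psi> \<iota> c by fact
  interpret ring G by fact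
  have carrier: "carrier (inv_lim_ring I rel f Q) = inv_lim I rel f (\<lambda>i. carrier (Q i))"
    and mult_eq: "monoid.mult (inv_lim_ring I rel f Q) = (\<lambda>x y. \<lambda>i\<in>I. x i \<otimes>\<^bsub>Q i\<^esub> y i)"
    and add_eq: "ring.add (inv_lim_ring I rel f Q) = (\<lambda>x y. \<lambda>i\<in>I. x i \<oplus>\<^bsub>Q i\<^esub> y i)"
    and one_eq: "monoid.one (inv_lim_ring I rel f Q) = (\<lambda>i\<in>I. \<one>\<^bsub>Q i\<^esub>)"
    by (simp_all add: inv_lim_ring_def)
  show ?thesis
    unfolding ring_completion_def ring_completion_axioms_def
      monoid_completion_def monoid_completion_axioms_def carrier mult_eq add_eq one_eq
    using completion_inv_lim op_in_lim[of "\<lambda>i. monoid.mult (Q i)" "monoid.mult G"] op_in_lim[of "\<lambda>i. ring.add (Q i)" "ring.add G"]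
      mult add \<iota>_in_lim c_in one by (simp cong: restrict_cong)
qed


section \<open>Pro-p completions of groups\<close>

text \<open>Both images index the same partition of \<open>A\<close>. This replaces a count of
  cosets by a count of explicit normal forms.\<close>

lemma card_image_eq_card_image:
  assumes "\<And>x y. x \<in> A \<Longrightarrow> y \<in> A \<Longrightarrow> f x = f y \<longleftrightarrow> g x = g y"
  shows "card (f ` A) = card (g ` A)"
proof (rule bij_betw_same_card[of "\<lambda>z. g (inv_into A f z)"])
  have eq: "g (inv_into A f (f x)) = g x" if "x \<in> A" for x
    using assms[of "inv_into A f (f x)" x] that by (simp add: inv_into_into f_inv_into_f)
  show "bij_betw (\<lambda>z. g (inv_into A f z)) (f ` A) (g ` A)"
    unfolding bij_betw_def inj_on_def image_image using eq assms by (auto cong: image_cong)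
qed

lemma (in group) rcos_eq_iff:
  assumes H: "subgroup H G" and g: "g \<in> carrier G" and h: "h \<in> carrier G"
  shows "H #> g = H #> h \<longleftrightarrow> g \<otimes> inv h \<in> H"
proof
  assume "H #> g = H #> h"
  then have "H #> (g \<otimes> inv h) = H"
    by (rule coset_mult_inv2[OF _ g h subgroup.subset[OF H]])
  then show "g \<otimes> inv h \<in> H"
    by (rule coset_join1) (simp_all add: g h H)
next
  assume "g \<otimes> inv h \<in> H"
  then have "H #> (g \<otimes> inv h) = H"
    by (intro coset_join2) (simp_all add: g h H)
  then show "H #> g = H #> h"
    by (rule coset_mult_inv1[OF _ g h subgroup.subset[OF H]])
qed

text \<open>The map \<open>\<psi>\<close> is any labelling whose fibres are the classes of a
  congruence; its target carries no group structure. So remainders and coefficient functions can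
  serve as labels without building the quotient group first.\<close>

locale group_congruence = group G for G (structure) +
  fixes \<psi> :: "'a \<Rightarrow> 'q"
  assumes \<psi>_cong: "\<lbrakk>g \<in> carrier G; g' \<in> carrier G; h \<in> carrier G; h' \<in> carrier G; \<psi> g
      = \<psi> g'; \<psi> h = \<psi> h'\<rbrakk> \<Longrightarrow>
    \<psi> (g \<otimes> h) = \<psi> (g' \<otimes> h')"
begin

definition ker :: "'a set" where
  "ker = {g \<in> carrier G. \<psi> g = \<psi> \<one>}"

lemma \<psi>_eq_iff:
  assumes g: "g \<in> carrier G" and h: "h \<in> carrier G"
  shows "\<psi> g = \<psi> h \<longleftrightarrow> g \<otimes> inv h \<in> ker"
proof
  assume "\<psi> g = \<psi> h"
  then show "g \<otimes> inv h \<in> ker"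
    unfolding ker_def using \<psi>_cong[of g h "inv h" "inv h"] g h by simp
next
  assume "g \<otimes> inv h \<in> ker"
  then show "\<psi> g = \<psi> h"
    unfolding ker_def using \<psi>_cong[of "g \<otimes> inv h" \<one> h h] g h by (simp add: m_assoc)
qed

lemma subgroup_ker: "subgroup ker G"
proof (rule subgroupI)
  show "inv a \<in> ker" if "a \<in> ker" for a
    using that \<psi>_eq_iff[of \<one> a] by (auto simp: ker_def)
  show "a \<otimes> b \<in> ker" if "a \<in> ker" "b \<in> ker" for a b
    using that \<psi>_cong[of a \<one> b \<one>] by (auto simp: ker_def)
qed (auto simp: ker_def)

lemma normal_ker: "ker \<lhd> G"
  unfolding normal_inv_iff
proof (intro conjI ballI subgroup_ker)
  fix x h assume x: "x \<in> carrier G" and "h \<in> ker"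
  then have h: "h \<in> carrier G" "\<psi> h = \<psi> \<one>"
    by (auto simp: ker_def)
  have "\<psi> (x \<otimes> h) = \<psi> (x \<otimes> \<one>)"
    using x h by (intro \<psi>_cong) auto
  then show "x \<otimes> h \<otimes> inv x \<in> ker"
    using \<psi>_eq_iff[of "x \<otimes> h" x] x h by simp
qed

lemma ker_rcos_eq_iff:
  assumes g: "g \<in> carrier G" and h: "h \<in> carrier G"
  shows "ker #> g = ker #> h \<longleftrightarrow> \<psi> g = \<psi> h"
  unfolding \<psi>_eq_iff[OF g h] by (rule rcos_eq_iff[OF subgroup_ker g h])

lemma card_rcosets_ker: "card (rcosets ker) = card (\<psi> ` carrier G)"
proof -
  have "rcosets ker = (\<lambda>g. ker #> g) ` carrier G"
    by (auto simp: RCOSETS_def)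
  then show ?thesis
    using card_image_eq_card_image[of "carrier G" "\<lambda>g. ker #> g" \<psi>] ker_rcos_eq_iff by simp
qed

end

text \<open>Since \<open>N M = N\<close> for \<open>M \<subseteq> N\<close>, the projection sends
  the coset of \<open>g\<close> to the coset of \<open>g\<close>, which is the compatibility with
  \<open>\<iota>\<close> in the inverse system.\<close>

lemma (in group) normal_absorb:
  assumes N: "N \<lhd> G" and M: "M \<lhd> G" and "M \<subseteq> N" and g: "g \<in> carrier G"
  shows "N <#> (M #> g) = N #> g"
proof -
  interpret N: normal N G by fact
  interpret M: normal M G by fact
  have "N <#> (M #> g) = (N <#> M) #> g"
    using setmult_rcos_assoc[OF N.subset M.subset g] .
  also have "N <#> M = N"
  proof
    show "N <#> M \<subseteq> N"
      using \<open>M \<subseteq> N\<close> by (auto simp: set_mult_def)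
    show "N \<subseteq> N <#> M"
      using M.one_closed by (auto simp: set_mult_def intro!: bexI[of _ \<one>])
  qed
  finally show ?thesis .
qed

text \<open>The prime enters in the last two conditions: by \<open>card_\<psi>\<close> the kernels
  of the levels belong to the pro-p family, and by \<open>cofinal\<close> every member of the family
  contains one of them.\<close>

locale pro_p_chain = group G for G (structure) +
  fixes p :: nat and \<psi> :: "nat \<Rightarrow> 'a \<Rightarrow> 'q"
  assumes \<psi>_cong: "\<lbrakk>g \<in> carrier G; g' \<in> carrier G; h \<in> carrier G; h' \<in> carrier G; \<psi> m g
      = \<psi> m g'; \<psi> m h = \<psi> m h'\<rbrakk> \<Longrightarrow>
    \<psi> m (g \<otimes> h) = \<psi> m (g' \<otimes> h')"
    and \<psi>_Suc: "\<lbrakk>g \<in> carrier G; h \<in> carrier G; \<psi> (Suc m) g = \<psi> (Suc m) h\<rbrakk> \<Longrightarrow> \<psi> m g = \<psi> m h"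
    and card_\<psi>: "\<exists>k. card (\<psi> m ` carrier G) = p ^ k"
    and cofinal: "N \<in> pro_p_normals p G \<Longrightarrow> \<exists>m. {g \<in> carrier G. \<psi> m g = \<psi> m \<one>} \<subseteq> N"
begin

sublocale level: group_congruence G "\<psi> m" for m
  by standard (fact \<psi>_cong)

lemma level_ker_mono: "m \<le> m' \<Longrightarrow> level.ker m' \<subseteq> level.ker m"
  by (induction m' rule: dec_induct) (auto simp: level.ker_def intro: \<psi>_Suc)

lemma inverse_system_pro_p_normals:
  "inverse_system (pro_p_normals p G) (\<lambda>N M. M \<subseteq> N) (\<lambda>M N C. N <#> C) (\<lambda>N. carrier (G Mod N))
    (carrier G) \<psi> (\<lambda>N g. N #> g) level.ker"
proof
  show "(\<lambda>g. N #> g) ` carrier G = carrier (G Mod N)" for N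
    by (auto simp: FactGroup_def RCOSETS_def)
  show "N <#> (M #> g) = N #> g"
    if "N \<in> pro_p_normals p G" "M \<in> pro_p_normals p G" "M \<subseteq> N" "g \<in> carrier G" for N M g
    using that normal_absorb by (auto simp: pro_p_normals_def)
  show "level.ker m \<in> pro_p_normals p G" for m
    using level.normal_ker level.card_rcosets_ker card_\<psi> by (auto simp: pro_p_normals_def)
  show "\<exists>m. level.ker m \<subseteq> N" if "N \<in> pro_p_normals p G" for N
    using cofinal[OF that] by (simp add: level.ker_def)
qed (use level_ker_mono level.ker_rcos_eq_iff in auto)

lemma monoid_completion_pro_p:
  "monoid_completion (pro_p_completion p G) (pro_p_completion_top p G) G \<psi>
    (\<lambda>m x g. x (level.ker m) = level.ker m #> g) (pro_p_map p G)"
  unfolding pro_p_completion_def pro_p_completion_top_def pro_p_map_def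
  by (rule monoid_completion_inv_lim[OF inverse_system_pro_p_normals])
    (auto simp: pro_p_normals_def normal.rcos_sum)

end

text \<open>Lagrange in the quotient, with one exponent valid for all elements. This turns an
  abstract normal subgroup into explicit members of it.\<close>

lemma (in group) pro_p_normals_pow:
  assumes N: "N \<in> pro_p_normals p G"
  obtains k where "\<And>g. g \<in> carrier G \<Longrightarrow> g [^] (p ^ k) \<in> N"
proof -
  obtain k where k: "N \<lhd> G" "card (rcosets N) = p ^ k"
    using N by (auto simp: pro_p_normals_def)
  interpret N: normal N G by (rule k(1))
  interpret Q: group "G Mod N"
    by (rule N.factorgroup_is_group)
  have "g [^] (p ^ k) \<in> N" if g: "g \<in> carrier G" for g
  proof -
    have "N #> g \<in> carrier (G Mod N)"
      using g by (auto simp: FactGroup_def RCOSETS_def)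
    then have "N #> (g [^] (p ^ k)) = N"
      using Q.pow_order_eq_1[of "N #> g"] N.FactGroup_pow[OF g] k(2)
      by (simp add: order_def FactGroup_def)
    then show ?thesis
      using coset_join1 N.subgroup_axioms g by blast
  qed
  then show ?thesis
    using that by blast
qed


section \<open>Group rings over the prime field\<close>

definition group_ring_supp :: "('g, 'x) monoid_scheme \<Rightarrow> ('g \<Rightarrow> int) \<Rightarrow> 'g set" where
  "group_ring_supp G f = {g \<in> carrier G. f g \<noteq> 0}"

text \<open>
  The linear functional with values \<open>F\<close> on the group elements.  An element of \<open>\<FF>\<^sub>p[G]\<close> is determined by
  its pairings modulo \<open>p\<close> with all \<open>F\<close>, and products and induced maps are most easily described by
  their pairings.
\<close>

definition pairing :: "('g, 'x) monoid_scheme \<Rightarrow> ('g \<Rightarrow> int) \<Rightarrow> ('g \<Rightarrow> int) \<Rightarrow> int" where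
  "pairing G f F = (\<Sum>g\<in>group_ring_supp G f. f g * F g)"

lemma pairing_superset:
  assumes "finite C" "group_ring_supp G f \<subseteq> C" "C \<subseteq> carrier G"
  shows "pairing G f F = (\<Sum>g\<in>C. f g * F g)"
  unfolding pairing_def by (rule sum.mono_neutral_left) (use assms in \<open>auto simp: group_ring_supp_def\<close>)

lemma pairing_cong: "(\<And>g. g \<in> carrier G \<Longrightarrow> F g = F' g) \<Longrightarrow> pairing G f F = pairing G f F'"
  unfolding pairing_def by (rule sum.cong) (auto simp: group_ring_supp_def)

lemma pairing_cong_mod:
  "(\<And>g. g \<in> carrier G \<Longrightarrow> [F g = F' g] (mod q)) \<Longrightarrow> [pairing G f F = pairing G f F'] (mod q)"
  unfolding pairing_def by (intro cong_sum cong_scalar_left) (auto simp: group_ring_supp_def)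

lemma pairing_plus_right: "pairing G f (\<lambda>g. F g + F' g) = pairing G f F + pairing G f F'"
  unfolding pairing_def by (simp add: sum.distrib algebra_simps)

locale group_ring_Fp = group G for G (structure) +
  fixes p :: nat
  assumes p_gt_1: "p > 1"
begin

abbreviation R :: "('a \<Rightarrow> int) ring" where
  "R \<equiv> group_ring (Fp p) G"

abbreviation supp :: "('a \<Rightarrow> int) \<Rightarrow> 'a set" where
  "supp \<equiv> group_ring_supp G"

abbreviation pair :: "('a \<Rightarrow> int) \<Rightarrow> ('a \<Rightarrow> int) \<Rightarrow> int" where
  "pair \<equiv> pairing G"

sublocale Fp: residues "int p" "Fp p"
  using p_gt_1 by (simp_all add: residues_def)

lemma mem_group_ring:
  "f \<in> carrier R \<longleftrightarrow> f \<in> extensional (carrier G) \<and> (\<forall>g\<in>carrier G. 0 \<le> f g \<and> f g < int p) \<and> finite (supp f)"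
  by (auto simp: group_ring_def group_ring_supp_def PiE_def Pi_def Fp.res_carrier_eq Fp.zero_cong)

lemma finite_supp: "f \<in> carrier R \<Longrightarrow> finite (supp f)"
  by (simp add: mem_group_ring)

lemma mod_self: "f \<in> carrier R \<Longrightarrow> g \<in> carrier G \<Longrightarrow> f g mod int p = f g"
  by (simp add: mem_group_ring)

lemma restrict_mod_in_group_ring:
  assumes "finite C" "\<And>g. g \<in> carrier G \<Longrightarrow> F g mod int p \<noteq> 0 \<Longrightarrow> g \<in> C"
  shows "(\<lambda>g\<in>carrier G. F g mod int p) \<in> carrier R"
  unfolding mem_group_ring using p_gt_1 assms
  by (auto simp: group_ring_supp_def intro: rev_finite_subset[OF assms(1)])

lemma group_ring_add: "f \<oplus>\<^bsub>R\<^esub> h = (\<lambda>g\<in>carrier G. (f g + h g) mod int p)"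
  by (simp add: group_ring_def Fp.res_add_eq)

lemma group_ring_zero: "\<zero>\<^bsub>R\<^esub> = (\<lambda>g\<in>carrier G. 0)"
  by (simp add: group_ring_def Fp.zero_cong)

lemma group_ring_one: "\<one>\<^bsub>R\<^esub> = group_elem (Fp p) G \<one>"
  by (simp add: group_ring_def group_elem_def)

lemma group_elem_eq: "group_elem (Fp p) G a = (\<lambda>g\<in>carrier G. if g = a then 1 else 0)"
  by (simp add: group_elem_def Fp.res_one_eq Fp.zero_cong cong: if_cong)

lemma group_ring_mult:
  "f \<otimes>\<^bsub>R\<^esub> h = (\<lambda>g\<in>carrier G. (\<Sum>a\<in>supp f. f a * h (inv a \<otimes> g)) mod int p)"
    if "f \<in> carrier R"
  using Fp.sum_cong[OF finite_supp[OF that]]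
  by (simp add: group_ring_def Fp.res_mult_eq Fp.zero_cong group_ring_supp_def)

lemma group_elem_in: "a \<in> carrier G \<Longrightarrow> group_elem (Fp p) G a \<in> carrier R"
  using p_gt_1 by (auto simp: mem_group_ring group_elem_eq group_ring_supp_def)

lemma supp_group_elem: "a \<in> carrier G \<Longrightarrow> supp (group_elem (Fp p) G a) = {a}"
  by (auto simp: group_elem_eq group_ring_supp_def)

lemma pair_group_elem: "a \<in> carrier G \<Longrightarrow> pair (group_elem (Fp p) G a) F = F a"
  by (simp add: pairing_def supp_group_elem) (simp add: group_elem_eq)

lemma pair_delta:
  assumes f: "f \<in> carrier R" and g: "g \<in> carrier G"
  shows "pair f (\<lambda>a. if a = g then 1 else 0) = f g"
proof -
  have "pair f (\<lambda>a. if a = g then 1 else 0) = (\<Sum>a\<in>supp f. if a = g then f g else 0)"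
    unfolding pairing_def by (rule sum.cong) auto
  also have "\<dots> = f g"
    using finite_supp[OF f] g by (simp add: sum.delta group_ring_supp_def)
  finally show ?thesis .
qed

text \<open>Delta functions as \<open>F\<close> recover the coefficients, and congruent coefficients
  are equal because both lie between 0 and \<open>p - 1\<close>.\<close>

lemma group_ring_eqI:
  assumes f: "f \<in> carrier R" and h: "h \<in> carrier R" and eq: "\<And>F. [pair f F = pair h F] (mod int p)"
  shows "f = h"
proof (rule extensionalityI)
  show "f \<in> extensional (carrier G)" "h \<in> extensional (carrier G)"
    using f h by (simp_all add: mem_group_ring)
  fix g assume g: "g \<in> carrier G"
  show "f g = h g"
    using eq[of "\<lambda>a. if a = g then 1 else 0"] mod_self[OF f g] mod_self[OF h g]
    by (simp add: pair_delta[OF f g] pair_delta[OF h g] cong_def)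
qed

lemma group_ring_add_in:
  assumes "f \<in> carrier R" "h \<in> carrier R" shows "f \<oplus>\<^bsub>R\<^esub> h \<in> carrier R"
  unfolding group_ring_add using assms
  by (intro restrict_mod_in_group_ring[of "supp f \<union> supp h"] finite_UnI finite_supp)
    (auto simp: group_ring_supp_def)

lemma pair_add:
  assumes f: "f \<in> carrier R" and h: "h \<in> carrier R"
  shows "[pair (f \<oplus>\<^bsub>R\<^esub> h) F = pair f F + pair h F] (mod int p)"
proof -
  let ?C = "supp f \<union> supp h"
  have C: "finite ?C" "?C \<subseteq> carrier G"
    using finite_supp[OF f] finite_supp[OF h] by (auto simp: group_ring_supp_def)
  have "pair (f \<oplus>\<^bsub>R\<^esub> h) F = (\<Sum>g\<in>?C. (f \<oplus>\<^bsub>R\<^esub> h) g * F g)"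
    using C by (intro pairing_superset) (auto simp: group_ring_add group_ring_supp_def)
  also have "[\<dots> = (\<Sum>g\<in>?C. (f g + h g) * F g)] (mod int p)"
    using C by (intro cong_sum cong_scalar_right) (auto simp: group_ring_add cong_def)
  also have "(\<Sum>g\<in>?C. (f g + h g) * F g) = pair f F + pair h F"
    using C by (simp add: pairing_superset[of ?C] algebra_simps sum.distrib)
  finally show ?thesis .
qed

text \<open>The convolution in symmetric form, over pairs from both supports; inverses disappear,
  and the sum can be rearranged by the value of \<open>a \<otimes> b\<close>.\<close>

lemma group_ring_mult_coeff:
  assumes f: "f \<in> carrier R" and h: "h \<in> carrier R" and g: "g \<in> carrier G"
  shows "(f \<otimes>\<^bsub>R\<^esub> h) g = (\<Sum>a\<in>supp f. \<Sum>b\<in>supp h. if a \<otimes> b = g then f a * h b else 0) mod int p"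
proof -
  have "f a * h (inv a \<otimes> g) = (\<Sum>b\<in>supp h. if a \<otimes> b = g then f a * h b else 0)" if "a \<in> supp f" for a
  proof -
    have a: "a \<in> carrier G"
      using that by (simp add: group_ring_supp_def)
    have "(\<Sum>b\<in>supp h. if a \<otimes> b = g then f a * h b else 0)
        = (\<Sum>b\<in>supp h. if b = inv a \<otimes> g then f a * h (inv a \<otimes> g) else 0)"
    proof (rule sum.cong)
      fix b assume "b \<in> supp h"
      then have "a \<otimes> b = g \<longleftrightarrow> b = inv a \<otimes> g"
        using a g inv_solve_left'[of b a g] by (auto simp: group_ring_supp_def)
      then show "(if a \<otimes> b = g then f a * h b else 0) = (if b = inv a \<otimes> g then f a * h (inv a \<otimes> g) else 0)"
        by auto
    qed simp
    also have "\<dots> = f a * h (inv a \<otimes> g)"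
      using finite_supp[OF h] a g by (simp add: sum.delta group_ring_supp_def)
    finally show ?thesis ..
  qed
  then show ?thesis
    using g by (simp add: group_ring_mult[OF f])
qed

lemma group_ring_mult_supp:
  assumes f: "f \<in> carrier R" and h: "h \<in> carrier R"
    and g: "g \<in> carrier G" "(f \<otimes>\<^bsub>R\<^esub> h) g \<noteq> 0"
  shows "g \<in> (\<lambda>(a, b). a \<otimes> b) ` (supp f \<times> supp h)"
proof (rule ccontr)
  assume "\<not> ?thesis"
  then have "(\<Sum>a\<in>supp f. \<Sum>b\<in>supp h. if a \<otimes> b = g then f a * h b else 0) = 0"
    by (intro sum.neutral ballI) auto
  then show False
    using group_ring_mult_coeff[OF f h g(1)] g(2) by simp
qed

lemma group_ring_mult_in:
  assumes f: "f \<in> carrier R" and h: "h \<in> carrier R" shows "f \<otimes>\<^bsub>R\<^esub> h \<in> carrier R"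
  unfolding group_ring_mult[OF f]
  by (intro restrict_mod_in_group_ring[of "(\<lambda>(a, b). a \<otimes> b) ` (supp f \<times> supp h)"] group_ring_mult_supp[OF f h])
    (simp_all add: finite_supp f h group_ring_mult[OF f])

text \<open>The product pairs with \<open>F\<close> as the tensor of the factors pairs with
  \<open>F\<close> composed with the group multiplication. The set \<open>?C\<close> of products
  contains the support of the product, which may be smaller through cancellation.\<close>

lemma pair_mult:
  assumes f: "f \<in> carrier R" and h: "h \<in> carrier R"
  shows "[pair (f \<otimes>\<^bsub>R\<^esub> h) F = pair f (\<lambda>a. pair h (\<lambda>b. F (a \<otimes> b)))] (mod int p)"
proof -
  let ?C = "(\<lambda>(a, b). a \<otimes> b) ` (supp f \<times> supp h)"
  have C: "finite ?C" "?C \<subseteq> carrier G"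
    using finite_supp[OF f] finite_supp[OF h] by (auto simp: group_ring_supp_def)
  have "pair (f \<otimes>\<^bsub>R\<^esub> h) F = (\<Sum>g\<in>?C. (f \<otimes>\<^bsub>R\<^esub> h) g * F g)"
    using C group_ring_mult_supp[OF f h] by (intro pairing_superset) (auto simp: group_ring_supp_def)
  also have "[\<dots> = (\<Sum>g\<in>?C. (\<Sum>a\<in>supp f. \<Sum>b\<in>supp h. if a \<otimes> b = g then f a * h b else 0) * F g)] (mod int p)"
    using C by (intro cong_sum cong_scalar_right) (auto simp: group_ring_mult_coeff[OF f h] cong_def)
  also have "(\<Sum>g\<in>?C. (\<Sum>a\<in>supp f. \<Sum>b\<in>supp h. if a \<otimes> b = g then f a * h b else 0) * F g)
      = (\<Sum>g\<in>?C. \<Sum>a\<in>supp f. \<Sum>b\<in>supp h. if g = a \<otimes> b then f a * (h b * F (a \<otimes> b)) else 0)"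
    unfolding sum_distrib_right by (intro sum.cong refl) auto
  \<comment> \<open>With the sum over \<open>g\<close> innermost, each pair \<open>a\<close>,
    \<open>b\<close> contributes at the single place \<open>g = a \<otimes> b\<close>.\<close>
  also have "\<dots> = (\<Sum>a\<in>supp f. \<Sum>b\<in>supp h. \<Sum>g\<in>?C. if g = a \<otimes> b then f a * (h b * F (a \<otimes> b)) else 0)"
    by (subst sum.swap, rule sum.cong[OF refl], rule sum.swap)
  also have "\<dots> = (\<Sum>a\<in>supp f. \<Sum>b\<in>supp h. f a * (h b * F (a \<otimes> b)))"
    using C(1) by (intro sum.cong refl) (auto simp: sum.delta)
  also have "\<dots> = pair f (\<lambda>a. pair h (\<lambda>b. F (a \<otimes> b)))"
    unfolding pairing_def sum_distrib_left ..
  finally show ?thesis .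
qed

text \<open>After pairing, associativity reduces to associativity in the group inside an iterated
  pairing, and distributivity to additivity of the pairing in either argument.\<close>

lemma ring_group_ring: "ring R"
proof (rule ringI)
  show "abelian_group R"
  proof (rule abelian_groupI)
    show "\<zero>\<^bsub>R\<^esub> \<in> carrier R"
      using p_gt_1 by (auto simp: mem_group_ring group_ring_zero group_ring_supp_def)
    fix f assume f: "f \<in> carrier R"
    show "\<zero>\<^bsub>R\<^esub> \<oplus>\<^bsub>R\<^esub> f = f"
      using f by (auto simp: mem_group_ring group_ring_zero group_ring_add extensional_def fun_eq_iff)
    have "(\<lambda>g\<in>carrier G. (- f g) mod int p) \<in> carrier R"
      using finite_supp[OF f] by (rule restrict_mod_in_group_ring) (auto simp: group_ring_supp_def)
    moreover have "(\<lambda>g\<in>carrier G. (- f g) mod int p) \<oplus>\<^bsub>R\<^esub> f = \<zero>\<^bsub>R\<^esub>"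
      by (auto simp: group_ring_zero group_ring_add mod_add_left_eq)
    ultimately show "\<exists>h\<in>carrier R. h \<oplus>\<^bsub>R\<^esub> f = \<zero>\<^bsub>R\<^esub>"
      by blast
    fix h assume h: "h \<in> carrier R"
    show "f \<oplus>\<^bsub>R\<^esub> h = h \<oplus>\<^bsub>R\<^esub> f"
      by (simp add: group_ring_add add.commute)
    fix k assume k: "k \<in> carrier R"
    show "f \<oplus>\<^bsub>R\<^esub> h \<oplus>\<^bsub>R\<^esub> k = f \<oplus>\<^bsub>R\<^esub> (h \<oplus>\<^bsub>R\<^esub> k)"
      by (simp add: group_ring_add mod_add_left_eq mod_add_right_eq add.assoc cong: restrict_cong)
  qed (rule group_ring_add_in)
next
  show "Group.monoid R"
  proof
    show "\<one>\<^bsub>R\<^esub> \<in> carrier R"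
      by (simp add: group_ring_one group_elem_in)
    fix f assume f: "f \<in> carrier R"
    have one: "\<one>\<^bsub>R\<^esub> \<in> carrier R"
      by (simp add: group_ring_one group_elem_in)
    show "\<one>\<^bsub>R\<^esub> \<otimes>\<^bsub>R\<^esub> f = f"
    proof (rule group_ring_eqI)
      fix F
      have "pair f (\<lambda>b. F (\<one> \<otimes> b)) = pair f F"
        by (rule pairing_cong) simp
      then show "[pair (\<one>\<^bsub>R\<^esub> \<otimes>\<^bsub>R\<^esub> f) F = pair f F] (mod int p)"
        using pair_mult[OF one f, of F] by (simp add: group_ring_one pair_group_elem)
    qed (simp_all add: f one group_ring_mult_in)
    show "f \<otimes>\<^bsub>R\<^esub> \<one>\<^bsub>R\<^esub> = f"
    proof (rule group_ring_eqI)
      fix F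
      have "pair f (\<lambda>a. pair \<one>\<^bsub>R\<^esub> (\<lambda>b. F (a \<otimes> b))) = pair f F"
        by (rule pairing_cong) (simp add: group_ring_one pair_group_elem)
      then show "[pair (f \<otimes>\<^bsub>R\<^esub> \<one>\<^bsub>R\<^esub>) F = pair f F] (mod int p)"
        using pair_mult[OF f one, of F] by simp
    qed (simp_all add: f one group_ring_mult_in)
    fix h k assume h: "h \<in> carrier R" and k: "k \<in> carrier R"
    show "f \<otimes>\<^bsub>R\<^esub> h \<otimes>\<^bsub>R\<^esub> k = f \<otimes>\<^bsub>R\<^esub> (h \<otimes>\<^bsub>R\<^esub> k)"
    proof (rule group_ring_eqI)
      fix F
      have "[pair (f \<otimes>\<^bsub>R\<^esub> h \<otimes>\<^bsub>R\<^esub> k) F = pair (f \<otimes>\<^bsub>R\<^esub> h) (\<lambda>a. pair k (\<lambda>b. F (a \<otimes> b)))] (mod int p)"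
        using f h k by (intro pair_mult group_ring_mult_in)
      also have "[pair (f \<otimes>\<^bsub>R\<^esub> h) (\<lambda>a. pair k (\<lambda>b. F (a \<otimes> b)))
          = pair f (\<lambda>a. pair h (\<lambda>b. pair k (\<lambda>c. F (a \<otimes> b \<otimes> c))))] (mod int p)"
        using f h by (rule pair_mult)
      also have "pair f (\<lambda>a. pair h (\<lambda>b. pair k (\<lambda>c. F (a \<otimes> b \<otimes> c))))
          = pair f (\<lambda>a. pair h (\<lambda>b. pair k (\<lambda>c. F (a \<otimes> (b \<otimes> c)))))"
        by (intro pairing_cong) (simp add: m_assoc)
      also have "[pair f (\<lambda>a. pair h (\<lambda>b. pair k (\<lambda>c. F (a \<otimes> (b \<otimes> c)))))
          = pair f (\<lambda>a. pair (h \<otimes>\<^bsub>R\<^esub> k) (\<lambda>b. F (a \<otimes> b)))] (mod int p)"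
        using h k by (intro pairing_cong_mod cong_sym[OF pair_mult])
      also have "[pair f (\<lambda>a. pair (h \<otimes>\<^bsub>R\<^esub> k) (\<lambda>b. F (a \<otimes> b))) = pair (f \<otimes>\<^bsub>R\<^esub> (h \<otimes>\<^bsub>R\<^esub> k)) F] (mod int p)"
        using f h k by (intro cong_sym[OF pair_mult] group_ring_mult_in)
      finally show "[pair (f \<otimes>\<^bsub>R\<^esub> h \<otimes>\<^bsub>R\<^esub> k) F = pair (f \<otimes>\<^bsub>R\<^esub> (h \<otimes>\<^bsub>R\<^esub> k)) F] (mod int p)" .
    qed (simp_all add: f h k group_ring_mult_in)
  qed (rule group_ring_mult_in)
next
  fix f h k assume f: "f \<in> carrier R" and h: "h \<in> carrier R" and k: "k \<in> carrier R"
  show "(f \<oplus>\<^bsub>R\<^esub> h) \<otimes>\<^bsub>R\<^esub> k = f \<otimes>\<^bsub>R\<^esub> k \<oplus>\<^bsub>R\<^esub> h \<otimes>\<^bsub>R\<^esub> k"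
  proof (rule group_ring_eqI)
    fix F
    let ?F = "\<lambda>a. pair k (\<lambda>b. F (a \<otimes> b))"
    have "[pair ((f \<oplus>\<^bsub>R\<^esub> h) \<otimes>\<^bsub>R\<^esub> k) F = pair (f \<oplus>\<^bsub>R\<^esub> h) ?F] (mod int p)"
      using f h k by (intro pair_mult group_ring_add_in)
    also have "[pair (f \<oplus>\<^bsub>R\<^esub> h) ?F = pair f ?F + pair h ?F] (mod int p)"
      using f h by (rule pair_add)
    also have "[pair f ?F + pair h ?F = pair (f \<otimes>\<^bsub>R\<^esub> k) F + pair (h \<otimes>\<^bsub>R\<^esub> k) F] (mod int p)"
      using f h k by (intro cong_add cong_sym[OF pair_mult])
    also have "[pair (f \<otimes>\<^bsub>R\<^esub> k) F + pair (h \<otimes>\<^bsub>R\<^esub> k) F = pair (f \<otimes>\<^bsub>R\<^esub> k \<oplus>\<^bsub>R\<^esub> h \<otimes>\<^bsub>R\<^esub> k) F] (mod int p)"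
      using f h k by (intro cong_sym[OF pair_add] group_ring_mult_in)
    finally show "[pair ((f \<oplus>\<^bsub>R\<^esub> h) \<otimes>\<^bsub>R\<^esub> k) F = pair (f \<otimes>\<^bsub>R\<^esub> k \<oplus>\<^bsub>R\<^esub> h \<otimes>\<^bsub>R\<^esub> k) F] (mod int p)" .
  qed (simp_all add: f h k group_ring_mult_in group_ring_add_in)
  show "k \<otimes>\<^bsub>R\<^esub> (f \<oplus>\<^bsub>R\<^esub> h) = k \<otimes>\<^bsub>R\<^esub> f \<oplus>\<^bsub>R\<^esub> k \<otimes>\<^bsub>R\<^esub> h"
  proof (rule group_ring_eqI)
    fix F
    have "[pair (k \<otimes>\<^bsub>R\<^esub> (f \<oplus>\<^bsub>R\<^esub> h)) F = pair k (\<lambda>a. pair (f \<oplus>\<^bsub>R\<^esub> h) (\<lambda>b. F (a \<otimes> b)))] (mod int p)"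
      using f h k by (intro pair_mult group_ring_add_in)
    also have "[pair k (\<lambda>a. pair (f \<oplus>\<^bsub>R\<^esub> h) (\<lambda>b. F (a \<otimes> b)))
        = pair k (\<lambda>a. pair f (\<lambda>b. F (a \<otimes> b)) + pair h (\<lambda>b. F (a \<otimes> b)))] (mod int p)"
      using f h by (intro pairing_cong_mod pair_add)
    also have "pair k (\<lambda>a. pair f (\<lambda>b. F (a \<otimes> b)) + pair h (\<lambda>b. F (a \<otimes> b)))
        = pair k (\<lambda>a. pair f (\<lambda>b. F (a \<otimes> b))) + pair k (\<lambda>a. pair h (\<lambda>b. F (a \<otimes> b)))"
      by (rule pairing_plus_right)
    also have "[pair k (\<lambda>a. pair f (\<lambda>b. F (a \<otimes> b))) + pair k (\<lambda>a. pair h (\<lambda>b. F (a \<otimes> b)))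
        = pair (k \<otimes>\<^bsub>R\<^esub> f) F + pair (k \<otimes>\<^bsub>R\<^esub> h) F] (mod int p)"
      using f h k by (intro cong_add cong_sym[OF pair_mult])
    also have "[pair (k \<otimes>\<^bsub>R\<^esub> f) F + pair (k \<otimes>\<^bsub>R\<^esub> h) F = pair (k \<otimes>\<^bsub>R\<^esub> f \<oplus>\<^bsub>R\<^esub> k \<otimes>\<^bsub>R\<^esub> h) F] (mod int p)"
      using f h k by (intro cong_sym[OF pair_add] group_ring_mult_in)
    finally show "[pair (k \<otimes>\<^bsub>R\<^esub> (f \<oplus>\<^bsub>R\<^esub> h)) F = pair (k \<otimes>\<^bsub>R\<^esub> f \<oplus>\<^bsub>R\<^esub> k \<otimes>\<^bsub>R\<^esub> h) F] (mod int p)" .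
  qed (simp_all add: f h k group_ring_mult_in group_ring_add_in)
qed

lemma group_elem_mult:
  assumes a: "a \<in> carrier G" and f: "f \<in> carrier R"
  shows "group_elem (Fp p) G a \<otimes>\<^bsub>R\<^esub> f = (\<lambda>g\<in>carrier G. f (inv a \<otimes> g))"
proof -
  have "group_elem (Fp p) G a \<otimes>\<^bsub>R\<^esub> f = (\<lambda>g\<in>carrier G. f (inv a \<otimes> g) mod int p)"
    using a by (simp add: group_ring_mult group_elem_in supp_group_elem) (simp add: group_elem_eq)
  then show ?thesis
    using a mod_self[OF f] by (simp cong: restrict_cong)
qed

end

section \<open>Linear maps induced by maps of groups\<close>

text \<open>Here \<open>\<phi>\<close> is only a map of sets; the homomorphism property is assumed
  where products are compared. Transition maps between quotients can thus be handled without proving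
  them multiplicative.\<close>

locale group_ring_Fp_map = G: group_ring_Fp G p + H: group_ring_Fp H p
  for G :: "('a, 'x) monoid_scheme" and H :: "('b, 'y) monoid_scheme" and p +
  fixes \<phi> :: "'a \<Rightarrow> 'b"
  assumes \<phi>_in: "a \<in> carrier G \<Longrightarrow> \<phi> a \<in> carrier H"
begin

abbreviation \<phi>' :: "('a \<Rightarrow> int) \<Rightarrow> 'b \<Rightarrow> int" where
  "\<phi>' \<equiv> group_ring_map (Fp p) G H \<phi>"

lemma map_eq:
  assumes f: "f \<in> carrier G.R"
  shows "\<phi>' f = (\<lambda>h\<in>carrier H. (\<Sum>a\<in>{a \<in> G.supp f. \<phi> a = h}. f a) mod int p)"
proof -
  have "(\<Oplus>\<^bsub>Fp p\<^esub>a\<in>{a \<in> G.supp f. \<phi> a = h}. f a) = (\<Sum>a\<in>{a \<in> G.supp f. \<phi> a = h}. f a) mod int p" for h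
  proof -
    let ?A = "{a \<in> G.supp f. \<phi> a = h}"
    have "(\<Oplus>\<^bsub>Fp p\<^esub>a\<in>?A. f a) = (\<Oplus>\<^bsub>Fp p\<^esub>a\<in>?A. f a mod int p)"
    proof (rule G.Fp.finsum_cong')
      show "f a = f a mod int p" if "a \<in> ?A" for a
        using that G.mod_self[OF f, of a] by (auto simp: group_ring_supp_def)
    qed auto
    then show ?thesis
      using G.Fp.sum_cong[of ?A f] G.finite_supp[OF f] by simp
  qed
  moreover have "{a \<in> carrier G. \<phi> a = h \<and> f a \<noteq> \<zero>\<^bsub>Fp p\<^esub>} = {a \<in> G.supp f. \<phi> a = h}" for h
    by (auto simp: group_ring_supp_def G.Fp.zero_cong)
  ultimately show ?thesis
    by (simp add: group_ring_map_def)
qed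

lemma map_supp:
  assumes f: "f \<in> carrier G.R" and "h \<in> carrier H" "\<phi>' f h \<noteq> 0"
  shows "h \<in> \<phi> ` G.supp f"
proof (rule ccontr)
  assume "h \<notin> \<phi> ` G.supp f"
  then have "{a \<in> G.supp f. \<phi> a = h} = {}"
    by auto
  moreover have "\<phi>' f h = (\<Sum>a\<in>{a \<in> G.supp f. \<phi> a = h}. f a) mod int p"
    using assms by (simp add: map_eq)
  ultimately show False
    using assms(3) by (simp only: sum.empty mod_0)
qed

lemma map_in:
  assumes f: "f \<in> carrier G.R" shows "\<phi>' f \<in> carrier H.R"
  unfolding map_eq[OF f]
proof (rule H.restrict_mod_in_group_ring)
  show "finite (\<phi> ` G.supp f)"
    using G.finite_supp[OF f] by simp
  show "h \<in> \<phi> ` G.supp f" if "h \<in> carrier H" "(\<Sum>a\<in>{a \<in> G.supp f. \<phi> a = h}. f a) mod int p \<noteq> 0" for h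
    using map_supp[OF f that(1)] that by (simp add: map_eq[OF f])
qed

text \<open>Change of variables: pushing \<open>f\<close> forward is dual to pulling
  \<open>F\<close> back, the sum over the support being grouped by fibres.\<close>

lemma pair_map:
  assumes f: "f \<in> carrier G.R"
  shows "[H.pair (\<phi>' f) F = G.pair f (\<lambda>a. F (\<phi> a))] (mod int p)"
proof -
  let ?C = "\<phi> ` G.supp f"
  have C: "finite ?C" "?C \<subseteq> carrier H"
    using G.finite_supp[OF f] \<phi>_in by (auto simp: group_ring_supp_def)
  have "H.pair (\<phi>' f) F = (\<Sum>h\<in>?C. \<phi>' f h * F h)"
    using C map_supp[OF f] by (intro pairing_superset) (auto simp: group_ring_supp_def)
  also have "[\<dots> = (\<Sum>h\<in>?C. (\<Sum>a\<in>{a \<in> G.supp f. \<phi> a = h}. f a) * F h)] (mod int p)"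
    using C by (intro cong_sum cong_scalar_right) (auto simp: map_eq[OF f] cong_def)
  also have "(\<Sum>h\<in>?C. (\<Sum>a\<in>{a \<in> G.supp f. \<phi> a = h}. f a) * F h)
      = (\<Sum>h\<in>?C. \<Sum>a\<in>{a \<in> G.supp f. \<phi> a = h}. f a * F (\<phi> a))"
    unfolding sum_distrib_right by (intro sum.cong refl) auto
  also have "\<dots> = G.pair f (\<lambda>a. F (\<phi> a))"
    unfolding pairing_def using G.finite_supp[OF f] C by (intro sum.group) auto
  finally show ?thesis .
qed

lemma map_group_elem: "a \<in> carrier G \<Longrightarrow> \<phi>' (group_elem (Fp p) G a) = group_elem (Fp p) H (\<phi> a)"
  using pair_map[OF G.group_elem_in, of a]
  by (intro H.group_ring_eqI map_in G.group_elem_in H.group_elem_in \<phi>_in)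
    (simp_all add: G.pair_group_elem H.pair_group_elem \<phi>_in)

lemma map_add:
  assumes f: "f \<in> carrier G.R" and h: "h \<in> carrier G.R"
  shows "\<phi>' (f \<oplus>\<^bsub>G.R\<^esub> h) = \<phi>' f \<oplus>\<^bsub>H.R\<^esub> \<phi>' h"
proof (rule H.group_ring_eqI)
  fix F
  have "[H.pair (\<phi>' (f \<oplus>\<^bsub>G.R\<^esub> h)) F = G.pair (f \<oplus>\<^bsub>G.R\<^esub> h) (\<lambda>a. F (\<phi> a))] (mod int p)"
    using f h by (intro pair_map G.group_ring_add_in)
  also have "[G.pair (f \<oplus>\<^bsub>G.R\<^esub> h) (\<lambda>a. F (\<phi> a))
      = G.pair f (\<lambda>a. F (\<phi> a)) + G.pair h (\<lambda>a. F (\<phi> a))] (mod int p)"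
    using f h by (rule G.pair_add)
  also have "[G.pair f (\<lambda>a. F (\<phi> a)) + G.pair h (\<lambda>a. F (\<phi> a))
      = H.pair (\<phi>' f) F + H.pair (\<phi>' h) F] (mod int p)"
    using f h by (intro cong_add cong_sym[OF pair_map])
  also have "[H.pair (\<phi>' f) F + H.pair (\<phi>' h) F = H.pair (\<phi>' f \<oplus>\<^bsub>H.R\<^esub> \<phi>' h) F] (mod int p)"
    using f h by (intro cong_sym[OF H.pair_add] map_in)
  finally show "[H.pair (\<phi>' (f \<oplus>\<^bsub>G.R\<^esub> h)) F = H.pair (\<phi>' f \<oplus>\<^bsub>H.R\<^esub> \<phi>' h) F] (mod int p)" .
qed (simp_all add: f h map_in G.group_ring_add_in H.group_ring_add_in)

lemma map_mult:
  assumes hom: "\<phi> \<in> hom G H" and f: "f \<in> carrier G.R" and h: "h \<in> carrier G.R"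
  shows "\<phi>' (f \<otimes>\<^bsub>G.R\<^esub> h) = \<phi>' f \<otimes>\<^bsub>H.R\<^esub> \<phi>' h"
proof (rule H.group_ring_eqI)
  fix F
  have "[H.pair (\<phi>' (f \<otimes>\<^bsub>G.R\<^esub> h)) F = G.pair (f \<otimes>\<^bsub>G.R\<^esub> h) (\<lambda>a. F (\<phi> a))] (mod int p)"
    using f h by (intro pair_map G.group_ring_mult_in)
  also have "[G.pair (f \<otimes>\<^bsub>G.R\<^esub> h) (\<lambda>a. F (\<phi> a))
      = G.pair f (\<lambda>a. G.pair h (\<lambda>b. F (\<phi> (a \<otimes>\<^bsub>G\<^esub> b))))] (mod int p)"
    using f h by (rule G.pair_mult)
  also have "G.pair f (\<lambda>a. G.pair h (\<lambda>b. F (\<phi> (a \<otimes>\<^bsub>G\<^esub> b))))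
      = G.pair f (\<lambda>a. G.pair h (\<lambda>b. F (\<phi> a \<otimes>\<^bsub>H\<^esub> \<phi> b)))"
    using hom by (intro pairing_cong) (simp add: hom_mult)
  also have "[G.pair f (\<lambda>a. G.pair h (\<lambda>b. F (\<phi> a \<otimes>\<^bsub>H\<^esub> \<phi> b)))
      = G.pair f (\<lambda>a. H.pair (\<phi>' h) (\<lambda>b. F (\<phi> a \<otimes>\<^bsub>H\<^esub> b)))] (mod int p)"
    using h by (intro pairing_cong_mod cong_sym[OF pair_map])
  also have "[G.pair f (\<lambda>a. H.pair (\<phi>' h) (\<lambda>b. F (\<phi> a \<otimes>\<^bsub>H\<^esub> b)))
      = H.pair (\<phi>' f) (\<lambda>a. H.pair (\<phi>' h) (\<lambda>b. F (a \<otimes>\<^bsub>H\<^esub> b)))] (mod int p)"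
    using f by (rule cong_sym[OF pair_map])
  also have "[H.pair (\<phi>' f) (\<lambda>a. H.pair (\<phi>' h) (\<lambda>b. F (a \<otimes>\<^bsub>H\<^esub> b)))
      = H.pair (\<phi>' f \<otimes>\<^bsub>H.R\<^esub> \<phi>' h) F] (mod int p)"
    using f h by (intro cong_sym[OF H.pair_mult] map_in)
  finally show "[H.pair (\<phi>' (f \<otimes>\<^bsub>G.R\<^esub> h)) F = H.pair (\<phi>' f \<otimes>\<^bsub>H.R\<^esub> \<phi>' h) F] (mod int p)" .
qed (simp_all add: f h map_in G.group_ring_mult_in H.group_ring_mult_in)

lemma map_one: "\<phi> \<in> hom G H \<Longrightarrow> \<phi>' \<one>\<^bsub>G.R\<^esub> = \<one>\<^bsub>H.R\<^esub>"
  using hom_one[of \<phi> G H] by (simp add: G.group_ring_one H.group_ring_one map_group_elem)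

lemma map_surj:
  assumes "\<phi> ` carrier G = carrier H"
  shows "\<phi>' ` carrier G.R = carrier H.R"
proof (intro equalityI subsetI)
  fix r assume r: "r \<in> carrier H.R"
  define \<sigma> where "\<sigma> = inv_into (carrier G) \<phi>"
  have \<sigma>: "\<sigma> h \<in> carrier G" "\<phi> (\<sigma> h) = h" if "h \<in> carrier H" for h
    unfolding \<sigma>_def using that assms by (auto simp: inv_into_into f_inv_into_f)
  \<comment> \<open>The condition \<open>a = \<sigma> (\<phi> a)\<close> selects one element of each
    fibre, so every fibre sum has at most one nonzero term.\<close>
  define f where "f = (\<lambda>a\<in>carrier G. if a = \<sigma> (\<phi> a) then r (\<phi> a) else 0)"
  have supp: "G.supp f \<subseteq> \<sigma> ` H.supp r"
    using \<phi>_in by (auto simp: f_def group_ring_supp_def split: if_splits)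
  then have f: "f \<in> carrier G.R"
    using finite_subset[OF supp] H.finite_supp[OF r] r \<phi>_in G.p_gt_1
    by (auto simp: G.mem_group_ring H.mem_group_ring f_def)
  have "\<phi>' f = r"
  proof (rule extensionalityI[of _ "carrier H"])
    fix h assume h: "h \<in> carrier H"
    have "{a \<in> G.supp f. \<phi> a = h} = (if r h = 0 then {} else {\<sigma> h})"
      using h \<sigma> by (auto simp: f_def group_ring_supp_def split: if_splits)
    then show "\<phi>' f h = r h"
      using h \<sigma> H.mod_self[OF r h] by (simp add: map_eq[OF f]) (simp add: f_def)
  qed (use r map_in[OF f] in \<open>auto simp: H.mem_group_ring\<close>)
  with f show "r \<in> \<phi>' ` carrier G.R"
    by blast
qed (use map_in in auto)

end

lemma group_ring_map_comp:
  assumes "group_ring_Fp_map G H p \<phi>" "group_ring_Fp_map H K p \<theta>" "group_ring_Fp_map G K p \<chi>"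
    and \<chi>: "\<And>a. a \<in> carrier G \<Longrightarrow> \<chi> a = \<theta> (\<phi> a)"
    and f: "f \<in> carrier (group_ring (Fp p) G)"
  shows "group_ring_map (Fp p) H K \<theta> (group_ring_map (Fp p) G H \<phi> f) = group_ring_map (Fp p) G K \<chi> f"
proof -
  interpret GH: group_ring_Fp_map G H p \<phi> by fact
  interpret HK: group_ring_Fp_map H K p \<theta> by fact
  interpret GK: group_ring_Fp_map G K p \<chi> by fact
  show ?thesis
  proof (rule HK.H.group_ring_eqI)
    fix F
    have "[pairing K (HK.\<phi>' (GH.\<phi>' f)) F = pairing H (GH.\<phi>' f) (\<lambda>a. F (\<theta> a))] (mod int p)"
      using f by (intro HK.pair_map GH.map_in)
    also have "[pairing H (GH.\<phi>' f) (\<lambda>a. F (\<theta> a)) = pairing G f (\<lambda>a. F (\<theta> (\<phi> a)))] (mod int p)"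
      using f by (rule GH.pair_map)
    also have "pairing G f (\<lambda>a. F (\<theta> (\<phi> a))) = pairing G f (\<lambda>a. F (\<chi> a))"
      by (rule pairing_cong) (simp add: \<chi>)
    also have "[pairing G f (\<lambda>a. F (\<chi> a)) = pairing K (GK.\<phi>' f) F] (mod int p)"
      using f by (rule cong_sym[OF GK.pair_map])
    finally show "[pairing K (HK.\<phi>' (GH.\<phi>' f)) F = pairing K (GK.\<phi>' f) F] (mod int p)" .
  qed (simp_all add: f GH.map_in HK.map_in GK.map_in)
qed

text \<open>The image of \<open>f\<close> records the sums of its coefficients over the fibres and
  is zero outside the image of the group. Equality of two images therefore depends on the partition
  into fibres only, not on the target group, so no isomorphism between the targets has to be
  constructed.\<close>

lemma group_ring_map_eq_iff:
  assumes "group_ring_Fp_map G H p \<phi>" "group_ring_Fp_map G K p \<chi>"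
    and fibres: "\<And>a b. a \<in> carrier G \<Longrightarrow> b \<in> carrier G \<Longrightarrow> \<phi> a = \<phi> b \<longleftrightarrow> \<chi> a = \<chi> b"
    and f: "f \<in> carrier (group_ring (Fp p) G)" and h: "h \<in> carrier (group_ring (Fp p) G)"
  shows "group_ring_map (Fp p) G H \<phi> f = group_ring_map (Fp p) G H \<phi> h \<longleftrightarrow>
    group_ring_map (Fp p) G K \<chi> f = group_ring_map (Fp p) G K \<chi> h"
proof -
  have eq_iff: "group_ring_map (Fp p) G M \<theta> f = group_ring_map (Fp p) G M \<theta> h \<longleftrightarrow>
      (\<forall>x\<in>carrier G. (\<Sum>a\<in>{a \<in> group_ring_supp G f. \<theta> a = \<theta> x}. f a) mod int p =
        (\<Sum>a\<in>{a \<in> group_ring_supp G h. \<theta> a = \<theta> x}. h a) mod int p)" (is "_ \<longleftrightarrow> ?r")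
    if "group_ring_Fp_map G M p \<theta>" for M :: "('m, 'z) monoid_scheme" and \<theta>
  proof -
    interpret group_ring_Fp_map G M p \<theta> by fact
    have "\<phi>' f y = \<phi>' h y" if ?r "y \<in> carrier M" for y
    proof (cases "y \<in> \<theta> ` carrier G")
      case True
      then show ?thesis
        using that by (auto simp: map_eq f h)
    next
      case False
      then have "\<phi>' f y = 0" "\<phi>' h y = 0"
        using map_supp[OF f that(2)] map_supp[OF h that(2)] by (auto simp: group_ring_supp_def)
      then show ?thesis
        by simp
    qed
    then have "\<phi>' f = \<phi>' h" if ?r
      using that map_in[OF f] map_in[OF h]
      by (intro extensionalityI[of _ "carrier M"]) (auto simp: H.mem_group_ring)
    moreover have ?r if eq: "\<phi>' f = \<phi>' h"
    proof
      fix x assume "x \<in> carrier G"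
      then show "(\<Sum>a\<in>{a \<in> G.supp f. \<theta> a = \<theta> x}. f a) mod int p = (\<Sum>a\<in>{a \<in> G.supp h. \<theta> a = \<theta> x}. h a) mod int p"
        using fun_cong[OF eq, of "\<theta> x"] \<phi>_in by (simp add: map_eq f h)
    qed
    ultimately show ?thesis
      by blast
  qed
  have "{a \<in> group_ring_supp G k. \<phi> a = \<phi> x} = {a \<in> group_ring_supp G k. \<chi> a = \<chi> x}"
    if "x \<in> carrier G" for k x
    using fibres that by (auto simp: group_ring_supp_def)
  then show ?thesis
    unfolding eq_iff[OF assms(1)] eq_iff[OF assms(2)] by simp
qed


section \<open>The p-adic integers\<close>

locale p_adic =
  fixes p :: nat
  assumes p_gt_1: "p > 1"
begin

abbreviation Z :: "int monoid" where
  "Z \<equiv> integer_group"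

abbreviation Z_mod :: "nat \<Rightarrow> int monoid" where
  "Z_mod m \<equiv> integer_mod_group (p ^ m)"

lemma carrier_Z_mod: "carrier (Z_mod m) = {0..<int p ^ m}"
  using p_gt_1 by (simp add: carrier_integer_mod_group)

lemma mod_in_Z_mod: "k mod int p ^ m \<in> carrier (Z_mod m)"
  using p_gt_1 by (simp add: carrier_Z_mod)

lemma mod_power_mod: "i \<le> j \<Longrightarrow> k mod int p ^ j mod int p ^ i = k mod int p ^ i"
  by (simp add: le_imp_power_dvd mod_mod_cancel)

lemma mod_image: "(\<lambda>k. k mod int p ^ m) ` UNIV = carrier (Z_mod m)"
proof (intro equalityI subsetI)
  fix k assume "k \<in> carrier (Z_mod m)"
  then have "k = k mod int p ^ m"
    by (simp add: carrier_Z_mod)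
  then show "k \<in> (\<lambda>k. k mod int p ^ m) ` UNIV"
    by blast
qed (use mod_in_Z_mod in auto)

lemma mod_hom: "(\<lambda>k. k mod int p ^ m) \<in> hom Z (Z_mod m)"
  by (auto simp: hom_def mod_in_Z_mod mod_add_eq)

sublocale Zp: inverse_system UNIV "(\<le>)" "\<lambda>j i a. a mod int p ^ i" "\<lambda>m. carrier (Z_mod m)"
  "carrier Z" "\<lambda>m k. k mod int p ^ m" "\<lambda>m k. k mod int p ^ m" "\<lambda>m. m"
  using mod_power_mod mod_image by unfold_locales auto

lemma Zp_mem:
  "x \<in> carrier (Zp p) \<longleftrightarrow> (\<forall>m. 0 \<le> x m \<and> x m < int p ^ m) \<and> (\<forall>i j. i \<le> j \<longrightarrow> x j mod int p ^ i = x i)"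
  by (auto simp: Zp_def inv_lim_group_def inv_lim_def carrier_Z_mod PiE_def Pi_def)

lemma Zp_mult: "x \<otimes>\<^bsub>Zp p\<^esub> y = (\<lambda>m. (x m + y m) mod int p ^ m)"
  by (simp add: Zp_def inv_lim_group_def product_group_def restrict_UNIV)

lemma Zp_one: "\<one>\<^bsub>Zp p\<^esub> = (\<lambda>m. 0)"
  by (simp add: Zp_def inv_lim_group_def product_group_def restrict_UNIV)

lemma monoid_completion_Zp:
  "monoid_completion (Zp p) (Zp_top p) Z (\<lambda>m k. k mod int p ^ m)
    (\<lambda>m x k. x m = k mod int p ^ m) (Zp_map p)"
  using monoid_completion_inv_lim[OF Zp.inverse_system_axioms]
  by (simp add: Zp_def Zp_top_def Zp_map_def[abs_def] mod_add_eq restrict_UNIV)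

sublocale Zp: monoid_completion "Zp p" "Zp_top p" Z "\<lambda>m k. k mod int p ^ m"
  "\<lambda>m x k. x m = k mod int p ^ m" "Zp_map p"
  by (rule monoid_completion_Zp)

lemma group_Zp: "group (Zp p)"
proof (rule groupI)
  show "\<one>\<^bsub>Zp p\<^esub> \<in> carrier (Zp p)"
    using p_gt_1 by (simp add: Zp_mem Zp_one)
  fix x assume x: "x \<in> carrier (Zp p)"
  show "\<one>\<^bsub>Zp p\<^esub> \<otimes>\<^bsub>Zp p\<^esub> x = x"
    using x by (simp add: Zp_mem Zp_one Zp_mult)
  let ?y = "\<lambda>m. (- x m) mod int p ^ m"
  have "?y j mod int p ^ i = ?y i" if "i \<le> j" for i j
  proof -
    have "?y j mod int p ^ i = (- (x j mod int p ^ i)) mod int p ^ i"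
      using mod_power_mod[OF that] by (simp add: mod_minus_eq)
    then show ?thesis
      using x that by (simp add: Zp_mem)
  qed
  then have "?y \<in> carrier (Zp p)"
    using p_gt_1 by (simp add: Zp_mem)
  moreover have "?y \<otimes>\<^bsub>Zp p\<^esub> x = \<one>\<^bsub>Zp p\<^esub>"
    by (simp add: Zp_mult Zp_one mod_add_left_eq)
  ultimately show "\<exists>y\<in>carrier (Zp p). y \<otimes>\<^bsub>Zp p\<^esub> x = \<one>\<^bsub>Zp p\<^esub>"
    by blast
  fix y z assume "y \<in> carrier (Zp p)" "z \<in> carrier (Zp p)"
  show "x \<otimes>\<^bsub>Zp p\<^esub> y \<otimes>\<^bsub>Zp p\<^esub> z = x \<otimes>\<^bsub>Zp p\<^esub> (y \<otimes>\<^bsub>Zp p\<^esub> z)"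
    by (simp add: Zp_mult mod_add_left_eq mod_add_right_eq add.assoc)
qed (rule Zp.lim_mult_in)

sublocale Zp: group "Zp p"
  by (rule group_Zp)

sublocale Zp_level: group_congruence "Zp p" "\<lambda>z. z m" for m
  by standard (simp add: Zp_mult)

lemma Zp_map_in: "Zp_map p k \<in> carrier (Zp p)"
  by (rule Zp.embed_in) simp

lemma Zp_map_hom: "Zp_map p \<in> hom Z (Zp p)"
  by (rule homI) (simp add: Zp_map_in, simp add: Zp_map_def Zp_mult mod_add_eq)

lemma Zp_level_cong:
  "z \<in> carrier (Zp p) \<Longrightarrow> z m = k mod int p ^ m \<Longrightarrow>
    Zp_level.ker m #>\<^bsub>Zp p\<^esub> z = Zp_level.ker m #>\<^bsub>Zp p\<^esub> Zp_map p k"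
  by (simp add: Zp_level.ker_rcos_eq_iff Zp_map_in) (simp add: Zp_map_def)

text \<open>\<open>Zp_level.ker m\<close> is the subgroup of multiples of \<open>p^m\<close>, given
  by vanishing of the \<open>m\<close>-th coordinate. As a cylinder it is open, and these subgroups
  form a neighbourhood base at the identity.\<close>

lemma Zp_level_ker: "Zp_level.ker m = Zp.cylinder m \<one>\<^bsub>Zp p\<^esub>"
  using Zp.cylinder_eq[OF Zp.one_closed, of 0 m] by (simp add: Zp_level.ker_def Zp_one)

lemma Zp_level_open: "Zp_level.ker m \<in> open_normals (Zp p) (Zp_top p)"
  unfolding open_normals_def
  using Zp.openin_cylinder[OF Zp.one_closed, of m] Zp_level.normal_ker by (simp add: Zp_level_ker)

lemma open_normals_level:
  assumes U: "U \<in> open_normals (Zp p) (Zp_top p)" obtains m where "Zp_level.ker m \<subseteq> U"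
proof -
  interpret U: normal U "Zp p"
    using U by (simp add: open_normals_def)
  obtain m where "Zp.cylinder m \<one>\<^bsub>Zp p\<^esub> \<subseteq> U"
    using U U.one_closed unfolding open_normals_def Zp.openin_iff by blast
  then show ?thesis
    using that by (simp add: Zp_level_ker)
qed

lemma Zp_map_rcos_surj:
  assumes U: "U \<in> open_normals (Zp p) (Zp_top p)"
  shows "(\<lambda>k. U #>\<^bsub>Zp p\<^esub> Zp_map p k) ` UNIV = carrier (Zp p Mod U)"
proof (intro equalityI subsetI)
  interpret U: normal U "Zp p"
    using U by (simp add: open_normals_def)
  fix C assume "C \<in> carrier (Zp p Mod U)"
  then obtain z where z: "z \<in> carrier (Zp p)" "C = U #>\<^bsub>Zp p\<^esub> z"
    by (auto simp: FactGroup_def RCOSETS_def)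
  obtain m where m: "Zp_level.ker m \<subseteq> U"
    using open_normals_level[OF U] by blast
  \<comment> \<open>Density of the integers: the coordinate \<open>z m\<close> is itself an integer
    that agrees with \<open>z\<close> at level \<open>m\<close>.\<close>
  have "Zp_map p (z m) m = z m"
    using z(1) by (simp add: Zp_map_def Zp_mem)
  then have "z \<otimes>\<^bsub>Zp p\<^esub> inv\<^bsub>Zp p\<^esub> Zp_map p (z m) \<in> Zp_level.ker m"
    using Zp_level.\<psi>_eq_iff[of z "Zp_map p (z m)" m] z(1) Zp_map_in by simp
  then have "C = U #>\<^bsub>Zp p\<^esub> Zp_map p (z m)"
    unfolding z(2) using m z(1) Zp_map_in U.subgroup_axioms by (subst Zp.rcos_eq_iff) auto
  then show "C \<in> (\<lambda>k. U #>\<^bsub>Zp p\<^esub> Zp_map p k) ` UNIV"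
    by blast
qed (use Zp_map_in in \<open>auto simp: FactGroup_def RCOSETS_def\<close>)

lemma Zp_map_rcos_hom:
  assumes "U \<lhd> Zp p" shows "(\<lambda>k. U #>\<^bsub>Zp p\<^esub> Zp_map p k) \<in> hom Z (Zp p Mod U)"
  using assms Zp_map_in hom_mult[OF Zp_map_hom]
  by (auto simp: hom_def FactGroup_def RCOSETS_def normal.rcos_sum)

lemma pro_p_chain_integers: "pro_p_chain Z p (\<lambda>m k. k mod int p ^ m)"
proof (intro pro_p_chain.intro pro_p_chain_axioms.intro)
  fix N assume "N \<in> pro_p_normals p Z"
  then obtain k where k: "\<And>g. g [^]\<^bsub>Z\<^esub> (p ^ k) \<in> N"
    using group.pro_p_normals_pow[OF group_integer_group, of N p] by auto
  \<comment> \<open>Powers in the additive group are multiples, so \<open>N\<close> contains all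
    multiples of \<open>p ^ k\<close>.\<close>
  have "{g \<in> carrier Z. g mod int p ^ k = \<one>\<^bsub>Z\<^esub> mod int p ^ k} \<subseteq> N"
    using k by (auto elim!: dvdE simp flip: dvd_eq_mod_eq_0)
  then show "\<exists>m. {g \<in> carrier Z. g mod int p ^ m = \<one>\<^bsub>Z\<^esub> mod int p ^ m} \<subseteq> N"
    by blast
next
  show "\<exists>k. card ((\<lambda>k. k mod int p ^ m) ` carrier Z) = p ^ k" for m
    using mod_image[of m] p_gt_1 by (auto simp: carrier_Z_mod nat_power_eq intro!: exI[of _ m])
next
  show "g mod int p ^ m = h mod int p ^ m" if "g mod int p ^ Suc m = h mod int p ^ Suc m" for m g h
    using that mod_power_mod[of m "Suc m"] by (metis le_SucI order_refl)
next
  show "(g \<otimes>\<^bsub>Z\<^esub> h) mod int p ^ m = (g' \<otimes>\<^bsub>Z\<^esub> h') mod int p ^ m"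
    if "g mod int p ^ m = g' mod int p ^ m" "h mod int p ^ m = h' mod int p ^ m" for m g g' h h'
    using mod_add_cong[OF that] by simp
qed (rule group_integer_group)


section \<open>The completed group algebra\<close>

sublocale L: group_ring_Fp Z p
  using p_gt_1 by (simp add: group_ring_Fp_def group_ring_Fp_axioms_def)

lemma group_ring_Fp_Z_mod: "group_ring_Fp (Z_mod m) p"
  using p_gt_1 by (simp add: group_ring_Fp_def group_ring_Fp_axioms_def)

sublocale LR: ring "Laurent p"
  by (rule L.ring_group_ring)

sublocale level: group_ring_Fp_map Z "Z_mod m" p "\<lambda>k. k mod int p ^ m" for m
  using L.group_ring_Fp_axioms group_ring_Fp_Z_mod
  by (simp add: group_ring_Fp_map_def group_ring_Fp_map_axioms_def mod_in_Z_mod)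

abbreviation reduce :: "nat \<Rightarrow> (int \<Rightarrow> int) \<Rightarrow> int \<Rightarrow> int" where
  "reduce m \<equiv> group_ring_map (Fp p) Z (Z_mod m) (\<lambda>k. k mod int p ^ m)"

abbreviation monomial :: "int \<Rightarrow> int \<Rightarrow> int" where
  "monomial \<equiv> group_elem (Fp p) Z"

lemma monomial_in: "monomial k \<in> carrier (Laurent p)"
  by (rule L.group_elem_in) simp

text \<open>Multiplication by a monomial is the shift by which the integers act on the lamps; this
  links the wreath product to the ring.\<close>

lemma monomial_mult: "f \<in> carrier (Laurent p) \<Longrightarrow> monomial k \<otimes>\<^bsub>Laurent p\<^esub> f = (\<lambda>j. f (j - k))"
  by (simp add: L.group_elem_mult restrict_UNIV)

lemma reduce_monomial: "reduce m (monomial k) = group_elem (Fp p) (Z_mod m) (k mod int p ^ m)"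
  by (rule level.map_group_elem) simp

lemma group_ring_Fp_map_levels:
  "group_ring_Fp_map (Z_mod j) (Z_mod i) p (\<lambda>k. k mod int p ^ i)"
  using L.group_ring_Fp_axioms group_ring_Fp_Z_mod
  by (simp add: group_ring_Fp_map_def group_ring_Fp_map_axioms_def mod_in_Z_mod)

lemma inverse_system_levels:
  "inverse_system UNIV (\<le>) (\<lambda>j i. group_ring_map (Fp p) (Z_mod j) (Z_mod i) (\<lambda>k. k mod int p ^ i))
    (\<lambda>m. carrier (group_ring (Fp p) (Z_mod m))) (carrier (Laurent p)) reduce reduce (\<lambda>m. m)"
proof
  fix i j r assume "i \<le> (j :: nat)" "r \<in> carrier (Laurent p)"
  then show "group_ring_map (Fp p) (Z_mod j) (Z_mod i) (\<lambda>k. k mod int p ^ i) (reduce j r) = reduce i r"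
    by (intro group_ring_map_comp[OF level.group_ring_Fp_map_axioms group_ring_Fp_map_levels
          level.group_ring_Fp_map_axioms]) (simp_all add: mod_power_mod)
next
  show "reduce m ` carrier (Laurent p) = carrier (group_ring (Fp p) (Z_mod m))" for m
    by (rule level.map_surj) (simp add: mod_image)
qed auto

lemma ring_completion_levels:
  "ring_completion (lim_group_ring p) (lim_group_ring_top p) (Laurent p) reduce
    (\<lambda>m x r. x m = reduce m r) (lim_group_ring_map p)"
proof -
  have "lim_group_ring_map p = (\<lambda>r. \<lambda>m\<in>UNIV. reduce m r)"
    by (simp add: lim_group_ring_map_def[abs_def] restrict_UNIV)
  then show ?thesis
    unfolding lim_group_ring_def lim_group_ring_top_def
    using ring_completion_inv_lim[OF inverse_system_levels L.ring_group_ring]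
      level.map_mult[OF mod_hom] level.map_add level.map_one[OF mod_hom] by simp
qed

lemma reduce_Suc:
  assumes "f \<in> carrier (Laurent p)" "h \<in> carrier (Laurent p)" "reduce (Suc m) f = reduce (Suc m) h"
  shows "reduce m f = reduce m h"
  using inverse_system.\<psi>_antimono[OF inverse_system_levels, of m "Suc m" f h] assms by simp

abbreviation Zp_rcos :: "(nat \<Rightarrow> int) set \<Rightarrow> int \<Rightarrow> (nat \<Rightarrow> int) set" where
  "Zp_rcos U \<equiv> \<lambda>k. U #>\<^bsub>Zp p\<^esub> Zp_map p k"

abbreviation Fp_Zp_reduce :: "(nat \<Rightarrow> int) set \<Rightarrow> (int \<Rightarrow> int) \<Rightarrow> (nat \<Rightarrow> int) set \<Rightarrow> int" where
  "Fp_Zp_reduce U \<equiv> group_ring_map (Fp p) Z (Zp p Mod U) (Zp_rcos U)"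

lemma group_ring_Fp_map_Zp_rcos:
  assumes "U \<in> open_normals (Zp p) (Zp_top p)"
  shows "group_ring_Fp_map Z (Zp p Mod U) p (Zp_rcos U)"
proof -
  interpret normal U "Zp p"
    using assms by (simp add: open_normals_def)
  show ?thesis
    using Zp_map_rcos_surj[OF assms] factorgroup_is_group L.group_ring_Fp_axioms
    by (auto simp: group_ring_Fp_map_def group_ring_Fp_map_axioms_def group_ring_Fp_def)
qed

lemma group_ring_Fp_map_rcos_rcos:
  assumes U: "U \<in> open_normals (Zp p) (Zp_top p)" and V: "V \<in> open_normals (Zp p) (Zp_top p)"
    and "V \<subseteq> U"
  shows "group_ring_Fp_map (Zp p Mod V) (Zp p Mod U) p (\<lambda>C. U <#>\<^bsub>Zp p\<^esub> C)"
proof -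
  interpret U: group_ring_Fp_map Z "Zp p Mod U" p "Zp_rcos U"
    using U by (rule group_ring_Fp_map_Zp_rcos)
  interpret V: group_ring_Fp_map Z "Zp p Mod V" p "Zp_rcos V"
    using V by (rule group_ring_Fp_map_Zp_rcos)
  show ?thesis
    unfolding group_ring_Fp_map_def group_ring_Fp_map_axioms_def
  proof (intro conjI allI impI U.H.group_ring_Fp_axioms V.H.group_ring_Fp_axioms)
    fix C assume "C \<in> carrier (Zp p Mod V)"
    then obtain z where "z \<in> carrier (Zp p)" "C = V #>\<^bsub>Zp p\<^esub> z"
      by (auto simp: FactGroup_def RCOSETS_def)
    moreover have "U \<lhd> Zp p" "V \<lhd> Zp p"
      using U V by (auto simp: open_normals_def)
    ultimately show "U <#>\<^bsub>Zp p\<^esub> C \<in> carrier (Zp p Mod U)"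
      using Zp.normal_absorb \<open>V \<subseteq> U\<close> by (auto simp: FactGroup_def RCOSETS_def)
  qed
qed

text \<open>The level map is \<open>reduce\<close>, although the quotients here are by subgroups of
  the p-adic integers: two integers lie in the same coset of \<open>Zp_level.ker m\<close> exactly
  when they agree modulo \<open>p^m\<close>, and only these fibres matter.\<close>

lemma inverse_system_open_normals:
  "inverse_system (open_normals (Zp p) (Zp_top p)) (\<lambda>U V. V \<subseteq> U)
    (\<lambda>V U. group_ring_map (Fp p) (Zp p Mod V) (Zp p Mod U) (\<lambda>C. U <#>\<^bsub>Zp p\<^esub> C))
    (\<lambda>U. carrier (group_ring (Fp p) (Zp p Mod U))) (carrier (Laurent p)) reduce
    Fp_Zp_reduce Zp_level.ker"
proof
  fix U V r
  assume UV: "U \<in> open_normals (Zp p) (Zp_top p)" "V \<in> open_normals (Zp p) (Zp_top p)" "V \<subseteq> U"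
    and r: "r \<in> carrier (Laurent p)"
  have "Zp_rcos U k = U <#>\<^bsub>Zp p\<^esub> Zp_rcos V k" for k
    using UV Zp.normal_absorb Zp_map_in by (simp add: open_normals_def)
  then show "group_ring_map (Fp p) (Zp p Mod V) (Zp p Mod U) (\<lambda>C. U <#>\<^bsub>Zp p\<^esub> C) (Fp_Zp_reduce V r)
      = Fp_Zp_reduce U r"
    using UV r by (intro group_ring_map_comp[OF group_ring_Fp_map_Zp_rcos group_ring_Fp_map_rcos_rcos
          group_ring_Fp_map_Zp_rcos]) auto
next
  fix U assume U: "U \<in> open_normals (Zp p) (Zp_top p)"
  interpret group_ring_Fp_map Z "Zp p Mod U" p "Zp_rcos U"
    using U by (rule group_ring_Fp_map_Zp_rcos)
  show "Fp_Zp_reduce U ` carrier (Laurent p) = carrier (group_ring (Fp p) (Zp p Mod U))"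
    using Zp_map_rcos_surj[OF U] by (intro map_surj) simp
next
  fix m m' :: nat assume "m \<le> m'"
  then have "z m = 0" if "z \<in> carrier (Zp p)" "z m' = 0" for z
    using that by (metis Zp_mem mod_0)
  then show "Zp_level.ker m' \<subseteq> Zp_level.ker m"
    by (auto simp: Zp_level.ker_def Zp_one)
next
  fix U assume "U \<in> open_normals (Zp p) (Zp_top p)"
  then show "\<exists>m. Zp_level.ker m \<subseteq> U"
    using open_normals_level by blast
next
  fix g h m assume "g \<in> carrier (Laurent p)" "h \<in> carrier (Laurent p)"
  moreover have "Zp_rcos (Zp_level.ker m) a = Zp_rcos (Zp_level.ker m) b
      \<longleftrightarrow> a mod int p ^ m = b mod int p ^ m" for a b
    using Zp_level.ker_rcos_eq_iff[OF Zp_map_in Zp_map_in] by (simp add: Zp_map_def)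
  ultimately show "Fp_Zp_reduce (Zp_level.ker m) g = Fp_Zp_reduce (Zp_level.ker m) h
      \<longleftrightarrow> reduce m g = reduce m h"
    by (intro group_ring_map_eq_iff[OF group_ring_Fp_map_Zp_rcos[OF Zp_level_open] level.group_ring_Fp_map_axioms])
qed (use Zp_level_open in auto)

lemma ring_completion_Fp_Zp:
  "ring_completion (Fp_Zp p) (Fp_Zp_top p) (Laurent p) reduce
    (\<lambda>m x r. x (Zp_level.ker m) = Fp_Zp_reduce (Zp_level.ker m) r) (Fp_Zp_map p)"
  unfolding completed_group_ring_def completed_group_ring_top_def completed_group_ring_map_def[abs_def]
proof (rule ring_completion_inv_lim[OF inverse_system_open_normals L.ring_group_ring])
  fix U g h
  assume U: "U \<in> open_normals (Zp p) (Zp_top p)" and gh: "g \<in> carrier (Laurent p)" "h \<in> carrier (Laurent p)"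
  interpret group_ring_Fp_map Z "Zp p Mod U" p "Zp_rcos U"
    using U by (rule group_ring_Fp_map_Zp_rcos)
  have hom: "Zp_rcos U \<in> hom Z (Zp p Mod U)"
    using U by (intro Zp_map_rcos_hom) (simp add: open_normals_def)
  show "Fp_Zp_reduce U g \<otimes>\<^bsub>group_ring (Fp p) (Zp p Mod U)\<^esub> Fp_Zp_reduce U h
      = Fp_Zp_reduce U (g \<otimes>\<^bsub>Laurent p\<^esub> h)"
    using map_mult[OF hom gh] by simp
  show "Fp_Zp_reduce U g \<oplus>\<^bsub>group_ring (Fp p) (Zp p Mod U)\<^esub> Fp_Zp_reduce U h
      = Fp_Zp_reduce U (g \<oplus>\<^bsub>Laurent p\<^esub> h)"
    using map_add[OF gh] by simp
next
  fix U assume U: "U \<in> open_normals (Zp p) (Zp_top p)"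
  interpret group_ring_Fp_map Z "Zp p Mod U" p "Zp_rcos U"
    using U by (rule group_ring_Fp_map_Zp_rcos)
  have hom: "Zp_rcos U \<in> hom Z (Zp p Mod U)"
    using U by (intro Zp_map_rcos_hom) (simp add: open_normals_def)
  show "Fp_Zp_reduce U \<one>\<^bsub>Laurent p\<^esub> = \<one>\<^bsub>group_ring (Fp p) (Zp p Mod U)\<^esub>"
    by (rule map_one[OF hom])
qed


section \<open>Pro-p quotients of the Laurent polynomials\<close>

text \<open>
  The kernel of the reduction to \<open>\<FF>\<^sub>p[\<int>/p^m\<int>]\<close> is generated by \<open>1 - x^(p^m)\<close>; the quotient is found by
  summing the coefficients along each residue class.
\<close>

lemma reduce_eq_zero_imp_difference:
  assumes f: "f \<in> carrier (Laurent p)" and f0: "reduce m f = reduce m \<zero>\<^bsub>Laurent p\<^esub>"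
  obtains g where "g \<in> carrier (Laurent p)" "f \<oplus>\<^bsub>Laurent p\<^esub> (monomial (int p ^ m) \<otimes>\<^bsub>Laurent p\<^esub> g) = g"
proof -
  let ?q = "int p ^ m" and ?S = "L.supp f"
  have q: "?q > 0"
    using p_gt_1 by simp
  \<comment> \<open>The formal quotient of \<open>f\<close> by \<open>1 - x^(p^m)\<close>: the
    partial sums of \<open>f\<close> along each residue class, up to \<open>j\<close>.\<close>
  define g where "g = (\<lambda>j. (\<Sum>a\<in>{a \<in> ?S. a mod ?q = j mod ?q \<and> a \<le> j}. f a) mod int p)"
  \<comment> \<open>The hypothesis on \<open>f\<close> enters here: the full sum over each class
    vanishes modulo \<open>p\<close>, so the partial sums become zero again to the right of the
    support.\<close>
  have class_sum: "(\<Sum>a\<in>{a \<in> ?S. a mod ?q = j mod ?q}. f a) mod int p = 0" for j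
  proof -
    have "(\<Sum>a\<in>{a \<in> ?S. a mod ?q = j mod ?q}. f a) mod int p = reduce m \<zero>\<^bsub>Laurent p\<^esub> (j mod ?q)"
      unfolding f0[symmetric] by (simp add: level.map_eq[OF f] mod_in_Z_mod)
    also have "\<dots> = (\<Sum>a\<in>{a \<in> L.supp \<zero>\<^bsub>Laurent p\<^esub>. a mod ?q = j mod ?q}. \<zero>\<^bsub>Laurent p\<^esub> a) mod int p"
      by (simp add: level.map_eq[OF LR.zero_closed] mod_in_Z_mod)
    also have "\<dots> = 0"
      by (simp add: L.group_ring_zero group_ring_supp_def)
    finally show ?thesis .
  qed
  have S: "finite ?S"
    using f by (rule L.finite_supp)
  have "g \<in> carrier (Laurent p)"
  proof -
    \<comment> \<open>Left of \<open>-B\<close> the partial sums are empty; right of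
      \<open>B\<close> they are full class sums.\<close>
    define B where "B = Max (abs ` ?S)"
    have B: "\<bar>a\<bar> \<le> B" if "a \<in> ?S" for a
      unfolding B_def using S that by (intro Max_ge) auto
    have "j \<in> {-B..B}" if "g j \<noteq> 0" for j
    proof (rule ccontr)
      assume "j \<notin> {-B..B}"
      then consider "j < - B" | "j > B"
        by fastforce
      then show False
      proof cases
        case 1
        then have "{a \<in> ?S. a mod ?q = j mod ?q \<and> a \<le> j} = {}"
          using B by fastforce
        with that show False
          by (simp add: g_def del: Collect_empty_eq)
      next
        case 2
        then have "{a \<in> ?S. a mod ?q = j mod ?q \<and> a \<le> j} = {a \<in> ?S. a mod ?q = j mod ?q}"
          using B by fastforce
        with that class_sum show False
          by (simp add: g_def)
      qed
    qed
    then show ?thesis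
      using L.restrict_mod_in_group_ring[of "{-B..B}" "\<lambda>j. \<Sum>a\<in>{a \<in> ?S. a mod ?q = j mod ?q \<and> a \<le> j}. f a"]
      by (simp add: g_def restrict_UNIV)
  qed
  moreover have "(f j + g (j - ?q)) mod int p = g j" for j
  proof -
    let ?A = "\<lambda>j. {a \<in> ?S. a mod ?q = j mod ?q \<and> a \<le> j}"
    \<comment> \<open>Passing from \<open>j - ?q\<close> to \<open>j\<close> adds only the index
      \<open>j\<close>, since distinct members of a class differ by at least
      \<open>?q\<close>.\<close>
    have less: "a \<le> j - ?q" if "a mod ?q = j mod ?q" "a \<le> j" "a \<noteq> j" for a
    proof -
      have "?q dvd j - a"
        using that(1) by (simp add: mod_eq_dvd_iff dvd_diff_commute)
      then have "?q \<le> j - a"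
        using that by (intro zdvd_imp_le) auto
      then show ?thesis
        by simp
    qed
    have le: "a \<le> j" if "a \<le> j - ?q" for a
      using q that by linarith
    have "(j - ?q) mod ?q = j mod ?q"
      by simp
    then have "?A j = ?A (j - ?q) \<union> (if j \<in> ?S then {j} else {})"
      using less le by (simp only: split: if_split) blast
    moreover have "\<not> j \<le> j - ?q"
      using q by linarith
    then have "j \<notin> ?A (j - ?q)"
      by blast
    ultimately have "sum f (?A j) = sum f (?A (j - ?q)) + (if j \<in> ?S then f j else 0)"
      using S by simp
    also have "(if j \<in> ?S then f j else 0) = f j"
      by (simp add: group_ring_supp_def)
    finally show ?thesis
      by (simp add: g_def mod_add_right_eq add.commute)
  qed
  ultimately show ?thesis
    using that by (simp add: L.group_ring_add monomial_mult restrict_UNIV)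
qed

section \<open>Kernels of the reductions as a cofinal chain of pro-p ideals\<close>

lemma reduce_surj: "reduce m ` carrier (Laurent p) = carrier (group_ring (Fp p) (Z_mod m))"
  by (rule level.map_surj) (simp add: mod_image)

lemma carrier_group_ring_Z_mod:
  "carrier (group_ring (Fp p) (Z_mod m)) = (\<Pi>\<^sub>E a\<in>{0..<int p ^ m}. {0..<int p})"
proof -
  have "finite (group_ring_supp (Z_mod m) f)" for f
    by (rule finite_subset[of _ "{0..<int p ^ m}"]) (auto simp: group_ring_supp_def carrier_Z_mod)
  then show ?thesis
    by (auto simp: group_ring_Fp.mem_group_ring[OF group_ring_Fp_Z_mod] carrier_Z_mod PiE_def Pi_def)
qed

lemma card_group_ring_Z_mod: "card (carrier (group_ring (Fp p) (Z_mod m))) = p ^ (p ^ m)"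
  using p_gt_1 unfolding carrier_group_ring_Z_mod by (simp add: card_PiE nat_power_eq)

sublocale reduce_add: group_congruence "add_monoid (Laurent p)" "reduce m" for m
proof (rule group_congruence.intro[OF LR.a_group group_congruence_axioms.intro])
  fix g g' h h'
  assume "g \<in> carrier (add_monoid (Laurent p))" "g' \<in> carrier (add_monoid (Laurent p))"
    "h \<in> carrier (add_monoid (Laurent p))" "h' \<in> carrier (add_monoid (Laurent p))"
    "reduce m g = reduce m g'" "reduce m h = reduce m h'"
  then show "reduce m (g \<otimes>\<^bsub>add_monoid (Laurent p)\<^esub> h) = reduce m (g' \<otimes>\<^bsub>add_monoid (Laurent p)\<^esub> h')"
    by (simp add: level.map_add)
qed

definition reduce_ker :: "nat \<Rightarrow> (int \<Rightarrow> int) set" where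
  "reduce_ker m = {f \<in> carrier (Laurent p). reduce m f = reduce m \<zero>\<^bsub>Laurent p\<^esub>}"

lemma reduce_add_ker: "reduce_add.ker m = reduce_ker m"
  unfolding reduce_add.ker_def reduce_ker_def by simp

lemma reduce_ker_rcos_eq_iff:
  assumes "f \<in> carrier (Laurent p)" "h \<in> carrier (Laurent p)"
  shows "reduce_ker m +>\<^bsub>Laurent p\<^esub> f = reduce_ker m +>\<^bsub>Laurent p\<^esub> h \<longleftrightarrow> reduce m f = reduce m h"
  using reduce_add.ker_rcos_eq_iff[unfolded reduce_add_ker, of f h m] assms by (simp add: a_r_coset_def)

lemma ideal_reduce_ker: "ideal (reduce_ker m) (Laurent p)"
proof (rule idealI[OF L.ring_group_ring reduce_add.subgroup_ker[unfolded reduce_add_ker]])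
  fix a x assume "a \<in> reduce_ker m" and x: "x \<in> carrier (Laurent p)"
  then have a: "a \<in> carrier (Laurent p)" "reduce m a = reduce m \<zero>\<^bsub>Laurent p\<^esub>"
    by (auto simp: reduce_ker_def)
  have "reduce m (x \<otimes>\<^bsub>Laurent p\<^esub> a) = reduce m (x \<otimes>\<^bsub>Laurent p\<^esub> \<zero>\<^bsub>Laurent p\<^esub>)"
    using a x by (simp add: level.map_mult[OF mod_hom] del: LR.r_null)
  then show "x \<otimes>\<^bsub>Laurent p\<^esub> a \<in> reduce_ker m"
    using a x by (simp add: reduce_ker_def)
  have "reduce m (a \<otimes>\<^bsub>Laurent p\<^esub> x) = reduce m (\<zero>\<^bsub>Laurent p\<^esub> \<otimes>\<^bsub>Laurent p\<^esub> x)"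
    using a x by (simp add: level.map_mult[OF mod_hom] del: LR.l_null)
  then show "a \<otimes>\<^bsub>Laurent p\<^esub> x \<in> reduce_ker m"
    using a x by (simp add: reduce_ker_def)
qed

text \<open>Both counts are made in \<open>\<FF>\<close>p of the cyclic group of order
  \<open>p^m\<close>: the ring has \<open>p^(p^m)\<close> elements, and the monomials reduce to its
  \<open>p^m\<close> distinct group elements.\<close>

lemma reduce_ker_in_pro_p_ideals: "reduce_ker m \<in> pro_p_ideals p (Fp p) Z"
proof -
  have "card (a_rcosets\<^bsub>Laurent p\<^esub> reduce_ker m) = p ^ (p ^ m)"
    using reduce_add.card_rcosets_ker[unfolded reduce_add_ker, of m]
      by (simp add: A_RCOSETS_def reduce_surj card_group_ring_Z_mod)
  moreover have "card ((\<lambda>k. reduce_ker m +>\<^bsub>Laurent p\<^esub> monomial k) ` carrier Z) = p ^ m"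
  proof -
    have "reduce m (monomial k) = reduce m (monomial l) \<longleftrightarrow> k mod int p ^ m = l mod int p ^ m" for k l
      unfolding reduce_monomial group_ring_Fp.group_elem_eq[OF group_ring_Fp_Z_mod]
      using mod_in_Z_mod[of k m] mod_in_Z_mod[of l m] by (auto simp: fun_eq_iff restrict_def)
    then have "card ((\<lambda>k. reduce_ker m +>\<^bsub>Laurent p\<^esub> monomial k) ` UNIV)
        = card ((\<lambda>k. k mod int p ^ m) ` UNIV)"
      by (intro card_image_eq_card_image) (simp add: reduce_ker_rcos_eq_iff monomial_in)
    then show ?thesis
      using p_gt_1 by (simp add: mod_image carrier_Z_mod nat_power_eq)
  qed
  ultimately show ?thesis
    using ideal_reduce_ker by (auto simp: pro_p_ideals_def)
qed

text \<open>The images of the monomials form a p-group, so \<open>x^(p^m)\<close> is 1 modulo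
  \<open>I\<close> for some \<open>m\<close>. If \<open>f + x^(p^m) g = g\<close>, then modulo
  \<open>I\<close> this reads \<open>f + g = g\<close>, which forces \<open>f\<close> into
  \<open>I\<close>.\<close>

lemma pro_p_ideals_cofinal:
  assumes I: "I \<in> pro_p_ideals p (Fp p) Z" obtains m where "reduce_ker m \<subseteq> I"
proof -
  interpret I: ideal I "Laurent p"
    using I by (simp add: pro_p_ideals_def)
  have mult_coset: "I +>\<^bsub>Laurent p\<^esub> (a \<otimes>\<^bsub>Laurent p\<^esub> b) = I +>\<^bsub>Laurent p\<^esub> (a' \<otimes>\<^bsub>Laurent p\<^esub> b')"
    if "a \<in> carrier (Laurent p)" "b \<in> carrier (Laurent p)" "a' \<in> carrier (Laurent p)" "b' \<in> carrier (Laurent p)"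
      "I +>\<^bsub>Laurent p\<^esub> a = I +>\<^bsub>Laurent p\<^esub> a'" "I +>\<^bsub>Laurent p\<^esub> b = I +>\<^bsub>Laurent p\<^esub> b'" for a b a' b'
    using I.rcoset_mult_add[of a b] I.rcoset_mult_add[of a' b'] that by simp
  have monomial_add: "monomial (k + l) = monomial k \<otimes>\<^bsub>Laurent p\<^esub> monomial l" for k l
    by (auto simp: monomial_mult[OF monomial_in]) (auto simp: L.group_elem_eq fun_eq_iff)
  \<comment> \<open>The exponents whose monomial is 1 modulo \<open>I\<close> form a subgroup of the
    integers of p-power index, so the bound on powers proved for groups applies.\<close>
  interpret mono: group_congruence Z "\<lambda>k. I +>\<^bsub>Laurent p\<^esub> monomial k"
  proof (rule group_congruence.intro[OF group_integer_group group_congruence_axioms.intro])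
    show "I +>\<^bsub>Laurent p\<^esub> monomial (k \<otimes>\<^bsub>Z\<^esub> l) = I +>\<^bsub>Laurent p\<^esub> monomial (k' \<otimes>\<^bsub>Z\<^esub> l')"
      if "I +>\<^bsub>Laurent p\<^esub> monomial k = I +>\<^bsub>Laurent p\<^esub> monomial k'"
        "I +>\<^bsub>Laurent p\<^esub> monomial l = I +>\<^bsub>Laurent p\<^esub> monomial l'" for k l k' l'
      using mult_coset[OF monomial_in monomial_in monomial_in monomial_in that]
        by (simp add: monomial_add)
  qed
  have "mono.ker \<in> pro_p_normals p Z"
    using I mono.normal_ker mono.card_rcosets_ker by (auto simp: pro_p_normals_def pro_p_ideals_def)
  then obtain m where "1 [^]\<^bsub>Z\<^esub> (p ^ m) \<in> mono.ker"
    using group.pro_p_normals_pow[OF group_integer_group] by (metis UNIV_I carrier_integer_group)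
  then have m: "I +>\<^bsub>Laurent p\<^esub> monomial (int p ^ m) = I +>\<^bsub>Laurent p\<^esub> monomial 0"
    by (simp add: mono.ker_def)
  have "f \<in> I" if "f \<in> reduce_ker m" for f
  proof -
    have f: "f \<in> carrier (Laurent p)" "reduce m f = reduce m \<zero>\<^bsub>Laurent p\<^esub>"
      using that by (auto simp: reduce_ker_def)
    obtain g where g: "g \<in> carrier (Laurent p)"
      "f \<oplus>\<^bsub>Laurent p\<^esub> (monomial (int p ^ m) \<otimes>\<^bsub>Laurent p\<^esub> g) = g"
      using reduce_eq_zero_imp_difference[OF f] .
    have "I +>\<^bsub>Laurent p\<^esub> (monomial (int p ^ m) \<otimes>\<^bsub>Laurent p\<^esub> g)
        = I +>\<^bsub>Laurent p\<^esub> (monomial 0 \<otimes>\<^bsub>Laurent p\<^esub> g)"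
      using g(1) m by (intro mult_coset) (simp_all add: monomial_in)
    then have "I +>\<^bsub>Laurent p\<^esub> (f \<oplus>\<^bsub>Laurent p\<^esub> (monomial (int p ^ m) \<otimes>\<^bsub>Laurent p\<^esub> g))
        = I +>\<^bsub>Laurent p\<^esub> (f \<oplus>\<^bsub>Laurent p\<^esub> (monomial 0 \<otimes>\<^bsub>Laurent p\<^esub> g))"
      using f(1) g(1) monomial_in by (simp flip: I.a_rcos_sum)
    then have "I +>\<^bsub>Laurent p\<^esub> (f \<oplus>\<^bsub>Laurent p\<^esub> g) = I +>\<^bsub>Laurent p\<^esub> g"
      unfolding g(2) using g(1) by (simp add: monomial_mult)
    then have "f \<oplus>\<^bsub>Laurent p\<^esub> g \<in> I +>\<^bsub>Laurent p\<^esub> g"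
      using I.a_rcos_self[of "f \<oplus>\<^bsub>Laurent p\<^esub> g"] f g(1) by simp
    then obtain h where h: "h \<in> I" "f \<oplus>\<^bsub>Laurent p\<^esub> g = h \<oplus>\<^bsub>Laurent p\<^esub> g"
      unfolding a_r_coset_def' by auto
    then show "f \<in> I"
      using f(1) g(1) I.a_Hcarr[OF h(1)] LR.add.right_cancel[of g f h] by simp
  qed
  then show ?thesis
    using that by blast
qed

lemma inverse_system_pro_p_ideals:
  "inverse_system (pro_p_ideals p (Fp p) Z) (\<lambda>I J. J \<subseteq> I) (\<lambda>J I C. I <+>\<^bsub>Laurent p\<^esub> C)
    (\<lambda>I. carrier (Laurent p Quot I)) (carrier (Laurent p)) reduce
    (\<lambda>I r. I +>\<^bsub>Laurent p\<^esub> r) reduce_ker"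
proof
  fix I J r
  assume "I \<in> pro_p_ideals p (Fp p) Z" "J \<in> pro_p_ideals p (Fp p) Z" and JI: "J \<subseteq> I" and r: "r \<in> carrier (Laurent p)"
  then interpret I: ideal I "Laurent p" + J: ideal J "Laurent p"
    by (simp_all add: pro_p_ideals_def)
  show "I <+>\<^bsub>Laurent p\<^esub> (J +>\<^bsub>Laurent p\<^esub> r) = I +>\<^bsub>Laurent p\<^esub> r"
    using group.normal_absorb[OF LR.a_group I.a_normal J.a_normal JI] r
    by (simp add: set_add_def a_r_coset_def)
next
  show "(\<lambda>r. I +>\<^bsub>Laurent p\<^esub> r) ` carrier (Laurent p) = carrier (Laurent p Quot I)" for I
    by (auto simp: FactRing_def A_RCOSETS_def RCOSETS_def a_r_coset_def)
next
  show "reduce_ker m' \<subseteq> reduce_ker m" if "m \<le> m'" for m m'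
    using inverse_system.\<psi>_antimono[OF inverse_system_levels that] by (auto simp: reduce_ker_def)
next
  show "\<exists>m. reduce_ker m \<subseteq> I" if "I \<in> pro_p_ideals p (Fp p) Z" for I
    using pro_p_ideals_cofinal[OF that] by blast
qed (use reduce_ker_in_pro_p_ideals reduce_ker_rcos_eq_iff in auto)

lemma ring_completion_pro_p_group_ring:
  "ring_completion (pro_p_group_ring p (Fp p) Z) (pro_p_group_ring_top p (Fp p) Z) (Laurent p) reduce
    (\<lambda>m x r. x (reduce_ker m) = reduce_ker m +>\<^bsub>Laurent p\<^esub> r) (pro_p_group_ring_map p (Fp p) Z)"
  unfolding pro_p_group_ring_def pro_p_group_ring_top_def pro_p_group_ring_map_def[abs_def]
proof (rule ring_completion_inv_lim[OF inverse_system_pro_p_ideals L.ring_group_ring])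
  fix I g h
  assume "I \<in> pro_p_ideals p (Fp p) Z" and gh: "g \<in> carrier (Laurent p)" "h \<in> carrier (Laurent p)"
  then interpret ideal I "Laurent p"
    by (simp add: pro_p_ideals_def)
  show "(I +>\<^bsub>Laurent p\<^esub> g) \<otimes>\<^bsub>Laurent p Quot I\<^esub> (I +>\<^bsub>Laurent p\<^esub> h) = I +>\<^bsub>Laurent p\<^esub> (g \<otimes>\<^bsub>Laurent p\<^esub> h)"
    using gh by (simp add: FactRing_def rcoset_mult_add)
  show "(I +>\<^bsub>Laurent p\<^esub> g) \<oplus>\<^bsub>Laurent p Quot I\<^esub> (I +>\<^bsub>Laurent p\<^esub> h) = I +>\<^bsub>Laurent p\<^esub> (g \<oplus>\<^bsub>Laurent p\<^esub> h)"
    using gh by (simp add: FactRing_def a_rcos_sum)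
qed (simp add: FactRing_def)


section \<open>The lamplighter group\<close>

abbreviation lamps :: "nat \<Rightarrow> (int \<Rightarrow> nat \<Rightarrow> int) set" where
  "lamps n \<equiv> carrier (sum_group (UNIV :: int set) (\<lambda>_. product_group {..<n} (\<lambda>_. integer_mod_group p)))"

text \<open>Since there are finitely many coordinates, a configuration has finite support exactly
  when each coordinate does; the coordinates, called rows below, are then Laurent
  polynomials.\<close>

lemma lamps_mem:
  "f \<in> lamps n \<longleftrightarrow> (\<forall>j. f j \<in> extensional {..<n}) \<and> (\<forall>i<n. (\<lambda>j. f j i) \<in> carrier (Laurent p))"
proof -
  have carrier: "carrier (integer_mod_group p) = {0..<int p}"
    using carrier_Z_mod[of 1] by simp
  have "f \<in> lamps n \<longleftrightarrow> (\<forall>j. f j \<in> extensional {..<n}) \<and> (\<forall>j. \<forall>i<n. 0 \<le> f j i \<and> f j i < int p) \<and>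
      finite {j. f j \<noteq> (\<lambda>i\<in>{..<n}. 0)}"
    by (subst carrier_sum_group) (auto simp: carrier PiE_iff)
  also have "\<dots> \<longleftrightarrow> (\<forall>j. f j \<in> extensional {..<n}) \<and> (\<forall>j. \<forall>i<n. 0 \<le> f j i \<and> f j i < int p) \<and>
      (\<forall>i<n. finite {j. f j i \<noteq> 0})"
  proof -
    have "{j. f j \<noteq> (\<lambda>i\<in>{..<n}. 0)} = (\<Union>i<n. {j. f j i \<noteq> 0})" if "\<forall>j. f j \<in> extensional {..<n}"
      using that by (auto simp: extensional_def fun_eq_iff)
    then show ?thesis
      by auto
  qed
  also have "\<dots> \<longleftrightarrow> (\<forall>j. f j \<in> extensional {..<n}) \<and> (\<forall>i<n. (\<lambda>j. f j i) \<in> carrier (Laurent p))"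
    by (auto simp: L.mem_group_ring group_ring_supp_def)
  finally show ?thesis .
qed

lemma lamps_mod: "f \<in> lamps n \<Longrightarrow> i < n \<Longrightarrow> f j i mod int p = f j i"
  using L.mod_self[of "\<lambda>j. f j i" j] by (simp add: lamps_mem)

lemma lamps_ext: "f \<in> lamps n \<Longrightarrow> (\<lambda>i\<in>{..<n}. f j i) = f j"
  by (simp add: lamps_mem extensional_restrict)

lemma lamps_eqI:
  assumes "f \<in> lamps n" "h \<in> lamps n" "\<And>i. i < n \<Longrightarrow> (\<lambda>j. f j i) = (\<lambda>j. h j i)"
  shows "f = h"
proof
  fix j
  show "f j = h j"
  proof (rule extensionalityI)
    show "f j i = h j i" if "i \<in> {..<n}" for i
      using fun_cong[OF assms(3), of i j] that by simp
  qed (use assms(1,2) in \<open>auto simp: lamps_mem\<close>)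
qed

lemma lamps_of_rows:
  assumes "\<And>i. i < n \<Longrightarrow> r i \<in> carrier (Laurent p)"
  shows "(\<lambda>j. \<lambda>i\<in>{..<n}. r i j) \<in> lamps n"
  unfolding lamps_mem using assms by simp

lemma carrier_lamplighter: "carrier (lamplighter p n) = lamps n \<times> UNIV"
  by (simp add: lamplighter_def wreath_int_def semidirect_def)

lemma lamplighter_mult:
  "(f, k) \<otimes>\<^bsub>lamplighter p n\<^esub> (h, l) = (\<lambda>j. \<lambda>i\<in>{..<n}. (f j i + h (j - k) i) mod int p, k + l)"
  by (simp add: lamplighter_def wreath_int_def semidirect_def restrict_UNIV)

lemma lamplighter_one: "\<one>\<^bsub>lamplighter p n\<^esub> = (\<lambda>j. \<lambda>i\<in>{..<n}. 0, 0)"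
  by (simp add: lamplighter_def wreath_int_def semidirect_def restrict_UNIV)

text \<open>Each row of a product is \<open>a + x^k b\<close>, an expression in ring operations, to
  which the homomorphisms \<open>reduce\<close> apply.\<close>

lemma lamplighter_mult_row:
  assumes "h \<in> lamps n" "i < n"
  shows "(\<lambda>j. fst ((f, k) \<otimes>\<^bsub>lamplighter p n\<^esub> (h, l)) j i)
    = (\<lambda>j. f j i) \<oplus>\<^bsub>Laurent p\<^esub> (monomial k \<otimes>\<^bsub>Laurent p\<^esub> (\<lambda>j. h j i))"
proof -
  have "(\<lambda>j. h j i) \<in> carrier (Laurent p)"
    using assms by (simp add: lamps_mem)
  then show ?thesis
    using assms(2) by (simp add: lamplighter_mult monomial_mult L.group_ring_add restrict_UNIV)
qed

lemma lamplighter_mult_in: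
  assumes "f \<in> lamps n" "h \<in> lamps n"
  shows "(f, k) \<otimes>\<^bsub>lamplighter p n\<^esub> (h, l) \<in> carrier (lamplighter p n)"
proof -
  have "(\<lambda>j. fst ((f, k) \<otimes>\<^bsub>lamplighter p n\<^esub> (h, l)) j i) \<in> carrier (Laurent p)" if "i < n" for i
    unfolding lamplighter_mult_row[OF assms(2) that]
    using assms that by (simp add: lamps_mem monomial_in)
  then have "fst ((f, k) \<otimes>\<^bsub>lamplighter p n\<^esub> (h, l)) \<in> lamps n"
    unfolding lamps_mem by (simp add: lamplighter_mult)
  then show ?thesis
    by (simp add: carrier_lamplighter lamplighter_mult)
qed

lemma group_lamplighter: "group (lamplighter p n)"
proof (rule groupI)
  show "\<one>\<^bsub>lamplighter p n\<^esub> \<in> carrier (lamplighter p n)"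
    using LR.zero_closed lamps_of_rows[of n "\<lambda>_ _. 0"]
    by (simp add: carrier_lamplighter lamplighter_one L.group_ring_zero restrict_UNIV)
  fix x assume "x \<in> carrier (lamplighter p n)"
  then obtain f k where x: "x = (f, k)" "f \<in> lamps n"
    by (auto simp: carrier_lamplighter)
  show "\<one>\<^bsub>lamplighter p n\<^esub> \<otimes>\<^bsub>lamplighter p n\<^esub> x = x"
    by (simp add: x(1) lamplighter_one lamplighter_mult lamps_mod[OF x(2)] lamps_ext[OF x(2)] cong: restrict_cong)
  \<comment> \<open>The inverse of \<open>(f, k)\<close> is \<open>- x^(-k) f\<close> together with
    \<open>- k\<close>.\<close>
  let ?f = "\<lambda>j. \<lambda>i\<in>{..<n}. (- f (j + k) i) mod int p"
  have "(\<lambda>j. (- f (j + k) i) mod int p) \<in> carrier (Laurent p)" if "i < n" for i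
  proof -
    have "finite ((\<lambda>j. j - k) ` L.supp (\<lambda>j. f j i))"
      using x(2) that by (simp add: L.finite_supp lamps_mem)
    moreover have "j \<in> (\<lambda>j. j - k) ` L.supp (\<lambda>j. f j i)" if "(- f (j + k) i) mod int p \<noteq> 0" for j
      using that by (intro image_eqI[of _ _ "j + k"]) (auto simp: group_ring_supp_def)
    ultimately show ?thesis
      using L.restrict_mod_in_group_ring[of "(\<lambda>j. j - k) ` L.supp (\<lambda>j. f j i)" "\<lambda>j. - f (j + k) i"]
      by (simp add: restrict_UNIV)
  qed
  then have "?f \<in> lamps n"
    by (rule lamps_of_rows)
  moreover have "(?f, - k) \<otimes>\<^bsub>lamplighter p n\<^esub> x = \<one>\<^bsub>lamplighter p n\<^esub>"
    by (simp add: x(1) lamplighter_one lamplighter_mult fun_eq_iff restrict_def mod_add_left_eq)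
  ultimately show "\<exists>y\<in>carrier (lamplighter p n). y \<otimes>\<^bsub>lamplighter p n\<^esub> x = \<one>\<^bsub>lamplighter p n\<^esub>"
    by (intro bexI[of _ "(?f, - k)"]) (simp_all add: carrier_lamplighter)
  fix y z assume "y \<in> carrier (lamplighter p n)" "z \<in> carrier (lamplighter p n)"
  then show "x \<otimes>\<^bsub>lamplighter p n\<^esub> y \<otimes>\<^bsub>lamplighter p n\<^esub> z = x \<otimes>\<^bsub>lamplighter p n\<^esub> (y \<otimes>\<^bsub>lamplighter p n\<^esub> z)"
    by (cases y; cases z)
      (simp add: x(1) lamplighter_mult fun_eq_iff restrict_def mod_add_left_eq mod_add_right_eq algebra_simps)
next
  show "x \<otimes>\<^bsub>lamplighter p n\<^esub> y \<in> carrier (lamplighter p n)"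
    if "x \<in> carrier (lamplighter p n)" "y \<in> carrier (lamplighter p n)" for x y
    using that lamplighter_mult_in by (auto simp: carrier_lamplighter)
qed

text \<open>The label of an element in the finite semidirect product at level \<open>m\<close>. One
  \<open>m\<close> serves both components, because multiplication by \<open>x^k\<close> on the
  reduced ring depends only on \<open>k\<close> modulo \<open>p^m\<close>.\<close>

definition lamplighter_level :: "nat \<Rightarrow> nat \<Rightarrow> (int \<Rightarrow> nat \<Rightarrow> int) \<times> int \<Rightarrow> (nat \<Rightarrow> int \<Rightarrow> int) \<times> int" where
  "lamplighter_level n m g = (\<lambda>i\<in>{..<n}. reduce m (\<lambda>j. fst g j i), snd g mod int p ^ m)"

lemma lamplighter_level_eq_iff:
  "lamplighter_level n m g = lamplighter_level n m h \<longleftrightarrow>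
    (\<forall>i<n. reduce m (\<lambda>j. fst g j i) = reduce m (\<lambda>j. fst h j i)) \<and> snd g mod int p ^ m = snd h mod int p ^ m"
  by (auto simp: lamplighter_level_def fun_eq_iff restrict_def)

lemma card_lamplighter_level:
  "card (lamplighter_level n m ` carrier (lamplighter p n)) = p ^ (p ^ m * n + m)"
proof -
  let ?Q = "carrier (group_ring (Fp p) (Z_mod m))"
  have "lamplighter_level n m ` carrier (lamplighter p n) = (\<Pi>\<^sub>E i\<in>{..<n}. ?Q) \<times> {0..<int p ^ m}"
  proof (intro equalityI subsetI)
    fix y assume y: "y \<in> (\<Pi>\<^sub>E i\<in>{..<n}. ?Q) \<times> {0..<int p ^ m}"
    then have fst: "fst y \<in> (\<Pi>\<^sub>E i\<in>{..<n}. ?Q)" and snd: "snd y \<in> {0..<int p ^ m}"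
      by (simp_all only: mem_Times_iff)
    have "\<exists>r. r \<in> carrier (Laurent p) \<and> reduce m r = fst y i" if "i < n" for i
    proof -
      have "fst y i \<in> reduce m ` carrier (Laurent p)"
        unfolding reduce_surj using that by (intro PiE_mem[OF fst]) simp
      then obtain r where "fst y i = reduce m r" "r \<in> carrier (Laurent p)"
        by (rule imageE)
      then show ?thesis
        by (intro exI[of _ r]) simp
    qed
    then obtain r where r: "\<And>i. i < n \<Longrightarrow> r i \<in> carrier (Laurent p) \<and> reduce m (r i) = fst y i"
      by metis
    let ?g = "(\<lambda>j. \<lambda>i\<in>{..<n}. r i j, snd y)"
    have "?g \<in> carrier (lamplighter p n)"
      using r lamps_of_rows[of n r] by (simp add: carrier_lamplighter)
    moreover have "lamplighter_level n m ?g = y"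
    proof (rule prod_eqI)
      show "fst (lamplighter_level n m ?g) = fst y"
      proof (rule extensionalityI[of _ "{..<n}"])
        show "fst (lamplighter_level n m ?g) i = fst y i" if "i \<in> {..<n}" for i
          using r that by (simp add: lamplighter_level_def)
      qed (use fst in \<open>simp_all add: lamplighter_level_def PiE_iff\<close>)
      show "snd (lamplighter_level n m ?g) = snd y"
        using snd by (simp add: lamplighter_level_def)
    qed
    ultimately show "y \<in> lamplighter_level n m ` carrier (lamplighter p n)"
      by (metis imageI)
  next
    fix y assume "y \<in> lamplighter_level n m ` carrier (lamplighter p n)"
    then show "y \<in> (\<Pi>\<^sub>E i\<in>{..<n}. ?Q) \<times> {0..<int p ^ m}"
      using p_gt_1 level.map_in by (auto simp: lamplighter_level_def carrier_lamplighter lamps_mem)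
  qed
  then show ?thesis
    using p_gt_1
    by (simp add: card_cartesian_product card_PiE card_group_ring_Z_mod nat_power_eq power_add power_mult)
qed

lemma pow_shift: "(\<lambda>j. \<lambda>i\<in>{..<n}. 0, k) [^]\<^bsub>lamplighter p n\<^esub> (a :: nat) = (\<lambda>j. \<lambda>i\<in>{..<n}. 0, int a * k)"
  by (induction a) (auto simp: lamplighter_one lamplighter_mult algebra_simps fun_eq_iff)

text \<open>
  A normal subgroup containing the shift \<open>t\<close> by \<open>p^m\<close> contains every \<open>u t u\<^sup>-\<^sup>1 t\<^sup>-\<^sup>1\<close>, hence the multiples
  of \<open>1 - x^(p^m)\<close>.
\<close>

lemma lamplighter_cofinal:
  assumes N: "N \<in> pro_p_normals p (lamplighter p n)"
  shows "\<exists>m. {g \<in> carrier (lamplighter p n). lamplighter_level n m g = lamplighter_level n m \<one>\<^bsub>lamplighter p n\<^esub>} \<subseteq> N"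
proof -
  let ?G = "lamplighter p n" and ?z = "\<lambda>j::int. \<lambda>i\<in>{..<n}. 0::int"
  interpret G: group ?G
    by (rule group_lamplighter)
  interpret N: normal N ?G
    using N by (simp add: pro_p_normals_def)
  obtain m where m: "\<And>g. g \<in> carrier ?G \<Longrightarrow> g [^]\<^bsub>?G\<^esub> (p ^ m) \<in> N"
    using G.pro_p_normals_pow[OF N] by blast
  have z: "?z \<in> lamps n"
    using G.one_closed by (simp add: lamplighter_one carrier_lamplighter)
  \<comment> \<open>The power of a pure shift by \<open>k\<close> with exponent \<open>p ^ m\<close>
    is the pure shift by \<open>p^m k\<close>.\<close>
  have shift: "(?z, int p ^ m * k) \<in> N" for k
    using m[of "(?z, k)"] z by (simp add: carrier_lamplighter pow_shift)
  have "g \<in> N" if g: "g \<in> carrier ?G" "lamplighter_level n m g = lamplighter_level n m \<one>\<^bsub>?G\<^esub>" for g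
  proof -
    obtain f l where fl: "g = (f, l)" "f \<in> lamps n"
      using g(1) by (auto simp: carrier_lamplighter)
    have f0: "(\<lambda>j. f j i) \<in> carrier (Laurent p)" "reduce m (\<lambda>j. f j i) = reduce m \<zero>\<^bsub>Laurent p\<^esub>"
      if "i < n" for i
      using g(2) fl that
      by (auto simp: lamps_mem lamplighter_level_eq_iff lamplighter_one L.group_ring_zero restrict_UNIV)
    obtain k where l: "l = int p ^ m * k"
      using g(2) fl(1)
        by (auto simp: lamplighter_level_eq_iff lamplighter_one mod_eq_0_iff_dvd elim: dvdE)
    have "\<exists>r\<in>carrier (Laurent p). (\<lambda>j. f j i) \<oplus>\<^bsub>Laurent p\<^esub> (monomial (int p ^ m) \<otimes>\<^bsub>Laurent p\<^esub> r) = r"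
      if "i < n" for i
      using reduce_eq_zero_imp_difference[OF f0[OF that]] by blast
    then obtain r where r: "\<And>i. i < n \<Longrightarrow> r i \<in> carrier (Laurent p) \<and>
        (\<lambda>j. f j i) \<oplus>\<^bsub>Laurent p\<^esub> (monomial (int p ^ m) \<otimes>\<^bsub>Laurent p\<^esub> r i) = r i"
      by metis
    \<comment> \<open>Row by row \<open>f = (1 - x^(p^m)) h\<close>.\<close>
    define h where "h = (\<lambda>j. \<lambda>i\<in>{..<n}. r i j)"
    have h: "h \<in> lamps n"
      unfolding h_def using r by (intro lamps_of_rows) blast
    have row_h: "(\<lambda>j. h j i) = r i" if "i < n" for i
      using that by (simp add: h_def)
    let ?f = "(f, 0)" and ?t = "(?z, int p ^ m)" and ?u = "(h, 0)"
    have in_G: "?f \<in> carrier ?G" "?t \<in> carrier ?G" "?u \<in> carrier ?G"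
      using fl h z by (simp_all add: carrier_lamplighter)
    have ft: "?f \<otimes>\<^bsub>?G\<^esub> (?z, k) = (f, k)" for k
      by (simp add: lamplighter_mult lamps_mod[OF fl(2)] lamps_ext[OF fl(2)] cong: restrict_cong)
    have "fst (?f \<otimes>\<^bsub>?G\<^esub> ?t \<otimes>\<^bsub>?G\<^esub> ?u) = h"
    proof (rule lamps_eqI)
      show "fst (?f \<otimes>\<^bsub>?G\<^esub> ?t \<otimes>\<^bsub>?G\<^esub> ?u) \<in> lamps n"
        unfolding ft using lamplighter_mult_in[OF fl(2) h]
          by (auto simp: carrier_lamplighter mem_Times_iff)
      show "(\<lambda>j. fst (?f \<otimes>\<^bsub>?G\<^esub> ?t \<otimes>\<^bsub>?G\<^esub> ?u) j i) = (\<lambda>j. h j i)" if "i < n" for i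
        unfolding ft lamplighter_mult_row[OF h that] row_h[OF that] using r[OF that] by blast
    qed (rule h)
    moreover have "?u \<otimes>\<^bsub>?G\<^esub> ?t = (h, int p ^ m)"
      by (simp add: lamplighter_mult lamps_mod[OF h] lamps_ext[OF h] cong: restrict_cong)
    moreover have "snd (?f \<otimes>\<^bsub>?G\<^esub> ?t \<otimes>\<^bsub>?G\<^esub> ?u) = int p ^ m"
      by (simp add: lamplighter_mult)
    \<comment> \<open>This is \<open>f + x^(p^m) h = h\<close> written in the group. So
      \<open>?f\<close> times \<open>?t\<close> is the conjugate of \<open>?t\<close> by
      \<open>?u\<close> and lies in \<open>N\<close>; cancelling \<open>?t\<close> leaves
      \<open>?f\<close>.\<close>
    ultimately have "?f \<otimes>\<^bsub>?G\<^esub> ?t \<otimes>\<^bsub>?G\<^esub> ?u = ?u \<otimes>\<^bsub>?G\<^esub> ?t"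
      by (metis prod.collapse)
    then have "?f \<otimes>\<^bsub>?G\<^esub> ?t = ?u \<otimes>\<^bsub>?G\<^esub> ?t \<otimes>\<^bsub>?G\<^esub> inv\<^bsub>?G\<^esub> ?u"
      using in_G G.inv_solve_right[of "?f \<otimes>\<^bsub>?G\<^esub> ?t" "?u \<otimes>\<^bsub>?G\<^esub> ?t" ?u] by simp
    moreover have t: "?t \<in> N"
      using shift[of 1] by simp
    ultimately have "?f \<otimes>\<^bsub>?G\<^esub> ?t \<in> N"
      using N.inv_op_closed2[OF in_G(3) t] by simp
    then have "?f \<otimes>\<^bsub>?G\<^esub> ?t \<otimes>\<^bsub>?G\<^esub> inv\<^bsub>?G\<^esub> ?t \<in> N"
      using t by simp
    then have "?f \<in> N"
      using in_G by (simp add: G.m_assoc)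
    \<comment> \<open>The element splits into its lamps and a pure shift by the multiple
      \<open>l\<close> of \<open>p^m\<close>, which is in \<open>N\<close> already.\<close>
    then have "?f \<otimes>\<^bsub>?G\<^esub> (?z, l) \<in> N"
      using shift[of k] l by simp
    then show "g \<in> N"
      unfolding ft fl(1) .
  qed
  then show ?thesis
    by blast
qed

lemma pro_p_chain_lamplighter: "pro_p_chain (lamplighter p n) p (lamplighter_level n)"
proof (intro pro_p_chain.intro pro_p_chain_axioms.intro group_lamplighter lamplighter_cofinal)
  fix g g' h h' m
  assume G: "g \<in> carrier (lamplighter p n)" "g' \<in> carrier (lamplighter p n)"
      "h \<in> carrier (lamplighter p n)" "h' \<in> carrier (lamplighter p n)"
    and eq: "lamplighter_level n m g = lamplighter_level n m g'" "lamplighter_level n m h = lamplighter_level n m h'"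
  obtain a k a' k' b l b' l' where ab: "g = (a, k)" "g' = (a', k')" "h = (b, l)" "h' = (b', l')"
    by (metis surj_pair)
  have in_lamps: "a \<in> lamps n" "a' \<in> lamps n" "b \<in> lamps n" "b' \<in> lamps n"
    using G by (simp_all add: ab carrier_lamplighter)
  have k: "k mod int p ^ m = k' mod int p ^ m" and l: "l mod int p ^ m = l' mod int p ^ m"
    using eq by (simp_all add: ab lamplighter_level_eq_iff)
  have "reduce m (\<lambda>j. fst (g \<otimes>\<^bsub>lamplighter p n\<^esub> h) j i)
      = reduce m (\<lambda>j. fst (g' \<otimes>\<^bsub>lamplighter p n\<^esub> h') j i)"
    if i: "i < n" for i
  proof -
    have rows: "(\<lambda>j. a j i) \<in> carrier (Laurent p)" "(\<lambda>j. a' j i) \<in> carrier (Laurent p)"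
      "(\<lambda>j. b j i) \<in> carrier (Laurent p)" "(\<lambda>j. b' j i) \<in> carrier (Laurent p)"
      using in_lamps i by (simp_all add: lamps_mem)
    have "reduce m (\<lambda>j. a j i) = reduce m (\<lambda>j. a' j i)" "reduce m (\<lambda>j. b j i) = reduce m (\<lambda>j. b' j i)"
      using eq i by (simp_all add: ab lamplighter_level_eq_iff)
    \<comment> \<open>The shift part of the left factor acts on the lamps of the right one; its
      action at level \<open>m\<close> must depend only on \<open>k\<close> modulo
      \<open>p^m\<close>.\<close>
    moreover have "reduce m (monomial k) = reduce m (monomial k')"
      by (simp add: reduce_monomial k)
    ultimately show ?thesis
      unfolding ab lamplighter_mult_row[OF in_lamps(3) i] lamplighter_mult_row[OF in_lamps(4) i]
      using rows by (simp add: level.map_add level.map_mult[OF mod_hom] monomial_in)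
  qed
  moreover have "snd (g \<otimes>\<^bsub>lamplighter p n\<^esub> h) mod int p ^ m
      = snd (g' \<otimes>\<^bsub>lamplighter p n\<^esub> h') mod int p ^ m"
    using mod_add_cong[OF k l] by (simp add: ab lamplighter_mult)
  ultimately show "lamplighter_level n m (g \<otimes>\<^bsub>lamplighter p n\<^esub> h)
      = lamplighter_level n m (g' \<otimes>\<^bsub>lamplighter p n\<^esub> h')"
    by (simp add: lamplighter_level_eq_iff)
next
  fix g h m
  assume gh: "g \<in> carrier (lamplighter p n)" "h \<in> carrier (lamplighter p n)"
    and "lamplighter_level n (Suc m) g = lamplighter_level n (Suc m) h"
  then have eq: "\<And>i. i < n \<Longrightarrow> reduce (Suc m) (\<lambda>j. fst g j i) = reduce (Suc m) (\<lambda>j. fst h j i)"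
    "snd g mod int p ^ Suc m = snd h mod int p ^ Suc m"
    by (simp_all only: lamplighter_level_eq_iff)
  have "reduce m (\<lambda>j. fst g j i) = reduce m (\<lambda>j. fst h j i)" if i: "i < n" for i
  proof (rule reduce_Suc[OF _ _ eq(1)[OF i]])
    show "(\<lambda>j. fst g j i) \<in> carrier (Laurent p)" "(\<lambda>j. fst h j i) \<in> carrier (Laurent p)"
      using gh i by (auto simp: carrier_lamplighter lamps_mem)
  qed
  moreover have "snd g mod int p ^ m = snd h mod int p ^ m"
    using eq(2) mod_power_mod[of m "Suc m" "snd g"] mod_power_mod[of m "Suc m" "snd h"]
    by (simp only: le_SucI[OF order_refl])
  ultimately show "lamplighter_level n m g = lamplighter_level n m h"
    by (simp add: lamplighter_level_eq_iff)
next
  show "\<exists>k. card (lamplighter_level n m ` carrier (lamplighter p n)) = p ^ k" for m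
    using card_lamplighter_level by blast
qed

section \<open>The semidirect product as a completion of the lamplighter group\<close>

abbreviation zp_elem :: "(nat \<Rightarrow> int) \<Rightarrow> (nat \<Rightarrow> int) set \<Rightarrow> (nat \<Rightarrow> int) set \<Rightarrow> int" where
  "zp_elem \<equiv> completed_group_elem (Fp p) (Zp p) (Zp_top p)"

lemma zp_elem_in:
  assumes z: "z \<in> carrier (Zp p)" shows "zp_elem z \<in> carrier (Fp_Zp p)"
proof -
  have "zp_elem z \<in> inv_lim (open_normals (Zp p) (Zp_top p)) (\<lambda>U V. V \<subseteq> U)
    (\<lambda>V U. group_ring_map (Fp p) (Zp p Mod V) (Zp p Mod U) (\<lambda>C. U <#>\<^bsub>Zp p\<^esub> C))
    (\<lambda>U. carrier (group_ring (Fp p) (Zp p Mod U)))"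
  proof (rule inverse_system.limI[OF inverse_system_open_normals])
    have rcos: "U #>\<^bsub>Zp p\<^esub> z \<in> carrier (Zp p Mod U)" for U
      using z by (auto simp: FactGroup_def RCOSETS_def)
    show "zp_elem z \<in> extensional (open_normals (Zp p) (Zp_top p))"
      by (simp add: completed_group_elem_def)
    show "zp_elem z U \<in> carrier (group_ring (Fp p) (Zp p Mod U))"
      if U: "U \<in> open_normals (Zp p) (Zp_top p)" for U
    proof -
      interpret group_ring_Fp_map Z "Zp p Mod U" p "Zp_rcos U"
        using U by (rule group_ring_Fp_map_Zp_rcos)
      show ?thesis
        using U rcos by (simp add: completed_group_elem_def H.group_elem_in)
    qed
    show "group_ring_map (Fp p) (Zp p Mod V) (Zp p Mod U) (\<lambda>C. U <#>\<^bsub>Zp p\<^esub> C) (zp_elem z V)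
        = zp_elem z U"
      if U: "U \<in> open_normals (Zp p) (Zp_top p)" and V: "V \<in> open_normals (Zp p) (Zp_top p)" and "V \<subseteq> U" for U V
    proof -
      interpret group_ring_Fp_map "Zp p Mod V" "Zp p Mod U" p "\<lambda>C. U <#>\<^bsub>Zp p\<^esub> C"
        using that by (rule group_ring_Fp_map_rcos_rcos)
      have "U <#>\<^bsub>Zp p\<^esub> (V #>\<^bsub>Zp p\<^esub> z) = U #>\<^bsub>Zp p\<^esub> z"
        using that z by (intro Zp.normal_absorb) (auto simp: open_normals_def)
      then show ?thesis
        using that rcos by (simp add: completed_group_elem_def map_group_elem)
    qed
  qed
  then show ?thesis
    by (simp add: completed_group_ring_def inv_lim_ring_def)
qed

text \<open>At level \<open>m\<close> the group element of \<open>z\<close> is the monomial of any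
  integer congruent to \<open>z\<close>; hence the action of the p-adic integers is approximated by
  the shift of the lamps.\<close>

lemma zp_elem_approx:
  assumes "z \<in> carrier (Zp p)" "z m = k mod int p ^ m"
  shows "zp_elem z (Zp_level.ker m) = Fp_Zp_reduce (Zp_level.ker m) (monomial k)"
proof -
  interpret group_ring_Fp_map Z "Zp p Mod Zp_level.ker m" p "Zp_rcos (Zp_level.ker m)"
    using Zp_level_open by (rule group_ring_Fp_map_Zp_rcos)
  show ?thesis
    using Zp_level_open[of m] Zp_level_cong[OF assms]
      by (simp add: completed_group_elem_def map_group_elem)
qed

sublocale Fp_Zp: ring_completion "Fp_Zp p" "Fp_Zp_top p" "Laurent p" reduce
  "\<lambda>m x r. x (Zp_level.ker m) = Fp_Zp_reduce (Zp_level.ker m) r" "Fp_Zp_map p"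
  by (rule ring_completion_Fp_Zp)

lemma carrier_Fp_Zp_semidirect:
  "carrier (Fp_Zp_semidirect p n) = (\<Pi>\<^sub>E i\<in>{..<n}. carrier (Fp_Zp p)) \<times> carrier (Zp p)"
  by (simp add: Fp_Zp_semidirect_def semidirect_def)

lemma Fp_Zp_semidirect_mult:
  "(v, z) \<otimes>\<^bsub>Fp_Zp_semidirect p n\<^esub> (w, y)
    = (\<lambda>i\<in>{..<n}. v i \<oplus>\<^bsub>Fp_Zp p\<^esub> (zp_elem z \<otimes>\<^bsub>Fp_Zp p\<^esub> w i), z \<otimes>\<^bsub>Zp p\<^esub> y)"
  by (simp add: Fp_Zp_semidirect_def semidirect_def product_group_def cong: restrict_cong)

text \<open>The approximation relation inherited from the factors: the semidirect product is not
  itself given as an inverse limit, so there is no single coordinate to compare.\<close>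

definition semidirect_approx ::
  "nat \<Rightarrow> nat \<Rightarrow> (nat \<Rightarrow> (nat \<Rightarrow> int) set \<Rightarrow> (nat \<Rightarrow> int) set \<Rightarrow> int) \<times> (nat \<Rightarrow> int) \<Rightarrow>
    (int \<Rightarrow> nat \<Rightarrow> int) \<times> int \<Rightarrow> bool" where
  "semidirect_approx n m x g \<longleftrightarrow>
    (\<forall>i\<in>{..<n}. fst x i (Zp_level.ker m) = Fp_Zp_reduce (Zp_level.ker m) (\<lambda>j. fst g j i)) \<and>
    snd x m = snd g mod int p ^ m"

text \<open>As a topological space the semidirect product is a finite power times the p-adic
  integers, so the product constructions apply; the twisted multiplication is treated
  separately.\<close>

lemma completion_semidirect:
  "completion (carrier (Fp_Zp_semidirect p n)) (Fp_Zp_semidirect_top p n) (carrier (lamplighter p n))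
    (lamplighter_level n) (semidirect_approx n)"
proof -
  have "completion (\<Pi>\<^sub>E i\<in>{..<n}. carrier (Fp_Zp p)) (product_topology (\<lambda>_. Fp_Zp_top p) {..<n}) (lamps n)
    (\<lambda>m f. \<lambda>i\<in>{..<n}. reduce m (\<lambda>j. f j i))
    (\<lambda>m x f. \<forall>i\<in>{..<n}. x i (Zp_level.ker m) = Fp_Zp_reduce (Zp_level.ker m) (\<lambda>j. f j i))"
  proof (rule completion_power[OF Fp_Zp.completion_axioms])
    show "(\<lambda>j. f j i) \<in> carrier (Laurent p)" if "i \<in> {..<n}" "f \<in> lamps n" for i f
      using that by (simp add: lamps_mem)
    show "\<exists>f\<in>lamps n. \<forall>i\<in>{..<n}. (\<lambda>j. f j i) = r i" if "\<And>i. i \<in> {..<n} \<Longrightarrow> r i \<in> carrier (Laurent p)" for r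
      using that lamps_of_rows[of n r] by (intro bexI[of _ "\<lambda>j. \<lambda>i\<in>{..<n}. r i j"]) auto
  qed simp
  from completion_prod[OF this Zp.completion_axioms] show ?thesis
    unfolding carrier_Fp_Zp_semidirect Fp_Zp_semidirect_top_def carrier_lamplighter
      lamplighter_level_def[abs_def] semidirect_approx_def[abs_def] by simp
qed

lemma monoid_completion_semidirect:
  "monoid_completion (Fp_Zp_semidirect p n) (Fp_Zp_semidirect_top p n) (lamplighter p n)
    (lamplighter_level n) (semidirect_approx n) (Fp_Zp_semidirect_map p n)"
proof (rule monoid_completion.intro[OF completion_semidirect monoid_completion_axioms.intro])
  show "g \<otimes>\<^bsub>lamplighter p n\<^esub> h \<in> carrier (lamplighter p n)"
    if "g \<in> carrier (lamplighter p n)" "h \<in> carrier (lamplighter p n)" for g h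
    using that lamplighter_mult_in by (auto simp: carrier_lamplighter)
next
  fix x y assume x: "x \<in> carrier (Fp_Zp_semidirect p n)" and y: "y \<in> carrier (Fp_Zp_semidirect p n)"
  obtain v z w y' where vw: "x = (v, z)" "y = (w, y')"
    by (metis surj_pair)
  have in_carrier: "z \<in> carrier (Zp p)" "y' \<in> carrier (Zp p)"
    "\<And>i. i < n \<Longrightarrow> v i \<in> carrier (Fp_Zp p)" "\<And>i. i < n \<Longrightarrow> w i \<in> carrier (Fp_Zp p)"
    using x y by (auto simp: vw carrier_Fp_Zp_semidirect PiE_iff)
  then show "x \<otimes>\<^bsub>Fp_Zp_semidirect p n\<^esub> y \<in> carrier (Fp_Zp_semidirect p n)"
    by (simp add: vw Fp_Zp_semidirect_mult carrier_Fp_Zp_semidirect Fp_Zp.lim_add_in Fp_Zp.lim_mult_in zp_elem_in)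
  fix g h m
  assume g: "g \<in> carrier (lamplighter p n)" and h: "h \<in> carrier (lamplighter p n)"
    and approx: "semidirect_approx n m x g" "semidirect_approx n m y h"
  obtain a k b l where ab: "g = (a, k)" "h = (b, l)"
    by (metis surj_pair)
  have in_lamps: "a \<in> lamps n" "b \<in> lamps n"
    using g h by (simp_all add: ab carrier_lamplighter)
  have zk: "z m = k mod int p ^ m" and yl: "y' m = l mod int p ^ m"
    using approx by (simp_all add: semidirect_approx_def vw ab)
  \<comment> \<open>Both sides have the shape of a sum with a twisted second summand, so the claim
    splits into approximations of \<open>v i\<close>, of the group element of \<open>z\<close> by
    the monomial of \<open>k\<close>, and of \<open>w i\<close>.\<close>
  have "(v i \<oplus>\<^bsub>Fp_Zp p\<^esub> (zp_elem z \<otimes>\<^bsub>Fp_Zp p\<^esub> w i)) (Zp_level.ker m)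
      = Fp_Zp_reduce (Zp_level.ker m) (\<lambda>j. fst (g \<otimes>\<^bsub>lamplighter p n\<^esub> h) j i)" if i: "i < n" for i
    unfolding ab lamplighter_mult_row[OF in_lamps(2) i]
  proof (intro Fp_Zp.approx_add Fp_Zp.approx_mult Fp_Zp.mult_in Fp_Zp.lim_mult_in zp_elem_in monomial_in zp_elem_approx)
    show "v i (Zp_level.ker m) = Fp_Zp_reduce (Zp_level.ker m) (\<lambda>j. a j i)"
      "w i (Zp_level.ker m) = Fp_Zp_reduce (Zp_level.ker m) (\<lambda>j. b j i)"
      using approx i by (simp_all add: semidirect_approx_def vw ab)
  qed (use in_carrier in_lamps i zk in \<open>simp_all add: lamps_mem\<close>)
  moreover have "(z \<otimes>\<^bsub>Zp p\<^esub> y') m = (k + l) mod int p ^ m"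
    using Zp.approx_mult[OF in_carrier(1,2) _ _ zk yl] by simp
  ultimately show "semidirect_approx n m (x \<otimes>\<^bsub>Fp_Zp_semidirect p n\<^esub> y) (g \<otimes>\<^bsub>lamplighter p n\<^esub> h)"
    by (simp add: semidirect_approx_def vw ab Fp_Zp_semidirect_mult) (simp add: lamplighter_mult)
next
  fix g assume "g \<in> carrier (lamplighter p n)"
  then obtain f k where g: "g = (f, k)" "\<And>i. i < n \<Longrightarrow> (\<lambda>j. f j i) \<in> carrier (Laurent p)"
    by (auto simp: carrier_lamplighter lamps_mem)
  show "Fp_Zp_semidirect_map p n g \<in> carrier (Fp_Zp_semidirect p n)"
    using g Fp_Zp.embed_in Zp_map_in by (simp add: Fp_Zp_semidirect_map_def carrier_Fp_Zp_semidirect)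
  show "semidirect_approx n m (Fp_Zp_semidirect_map p n g) g" for m
    using g Fp_Zp.approx_embed by (simp add: Fp_Zp_semidirect_map_def semidirect_approx_def Zp_map_def)
qed

end

theorem lemma3p30:
  fixes p n :: nat
  assumes "prime p" and "n \<ge> 1"
  shows
    "(\<exists>\<phi> \<in> top_group_iso (pro_p_completion p (lamplighter p n)) (pro_p_completion_top p (lamplighter p n))
              (Fp_Zp_semidirect p n) (Fp_Zp_semidirect_top p n).
        \<forall>g \<in> carrier (lamplighter p n).
          \<phi> (pro_p_map p (lamplighter p n) g) = Fp_Zp_semidirect_map p n g)
     \<and> (\<exists>\<phi> \<in> top_group_iso (pro_p_completion p integer_group) (pro_p_completion_top p integer_group)
              (Zp p) (Zp_top p).
        \<forall>k \<in> carrier integer_group. \<phi> (pro_p_map p integer_group k) = Zp_map p k)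
     \<and> (\<exists>\<phi> \<in> top_ring_iso (pro_p_group_ring p (Fp p) integer_group) (pro_p_group_ring_top p (Fp p) integer_group)
              (Fp_Zp p) (Fp_Zp_top p).
        \<forall>r \<in> carrier (Laurent p). \<phi> (pro_p_group_ring_map p (Fp p) integer_group r) = Fp_Zp_map p r)
     \<and> (\<exists>\<phi> \<in> top_ring_iso (Fp_Zp p) (Fp_Zp_top p) (lim_group_ring p) (lim_group_ring_top p).
        \<forall>r \<in> carrier (Laurent p). \<phi> (Fp_Zp_map p r) = lim_group_ring_map p r)"
proof -
  interpret p_adic p
    using prime_gt_1_nat[OF \<open>prime p\<close>] by unfold_locales
  show ?thesis
    \<comment> \<open>In each conjunct the two completions carry the same level map:
      \<open>lamplighter_level n\<close> for the first, remainders modulo \<open>p^m\<close> for the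
      second, and \<open>reduce\<close> for the two ring isomorphisms.\<close>
    by (intro conjI
        top_group_iso_completions[OF pro_p_chain.monoid_completion_pro_p[OF pro_p_chain_lamplighter]
          monoid_completion_semidirect]
        top_group_iso_completions[OF pro_p_chain.monoid_completion_pro_p[OF pro_p_chain_integers]
          monoid_completion_Zp]
        top_ring_iso_completions[OF ring_completion_pro_p_group_ring ring_completion_Fp_Zp]
        top_ring_iso_completions[OF ring_completion_Fp_Zp ring_completion_levels])
qed

end
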